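(* Let $G$ be an undirected graph with vertex set $\{1,\ldots,p\}$ and let $X_1,\ldots,X_n$ be independent and identically $E_p(\mu,S,g)$ distributed with $S^{-1}\in\mathscr{S}^+_p(G)$. Let $u_1,u_2$ be weight functions, let $(\hat\mu_P,\hat S_P)$ be the corresponding plug-in $M$-estimators and $(\hat\mu_M,\hat S_M)$ the corresponding graphical $M$-estimators of location and scatter under $G$, as defined in the context. If the functions $u_1$, $u_2$ and $g$ are such that the monotonicity conditions on $u_1,u_2$ and the $M$-estimation regularity conditions stated in the context are satisfied, then $$\sqrt n\left\{(\hat\mu_P,\mathrm{vec}\,\hat S_P)-(\hat\mu_M,\mathrm{vec}\,\hat S_M)\right\}\to0$$ in probability as $n\to\infty$.
   Context: Matrix sets: $\mathscr{S}^+_p$ is the set of symmetric positive definite real $p\times p$ matrices. For an undirected graph $G$ (no loops) with vertex set $\{1,\dots,p\}$ and edge set $E$, $\mathscr{S}^+_p(G)=\{A\in\mathscr{S}^+_p: A_{i,j}=0\text{ whenever }i\ne j,\ \{i,j\}\notin E\}$. $\mathrm{vec}$ stacks the columns of a matrix; $v(A)\in\mathbb{R}^{m}$, $m=p(p+1)/2$, is obtained from $\mathrm{vec}\,A$ ($A$ symmetric) by deleting the super-diagonal elements. $K(G)=\{(i,j):1\le j<i\le p,\ \{i,j\}\in E\}\cup\{(i,i):1\le i\le p\}$, which has $m-q$ elements, where $q$ is the number of absent edges; $Q_K\mathrm{vec}\,A$ is the vector of the elements $A_{i,j}$, $(i,j)\in K(G)$, in the order in which they appear in $\mathrm{vec}\,A$.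 Elliptical distributions: $E_p(\mu,S,g)$, with $\mu\in\mathbb{R}^p$, $S\in\mathscr{S}^+_p$, $g:[0,\infty)\to[0,\infty)$, is the distribution on $\mathbb{R}^p$ with Lebesgue density $f(x)=\det(S)^{-1/2}g\{(x-\mu)^TS^{-1}(x-\mu)\}$ (where $g$ is such that $f$ integrates to 1). The map $h_G:\mathscr{S}^+_p\to\mathscr{S}^+_p$: $A_G=h_G(A)$ is the unique matrix in $\mathscr{S}^+_p$ with $(A_G)_{i,j}=A_{i,j}$ if $\{i,j\}\in E$ or $i=j$, and $(A_G^{-1})_{i,j}=0$ if $\{i,j\}\notin E$, $i\ne j$. Unconstrained and plug-in $M$-estimators: $(\hat\mu_n,\hat S_n)\in\mathbb{R}^p\times\mathscr{S}^+_p$ is a solution of $$0=\sum_{i=1}^nu_1(\hat R_i)(X_i-\hat\mu_n),\qquad \hat S_n=\frac1n\sum_{i=1}^nu_2(\hat R_i)(X_i-\hat\mu_n)(X_i-\hat\mu_n)^T,$$ where $\hat R_i=(X_i-\hat\mu_n)^T\hat S_n^{-1}(X_i-\hat\mu_n)$. The plug-in $M$-estimators under $G$ are $(\hat\mu_P,\hat S_P)=(\hat\mu_n,h_G(\hat S_n))$. Graphical $M$-estimators: $(\hat\mu_M,\hat S_M)\in\mathbb{R}^p\times\mathscr{S}^+_p$ is a solution of $$0=\sum_{i=1}^nu_1(\hat R_{i,M})(X_i-\hat\mu_M),$$ $$(\hat S_M)_{j,k}=e_j^T\left\{\frac1n\sum_{i=1}^nu_2(\hat R_{i,M})(X_i-\hat\mu_M)(X_i-\hat\mu_M)^T\right\}e_k\quad\text{if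 }\{j,k\}\in E\text{ or }j=k,$$ $$(\hat S_M^{-1})_{j,k}=0\quad\text{if }\{j,k\}\notin E,\ j\ne k,$$ where $\hat R_{i,M}=(X_i-\hat\mu_M)^T\hat S_M^{-1}(X_i-\hat\mu_M)$ and $e_1,\ldots,e_p$ are the unit vectors of $\mathbb{R}^p$. Monotonicity conditions: $u_1$ and $u_2$ are non-increasing, while $\phi_1(s)=su_1(s)$ and $\phi_2(s)=su_2(s)$ are non-decreasing. $M$-estimation regularity conditions: both the system of estimating equations of the unconstrained $M$-estimator $(\hat\mu_n,\hat S_n)$, namely $0=\sum_{i=1}^nu_1(\hat R_i)(X_i-\hat\mu_n)$ and $\hat S_n=\frac1n\sum_{i=1}^nu_2(\hat R_i)(X_i-\hat\mu_n)(X_i-\hat\mu_n)^T$, and the system of estimating equations of the graphical $M$-estimator $(\hat\mu_M,\hat S_M)$, namely $0=\sum_{i=1}^nu_1(\hat R_{i,M})(X_i-\hat\mu_M)$ and $(\hat S_M)_{j,k}=e_j^T\{\frac1n\sum_{i=1}^nu_2(\hat R_{i,M})(X_i-\hat\mu_M)(X_i-\hat\mu_M)^T\}e_k$ if $\{j,k\}\in E$ or $j=k$, with $(\hat S_M^{-1})_{j,k}=0$ if $\{j,k\}\notin E$, $j\ne k$, are of the form $n^{-1}\sum_{i=1}^n\psi_j(X_i;\hat\theta)=0$, $j=1,\dots,l$, with $\theta$ ranging over an open subset of $\mathbb{R}^l$. For the unconstrained $M$-estimator, $\theta=(\mu,v(\Sigma))$ with $\Sigma\in\mathscr{S}^+_p$,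 $l=p+m$, and $\psi(x;\theta)=\big(u_1(r)(x-\mu),\ v\{u_2(r)(x-\mu)(x-\mu)^T-\Sigma\}\big)$, $r=(x-\mu)^T\Sigma^{-1}(x-\mu)$. For the graphical $M$-estimator, $\theta=(\mu,k)$, where $k=Q_K\mathrm{vec}\,K\in\mathbb{R}^{m-q}$ parametrizes $K\in\mathscr{S}^+_p(G)$, $l=p+m-q$, and $\psi(x;\theta)=\big(u_1(r)(x-\mu),\ Q_K\mathrm{vec}\{K^{-1}-u_2(r)(x-\mu)(x-\mu)^T\}\big)$, $r=(x-\mu)^TK(x-\mu)$. With $F=E_p(\mu,S,g)$ the common distribution of the $X_i$, it is assumed, for each of these two systems, that: (I) There is a unique solution $\theta_F=(\theta_1,\dots,\theta_l)$ to $E_F\{\psi(X;\theta)\}=0$. (II) For any sequence $\hat\theta$ satisfying the estimating equations, $\hat\theta\to\theta_F$ in probability. (III) For $j=1,\dots,l$, $$0=\frac1n\sum_{i=1}^n\psi_j(X_i;\theta_F)+\sum_{k=1}^l(\hat\theta_k-\theta_k)\left[\frac1n\sum_{i=1}^n\frac{\partial\psi_j(X_i;\theta_F)}{\partial\theta_k}+r_{j,k,n}\right],$$ where $r_{j,k,n}\to0$ in probability as $n\to\infty$. (IV) The expectations $b_{j,k}=E_F\{\partial\psi_j(X_i;\theta_F)/\partial\theta_k\}$ and $a_{j,k}=E_F\{\psi_j(X_i;\theta_F)\psi_k(X_i;\theta_F)\}$ exist.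
   Formalization: The formal theorem additionally assumes that the matrix (b_{j,k}) of expected derivatives for the unconstrained M-estimator system is invertible; without this the claim fails, e.g. for p=1 when s·u_2(s) is constant on the support. *)

theory Defs
  imports "HOL-Probability.Probability"
begin

section \<open>Matrices and graphs\<close>

definition spd :: "(real ^ 'p ^ 'p) set" where
  "spd = {A. transpose A = A \<and> (\<forall>x. x \<noteq> 0 \<longrightarrow> 0 < x \<bullet> (A *v x))}"

text \<open>The vertices are the elements of the finite linearly ordered index type; a graph is given by
  its set of edges. The order serves only to select one of the positions (i, j), (j, i).\<close>

definition simple_graph :: "'p set set \<Rightarrow> bool" where
  "simple_graph E \<longleftrightarrow> (\<forall>e\<in>E. card e = 2)"

definition spd_graph :: "'p set set \<Rightarrow> (real ^ 'p ^ 'p) set" where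
  "spd_graph E = {A \<in> spd. \<forall>i j. i \<noteq> j \<and> {i, j} \<notin> E \<longrightarrow> A $ i $ j = 0}"

definition lower_triangle :: "('p::linorder \<times> 'p) set" where
  "lower_triangle = {(i, j). j \<le> i}"

definition graph_positions :: "'p::linorder set set \<Rightarrow> ('p \<times> 'p) set" where
  "graph_positions E = {(i, j). j < i \<and> {i, j} \<in> E} \<union> {(i, i) |i. True}"

definition h_graph :: "'p set set \<Rightarrow> real ^ 'p ^ 'p \<Rightarrow> real ^ 'p ^ 'p" where
  "h_graph E A = (THE B. B \<in> spd \<and>
     (\<forall>i j. {i, j} \<in> E \<or> i = j \<longrightarrow> B $ i $ j = A $ i $ j) \<and>
     (\<forall>i j. {i, j} \<notin> E \<and> i \<noteq> j \<longrightarrow> matrix_inv B $ i $ j = 0))"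

text \<open>Entries are indexed by (column, row), so the columns are stacked in lexicographic order.\<close>

definition vec_mat :: "real ^ 'p ^ 'p \<Rightarrow> real ^ ('p \<times> 'p)" where
  "vec_mat A = (\<chi> c. A $ snd c $ fst c)"

definition outer :: "real ^ 'p \<Rightarrow> real ^ 'p ^ 'p" where
  "outer x = (\<chi> i j. x $ i * x $ j)"

definition mahalanobis :: "real ^ 'p \<Rightarrow> real ^ 'p ^ 'p \<Rightarrow> real ^ 'p \<Rightarrow> real" where
  "mahalanobis \<mu> S x = (x - \<mu>) \<bullet> (matrix_inv S *v (x - \<mu>))"


section \<open>Elliptical distributions and convergence in probability\<close>

definition elliptical_density ::
    "real ^ 'p \<Rightarrow> real ^ 'p ^ 'p \<Rightarrow> (real \<Rightarrow> real) \<Rightarrow> real ^ 'p \<Rightarrow> real" where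
  "elliptical_density \<mu> S g x = det S powr (- 1 / 2) * g (mahalanobis \<mu> S x)"

definition elliptical ::
    "real ^ 'p \<Rightarrow> real ^ 'p ^ 'p \<Rightarrow> (real \<Rightarrow> real) \<Rightarrow> (real ^ 'p) measure" where
  "elliptical \<mu> S g = density lborel (\<lambda>x. ennreal (elliptical_density \<mu> S g x))"

definition tendsto_in_prob ::
    "'a measure \<Rightarrow> (nat \<Rightarrow> 'a \<Rightarrow> 'b::metric_space) \<Rightarrow> 'b \<Rightarrow> bool" where
  "tendsto_in_prob M Y c \<longleftrightarrow>
     (\<forall>n. Y n \<in> borel_measurable M) \<and>
     (\<forall>\<epsilon>>0. (\<lambda>n. measure M {\<omega> \<in> space M. \<epsilon> < dist (Y n \<omega>) c}) \<longlonglongrightarrow> 0)"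


section \<open>M-estimators\<close>

definition M_equations ::
    "(real \<Rightarrow> real) \<Rightarrow> (real \<Rightarrow> real) \<Rightarrow> nat \<Rightarrow> (nat \<Rightarrow> real ^ 'p) \<Rightarrow>
     real ^ 'p \<Rightarrow> real ^ 'p ^ 'p \<Rightarrow> bool" where
  "M_equations u\<^sub>1 u\<^sub>2 n x \<mu> S \<longleftrightarrow>
     0 = (\<Sum>i<n. u\<^sub>1 (mahalanobis \<mu> S (x i)) *\<^sub>R (x i - \<mu>)) \<and>
     S = (1 / real n) *\<^sub>R (\<Sum>i<n. u\<^sub>2 (mahalanobis \<mu> S (x i)) *\<^sub>R outer (x i - \<mu>))"

definition graphical_M_equations ::
    "'p set set \<Rightarrow> (real \<Rightarrow> real) \<Rightarrow> (real \<Rightarrow> real) \<Rightarrow> nat \<Rightarrow> (nat \<Rightarrow> real ^ 'p) \<Rightarrow>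
     real ^ 'p \<Rightarrow> real ^ 'p ^ 'p \<Rightarrow> bool" where
  "graphical_M_equations E u\<^sub>1 u\<^sub>2 n x \<mu> S \<longleftrightarrow>
     0 = (\<Sum>i<n. u\<^sub>1 (mahalanobis \<mu> S (x i)) *\<^sub>R (x i - \<mu>)) \<and>
     (\<forall>j k. {j, k} \<in> E \<or> j = k \<longrightarrow>
        S $ j $ k =
        ((1 / real n) *\<^sub>R (\<Sum>i<n. u\<^sub>2 (mahalanobis \<mu> S (x i)) *\<^sub>R outer (x i - \<mu>))) $ j $ k) \<and>
     (\<forall>j k. {j, k} \<notin> E \<and> j \<noteq> k \<longrightarrow> matrix_inv S $ j $ k = 0)"

text \<open>Since a scatter matrix computed from few observations cannot be positive definite, the
  equations are required to hold almost surely for all sufficiently large sample sizes; for the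
  remaining ones the estimators are arbitrary.\<close>

definition estimator_sequence ::
    "'a measure \<Rightarrow> (nat \<Rightarrow> 'a \<Rightarrow> real ^ 'p) \<Rightarrow>
     (nat \<Rightarrow> (nat \<Rightarrow> real ^ 'p) \<Rightarrow> real ^ 'p \<Rightarrow> real ^ 'p ^ 'p \<Rightarrow> bool) \<Rightarrow>
     (nat \<Rightarrow> 'a \<Rightarrow> real ^ 'p) \<Rightarrow> (nat \<Rightarrow> 'a \<Rightarrow> real ^ 'p ^ 'p) \<Rightarrow> bool" where
  "estimator_sequence M X eqs \<mu>\<^sub>n S\<^sub>n \<longleftrightarrow>
     (\<forall>n. \<mu>\<^sub>n n \<in> borel_measurable M \<and> S\<^sub>n n \<in> borel_measurable M) \<and>
     (\<forall>n. \<forall>\<omega>\<in>space M. S\<^sub>n n \<omega> \<in> spd) \<and>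
     (\<forall>\<^sub>F n in sequentially. AE \<omega> in M. eqs n (\<lambda>i. X i \<omega>) (\<mu>\<^sub>n n \<omega>) (S\<^sub>n n \<omega>))"

definition monotonicity_conditions :: "(real \<Rightarrow> real) \<Rightarrow> (real \<Rightarrow> real) \<Rightarrow> bool" where
  "monotonicity_conditions u\<^sub>1 u\<^sub>2 \<longleftrightarrow>
     antimono_on {0..} u\<^sub>1 \<and> antimono_on {0..} u\<^sub>2 \<and>
     mono_on {0..} (\<lambda>s. s * u\<^sub>1 s) \<and> mono_on {0..} (\<lambda>s. s * u\<^sub>2 s)"


section \<open>General systems of estimating equations\<close>

text \<open>Parameters are extensional functions on a finite index set \<open>J\<close> and range over \<open>\<Theta>\<close>;
  \<open>\<psi> x \<theta> j\<close> is the \<open>j\<close>-th estimating function.\<close>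

definition population_solution ::
    "'x measure \<Rightarrow> 'i set \<Rightarrow> ('i \<Rightarrow> real) set \<Rightarrow> ('x \<Rightarrow> ('i \<Rightarrow> real) \<Rightarrow> 'i \<Rightarrow> real) \<Rightarrow>
     ('i \<Rightarrow> real) \<Rightarrow> bool" where
  "population_solution F J \<Theta> \<psi> \<theta> \<longleftrightarrow> \<theta> \<in> \<Theta> \<and>
     (\<forall>j\<in>J. integrable F (\<lambda>x. \<psi> x \<theta> j) \<and> (\<integral>x. \<psi> x \<theta> j \<partial>F) = 0)"

definition theta_F ::
    "'x measure \<Rightarrow> 'i set \<Rightarrow> ('i \<Rightarrow> real) set \<Rightarrow> ('x \<Rightarrow> ('i \<Rightarrow> real) \<Rightarrow> 'i \<Rightarrow> real) \<Rightarrow>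
     ('i \<Rightarrow> real)" where
  "theta_F F J \<Theta> \<psi> = (THE \<theta>. population_solution F J \<Theta> \<psi> \<theta>)"

definition solution_sequence ::
    "'a measure \<Rightarrow> (nat \<Rightarrow> 'a \<Rightarrow> 'x) \<Rightarrow> 'i set \<Rightarrow> ('i \<Rightarrow> real) set \<Rightarrow>
     ('x \<Rightarrow> ('i \<Rightarrow> real) \<Rightarrow> 'i \<Rightarrow> real) \<Rightarrow> (nat \<Rightarrow> 'a \<Rightarrow> 'i \<Rightarrow> real) \<Rightarrow> bool" where
  "solution_sequence M X J \<Theta> \<psi> \<theta>\<^sub>n \<longleftrightarrow>
     (\<forall>n. \<forall>j\<in>J. (\<lambda>\<omega>. \<theta>\<^sub>n n \<omega> j) \<in> borel_measurable M) \<and>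
     (\<forall>n. \<forall>\<omega>\<in>space M. \<theta>\<^sub>n n \<omega> \<in> \<Theta>) \<and>
     (\<forall>\<^sub>F n in sequentially. AE \<omega> in M.
        \<forall>j\<in>J. (1 / real n) * (\<Sum>i<n. \<psi> (X i \<omega>) (\<theta>\<^sub>n n \<omega>) j) = 0)"

definition partial_psi ::
    "('x \<Rightarrow> ('i \<Rightarrow> real) \<Rightarrow> 'i \<Rightarrow> real) \<Rightarrow> 'x \<Rightarrow> ('i \<Rightarrow> real) \<Rightarrow> 'i \<Rightarrow> 'i \<Rightarrow> real" where
  "partial_psi \<psi> x \<theta> j k = deriv (\<lambda>t. \<psi> x (\<theta>(k := t)) j) (\<theta> k)"

definition b_matrix ::
    "'x measure \<Rightarrow> 'i set \<Rightarrow> ('i \<Rightarrow> real) set \<Rightarrow> ('x \<Rightarrow> ('i \<Rightarrow> real) \<Rightarrow> 'i \<Rightarrow> real) \<Rightarrow>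
     'i \<Rightarrow> 'i \<Rightarrow> real" where
  "b_matrix F J \<Theta> \<psi> j k = (\<integral>x. partial_psi \<psi> x (theta_F F J \<Theta> \<psi>) j k \<partial>F)"

text \<open>Invertibility of the matrix b of the unconstrained system is a genuine assumption: it does not
  follow from the regularity conditions below. If \<open>s * u\<^sub>2 s\<close> is constant on the support of
  \<open>mahalanobis \<mu> \<Sigma> X\<close>, where \<open>\<Sigma>\<close> is the population scatter, then b is singular, and the sample
  equations can have two sequences of solutions that differ by more than O(1 / sqrt n).\<close>

definition invertible_on :: "'i set \<Rightarrow> ('i \<Rightarrow> 'i \<Rightarrow> real) \<Rightarrow> bool" where
  "invertible_on J b \<longleftrightarrow> (\<exists>c. \<forall>i\<in>J. \<forall>j\<in>J.
     (\<Sum>k\<in>J. b i k * c k j) = (if i = j then 1 else 0) \<and>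
     (\<Sum>k\<in>J. c i k * b k j) = (if i = j then 1 else 0))"

text \<open>The four conjuncts: identifiability, consistency, first-order expansion, and existence of
  the moments (including almost sure existence of the partial derivatives).\<close>

definition M_estimation_regular ::
    "'a measure \<Rightarrow> (nat \<Rightarrow> 'a \<Rightarrow> 'x) \<Rightarrow> 'x measure \<Rightarrow> 'i set \<Rightarrow> ('i \<Rightarrow> real) set \<Rightarrow>
     ('x \<Rightarrow> ('i \<Rightarrow> real) \<Rightarrow> 'i \<Rightarrow> real) \<Rightarrow> bool" where
  "M_estimation_regular M X F J \<Theta> \<psi> \<longleftrightarrow>
     (let \<theta> = theta_F F J \<Theta> \<psi> in
      (\<exists>!\<theta>'. population_solution F J \<Theta> \<psi> \<theta>') \<and>
      (\<forall>\<theta>\<^sub>n. solution_sequence M X J \<Theta> \<psi> \<theta>\<^sub>n \<longrightarrow>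
         (\<forall>j\<in>J. tendsto_in_prob M (\<lambda>n \<omega>. \<theta>\<^sub>n n \<omega> j) (\<theta> j))) \<and>
      (\<forall>\<theta>\<^sub>n. solution_sequence M X J \<Theta> \<psi> \<theta>\<^sub>n \<longrightarrow>
         (\<exists>r. (\<forall>j\<in>J. \<forall>k\<in>J. tendsto_in_prob M (r j k) 0) \<and>
              (\<forall>j\<in>J. \<forall>\<^sub>F n in sequentially. AE \<omega> in M.
                 0 = (1 / real n) * (\<Sum>i<n. \<psi> (X i \<omega>) \<theta> j) +
                     (\<Sum>k\<in>J. (\<theta>\<^sub>n n \<omega> k - \<theta> k) *
                        ((1 / real n) * (\<Sum>i<n. partial_psi \<psi> (X i \<omega>) \<theta> j k) + r j k n \<omega>))))) \<and>
      (\<forall>j\<in>J. \<forall>k\<in>J.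
         (AE x in F. (\<lambda>t. \<psi> x (\<theta>(k := t)) j) differentiable (at (\<theta> k))) \<and>
         integrable F (\<lambda>x. partial_psi \<psi> x \<theta> j k) \<and>
         integrable F (\<lambda>x. \<psi> x \<theta> j * \<psi> x \<theta> k)))"


section \<open>The systems of the unconstrained and the graphical M-estimator\<close>

text \<open>\<open>coordinates K \<mu> A\<close> is the vector consisting of \<open>\<mu>\<close> and the entries of \<open>A\<close> at the positions
  in \<open>K\<close>; \<open>location_of\<close> and \<open>symmetric_of\<close> recover \<open>\<mu>\<close> and the symmetric matrix \<open>A\<close>.\<close>

definition coordinates ::
    "('p \<times> 'p) set \<Rightarrow> real ^ 'p \<Rightarrow> real ^ 'p ^ 'p \<Rightarrow> ('p + 'p \<times> 'p \<Rightarrow> real)" where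
  "coordinates K \<mu> A =
     restrict (\<lambda>c. case c of Inl i \<Rightarrow> \<mu> $ i | Inr (i, j) \<Rightarrow> A $ i $ j) (UNIV <+> K)"

definition location_of :: "('p + 'p \<times> 'p \<Rightarrow> real) \<Rightarrow> real ^ 'p" where
  "location_of \<theta> = (\<chi> i. \<theta> (Inl i))"

definition symmetric_of :: "('p \<times> 'p) set \<Rightarrow> ('p + 'p \<times> 'p \<Rightarrow> real) \<Rightarrow> real ^ 'p ^ 'p" where
  "symmetric_of K \<theta> = (\<chi> i j. if (i, j) \<in> K then \<theta> (Inr (i, j))
                               else if (j, i) \<in> K then \<theta> (Inr (j, i)) else 0)"

definition unconstrained_params :: "('p::{finite,linorder} + 'p \<times> 'p \<Rightarrow> real) set" where
  "unconstrained_params = {coordinates lower_triangle \<mu> \<Sigma> |\<mu> \<Sigma>. \<Sigma> \<in> spd}"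

definition unconstrained_psi ::
    "(real \<Rightarrow> real) \<Rightarrow> (real \<Rightarrow> real) \<Rightarrow> real ^ 'p::{finite,linorder} \<Rightarrow>
     ('p + 'p \<times> 'p \<Rightarrow> real) \<Rightarrow> ('p + 'p \<times> 'p \<Rightarrow> real)" where
  "unconstrained_psi u\<^sub>1 u\<^sub>2 x \<theta> =
     (let \<mu> = location_of \<theta>; \<Sigma> = symmetric_of lower_triangle \<theta>;
          r = mahalanobis \<mu> \<Sigma> x
      in coordinates lower_triangle (u\<^sub>1 r *\<^sub>R (x - \<mu>)) (u\<^sub>2 r *\<^sub>R outer (x - \<mu>) - \<Sigma>))"

definition graphical_params ::
    "'p set set \<Rightarrow> ('p::{finite,linorder} + 'p \<times> 'p \<Rightarrow> real) set" where
  "graphical_params E = {coordinates (graph_positions E) \<mu> K |\<mu> K. K \<in> spd_graph E}"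

definition graphical_psi ::
    "'p set set \<Rightarrow> (real \<Rightarrow> real) \<Rightarrow> (real \<Rightarrow> real) \<Rightarrow> real ^ 'p::{finite,linorder} \<Rightarrow>
     ('p + 'p \<times> 'p \<Rightarrow> real) \<Rightarrow> ('p + 'p \<times> 'p \<Rightarrow> real)" where
  "graphical_psi E u\<^sub>1 u\<^sub>2 x \<theta> =
     (let \<mu> = location_of \<theta>; K = symmetric_of (graph_positions E) \<theta>;
          r = (x - \<mu>) \<bullet> (K *v (x - \<mu>))
      in coordinates (graph_positions E)
           (u\<^sub>1 r *\<^sub>R (x - \<mu>)) (matrix_inv K - u\<^sub>2 r *\<^sub>R outer (x - \<mu>)))"

end

theory Submission
  imports Defs
begin

text \<open>By uniqueness, the population solution of the unconstrained system inherits the symmetries of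
  the elliptical distribution. Hence it equals \<open>(\<mu>, \<Sigma>)\<close> with \<open>\<Sigma>\<close> a multiple of \<open>S\<close>, the inverse of
  \<open>\<Sigma>\<close> is supported on the graph, and \<open>(\<mu>, matrix_inv \<Sigma>)\<close> is the population solution of the graphical
  system. The first order expansions read \<open>Z + b D = o(1)\<close>, where \<open>D\<close> is the rescaled estimation
  error, \<open>Z\<close> the rescaled mean of the estimating functions, and \<open>b\<close> the matrix of expected
  derivatives. Up to sign, \<open>Z\<close> for the graphical system is the part of \<open>Z\<close> for the unconstrained
  system on the graph. By reflection invariance, \<open>b\<close> does not couple location with scatter, and its
  scatter block is \<open>V \<mapsto> - ((1 + 2 \<kappa>) V + \<kappa> (matrix_inv \<Sigma> \<bullet> V) \<Sigma>)\<close> for the unconstrained system and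
  the composition of this map with \<open>\<Delta> \<mapsto> \<Sigma> \<Delta> \<Sigma>\<close>, restricted to the graph, for the graphical one. The
  inverse of the completion of the unconstrained scatter estimator therefore satisfies the expansion
  of the graphical system, and so does the graphical estimator. Invertibility of the unconstrained
  \<open>b\<close> passes to the graphical one, so the difference of the two vanishes in probability.\<close>

section \<open>Symmetric positive definite matrices\<close>

text \<open>The hinge is that \<open>L = matrix_inv \<Sigma>\<close> is supported on the graph. At a
  graph position, \<open>op_U \<kappa> V\<close> involves \<open>V\<close> only through that entry
  and through \<open>L \<bullet> V\<close>, and \<open>L \<bullet> V\<close> sees only graph
  entries. The completion alters only entries off the graph, so it can be inserted into the
  unconstrained expansion at graph positions. The comparison is made between inverses because there
  the parameter set is an open part of a linear space, whereas the completed matrices need not form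
  one. The expansions come with coefficients that are merely close to b, so they say nothing until
  \<open>D\<close> is known to be stochastically bounded. That bound comes from injectivity of b:
  the error term is a small multiple of \<open>D\<close> and can be absorbed. The same absorption
  replaces differentiability of \<open>h_graph\<close> by its continuity. The weight function
  \<open>u\<^sub>2\<close> is not given as smooth. Its derivative at the distance is recovered,
  almost everywhere, from a diagonal coordinate of the graphical system, in which the distance is
  affine. The weighted fourth moments built from this derivative produce \<open>\<kappa>\<close>,
  which is why one constant serves both systems.\<close>

definition psd :: "(real ^ 'n ^ 'n) set" where
  "psd = {A. transpose A = A \<and> (\<forall>x. 0 \<le> x \<bullet> (A *v x))}"

text \<open>The inner product of the matrix type is the trace form, so \<open>A \<bullet> B\<close>
  denotes the trace of \<open>transpose A ** B\<close> throughout; the lemmas that follow move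
  factors across it.\<close>

lemma inner_matrix: "A \<bullet> B = (\<Sum>i\<in>UNIV. \<Sum>j\<in>UNIV. A $ i $ j * B $ i $ j)"
  for A B :: "real ^ 'n ^ 'm"
  by (simp add: inner_vec_def)

lemma inner_transpose: "transpose A \<bullet> transpose B = A \<bullet> B"
  for A B :: "real ^ 'n ^ 'm"
  unfolding inner_matrix transpose_def by (subst sum.swap) simp

lemma inner_matrix_mult_left: "(A ** B) \<bullet> C = B \<bullet> (transpose A ** C)"
  for A :: "real ^ 'n ^ 'm" and B :: "real ^ 'k ^ 'n"
proof -
  have "(A ** B) \<bullet> C = (\<Sum>i\<in>UNIV. \<Sum>j\<in>UNIV. \<Sum>l\<in>UNIV. A $ i $ l * B $ l $ j * C $ i $ j)"
    by (simp add: inner_matrix matrix_matrix_mult_def sum_distrib_right)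
  also have "\<dots> = (\<Sum>i\<in>UNIV. \<Sum>l\<in>UNIV. \<Sum>j\<in>UNIV. A $ i $ l * B $ l $ j * C $ i $ j)"
    by (rule sum.cong[OF refl], rule sum.swap)
  also have "\<dots> = (\<Sum>l\<in>UNIV. \<Sum>i\<in>UNIV. \<Sum>j\<in>UNIV. A $ i $ l * B $ l $ j * C $ i $ j)"
    by (rule sum.swap)
  also have "\<dots> = (\<Sum>l\<in>UNIV. \<Sum>j\<in>UNIV. \<Sum>i\<in>UNIV. A $ i $ l * B $ l $ j * C $ i $ j)"
    by (rule sum.cong[OF refl], rule sum.swap)
  also have "\<dots> = B \<bullet> (transpose A ** C)"
    by (simp add: inner_matrix matrix_matrix_mult_def transpose_def sum_distrib_left mult_ac)
  finally show ?thesis .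
qed

lemma inner_matrix_mult_right: "(A ** B) \<bullet> C = A \<bullet> (C ** transpose B)"
  for A :: "real ^ 'n ^ 'm" and B :: "real ^ 'k ^ 'n"
proof -
  have "(A ** B) \<bullet> C = (transpose B ** transpose A) \<bullet> transpose C"
    by (metis inner_transpose matrix_transpose_mul)
  also have "\<dots> = transpose A \<bullet> (B ** transpose C)"
    by (simp add: inner_matrix_mult_left)
  also have "\<dots> = A \<bullet> transpose (B ** transpose C)"
    by (metis inner_transpose transpose_transpose)
  finally show ?thesis by (simp add: matrix_transpose_mul)
qed

lemma inner_mat_1: "A \<bullet> mat 1 = (\<Sum>i\<in>UNIV. A $ i $ i)"
  for A :: "real ^ 'n ^ 'n"
  unfolding inner_matrix mat_def
  by (simp add: if_distrib[of "\<lambda>x. _ * x"] cong: if_cong)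

lemma inner_outer: "A \<bullet> outer v = v \<bullet> (A *v v)"
  by (simp add: inner_matrix outer_def inner_vec_def matrix_vector_mult_def sum_distrib_left mult_ac)

lemma transpose_outer [simp]: "transpose (outer v) = outer v"
  by (simp add: outer_def transpose_def mult.commute)

lemma outer_mult_vec: "outer v *v x = (v \<bullet> x) *\<^sub>R v"
  by (simp add: outer_def vec_eq_iff matrix_vector_mult_def inner_vec_def sum_distrib_left
      sum_distrib_right mult_ac)

lemma symmetric_inner_commute:
  fixes A :: "real ^ 'n ^ 'n"
  assumes "transpose A = A"
  shows "x \<bullet> (A *v y) = y \<bullet> (A *v x)"
  by (metis assms dot_lmul_matrix inner_commute vector_transpose_matrix)

lemma matrix_vector_axis: "(A *v axis j 1) $ i = A $ i $ j"
  for A :: "real ^ 'n ^ 'm"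
  by (simp add: matrix_vector_mult_basis column_def)

lemma axis_inner_matrix: "axis i 1 \<bullet> (A *v axis j 1) = A $ i $ j"
  for A :: "real ^ 'n ^ 'm"
  by (simp add: inner_axis' matrix_vector_axis)

text \<open>A zero of a nonnegative quadratic form is a minimum, so the gradient
  \<open>2 *\<^sub>R (A *v x)\<close> vanishes there. The test direction is \<open>A *v x\<close>
  itself.\<close>

lemma psd_kernel:
  assumes "A \<in> psd" "x \<bullet> (A *v x) = 0"
  shows "A *v x = 0"
proof -
  let ?y = "A *v x"
  let ?q = "?y \<bullet> (A *v ?y)"
  have sym: "transpose A = A" and nn: "\<And>z. 0 \<le> z \<bullet> (A *v z)"
    using assms(1) by (auto simp: psd_def)
  have expand: "(x - t *\<^sub>R ?y) \<bullet> (A *v (x - t *\<^sub>R ?y)) = t\<^sup>2 * ?q - 2 * t * (?y \<bullet> ?y)" for t :: real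
    using symmetric_inner_commute[OF sym, of x ?y] assms(2)
    by (simp add: matrix_vector_mult_diff_distrib matrix_vector_mult_scaleR inner_diff_left
        inner_diff_right power2_eq_square algebra_simps)
  have ineq: "2 * t * (?y \<bullet> ?y) \<le> t\<^sup>2 * ?q" for t :: real
    using nn[of "x - t *\<^sub>R ?y"] expand[of t] by simp
  have "?y \<bullet> ?y \<le> 0"
  proof (rule ccontr)
    assume "\<not> ?y \<bullet> ?y \<le> 0"
    then have pos: "0 < ?y \<bullet> ?y" by linarith
    \<comment> \<open>Any small positive \<open>t\<close> contradicts \<open>ineq\<close>. This one
      makes \<open>t * ?q\<close> at most \<open>?y \<bullet> ?y\<close>, and the \<open>+ 1\<close>
      covers the case \<open>?q = 0\<close>.\<close>
    define t where "t = (?y \<bullet> ?y) / (?q + 1)"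
    have q: "0 \<le> ?q" by (rule nn)
    then have t: "0 < t" using pos by (simp add: t_def)
    from ineq[of t] t have "2 * (?y \<bullet> ?y) \<le> t * ?q"
      by (simp add: power2_eq_square)
    also have "\<dots> \<le> ?y \<bullet> ?y"
      using q pos by (simp add: t_def field_simps)
    finally show False using pos by simp
  qed
  then show ?thesis by (metis inner_gt_zero_iff not_le)
qed

lemma psd_diag: "A \<in> psd \<Longrightarrow> 0 \<le> A $ i $ i"
  by (metis (mono_tags, lifting) psd_def axis_inner_matrix mem_Collect_eq)

text \<open>Completing the square: the form of the difference at \<open>x\<close> is the form of
  \<open>A\<close> at \<open>?z\<close>, which is \<open>x\<close> minus its projection on
  \<open>axis i 1\<close> with respect to \<open>A\<close>.\<close>

lemma psd_schur:
  fixes A :: "real ^ 'n ^ 'n"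
  assumes A: "A \<in> psd" and pos: "0 < A $ i $ i"
  defines "w \<equiv> A *v axis i 1"
  shows "A - (1 / A $ i $ i) *\<^sub>R outer w \<in> psd"
proof -
  let ?a = "A $ i $ i"
  have sym: "transpose A = A" and nn: "\<And>z. 0 \<le> z \<bullet> (A *v z)"
    using A by (auto simp: psd_def)
  have wi: "axis i 1 \<bullet> w = ?a"
    by (simp add: w_def axis_inner_matrix)
  have "0 \<le> x \<bullet> ((A - (1 / ?a) *\<^sub>R outer w) *v x)" for x
  proof -
    let ?t = "(w \<bullet> x) / ?a"
    let ?z = "x - ?t *\<^sub>R axis i 1"
    have xw: "axis i 1 \<bullet> (A *v x) = w \<bullet> x"
      using symmetric_inner_commute[OF sym, of "axis i 1" x] by (simp add: w_def inner_commute)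
    have "?z \<bullet> (A *v ?z) = x \<bullet> (A *v x) - 2 * ?t * (w \<bullet> x) + ?t\<^sup>2 * ?a"
      using xw wi
      by (simp add: matrix_vector_mult_diff_distrib matrix_vector_mult_scaleR inner_diff_left
          inner_diff_right power2_eq_square w_def[symmetric] inner_commute[of x w] algebra_simps)
    also have "\<dots> = x \<bullet> (A *v x) - (w \<bullet> x)\<^sup>2 / ?a"
      using pos by (simp add: field_simps power2_eq_square)
    also have "\<dots> = x \<bullet> ((A - (1 / ?a) *\<^sub>R outer w) *v x)"
      by (simp add: matrix_vector_mult_diff_rdistrib inner_diff_right outer_mult_vec
          scaleR_matrix_vector_assoc[symmetric] power2_eq_square inner_commute[of x w])
    finally show ?thesis using nn[of ?z] by simp
  qed
  moreover have "transpose (A - (1 / ?a) *\<^sub>R outer w) = A - (1 / ?a) *\<^sub>R outer w"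
    using sym by (simp add: transpose_def vec_eq_iff outer_def mult.commute)
  ultimately show ?thesis by (simp add: psd_def)
qed

text \<open>Removing a Schur complement kills one more row, so a positive semidefinite matrix is a
  conic combination of matrices \<open>outer w\<close>.\<close>

lemma psd_inner_nonneg:
  fixes A L :: "real ^ 'n ^ 'n"
  assumes "A \<in> psd" and L: "\<And>v. 0 \<le> v \<bullet> (L *v v)"
  shows "0 \<le> A \<bullet> L"
  using assms(1)
proof (induction "card {i. A *v axis i 1 \<noteq> 0}" arbitrary: A rule: less_induct)
  case less
  show ?case
  proof (cases "\<exists>i. A *v axis i 1 \<noteq> 0")
    case False
    then have "(A *v axis j 1) $ i = 0" for i j
      by simp
    then have "A $ i $ j = 0" for i j
      by (simp add: matrix_vector_axis)
    then have "A = 0" by (intro vec_eq_iff[THEN iffD2] allI) simp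
    then show ?thesis by simp
  next
    case True
    then obtain i where i: "A *v axis i 1 \<noteq> 0" by blast
    define w where "w = A *v axis i 1"
    let ?a = "A $ i $ i"
    have pos: "0 < ?a"
      using psd_diag[OF less.prems, of i] psd_kernel[OF less.prems, of "axis i 1"] i
      by (auto simp: axis_inner_matrix less_le)
    define B where "B = A - (1 / ?a) *\<^sub>R outer w"
    have B: "B \<in> psd"
      unfolding B_def w_def by (rule psd_schur[OF less.prems pos])
    have sym: "transpose A = A" using less.prems by (simp add: psd_def)
    have Bx: "B *v axis j 1 = A *v axis j 1 - ((w \<bullet> axis j 1) / ?a) *\<^sub>R w" for j
      by (simp add: B_def matrix_vector_mult_diff_rdistrib outer_mult_vec
          scaleR_matrix_vector_assoc[symmetric])
    have "w \<bullet> axis j 1 = axis i 1 \<bullet> (A *v axis j 1)" for j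
      using symmetric_inner_commute[OF sym] by (simp add: w_def inner_commute)
    then have "B *v axis j 1 = 0" if "A *v axis j 1 = 0" for j
      using that by (simp add: Bx)
    moreover have "B *v axis i 1 = 0"
      using pos by (simp add: Bx) (simp add: w_def inner_commute[of _ "axis i 1"] axis_inner_matrix)
    ultimately have "{j. B *v axis j 1 \<noteq> 0} \<subset> {j. A *v axis j 1 \<noteq> 0}"
      using i by auto
    then have "card {j. B *v axis j 1 \<noteq> 0} < card {j. A *v axis j 1 \<noteq> 0}"
      by (intro psubset_card_mono) auto
    then have "0 \<le> B \<bullet> L" by (rule less.hyps) (rule B)
    moreover have "0 \<le> outer w \<bullet> L"
      using L[of w] by (simp add: inner_commute[of _ L] inner_outer)
    moreover have "A \<bullet> L = B \<bullet> L + (1 / ?a) * (outer w \<bullet> L)"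
      by (simp add: B_def inner_diff_left)
    ultimately show ?thesis using pos by simp
  qed
qed

section \<open>Positive definite matrices and their inverses\<close>

lemma spd_psd:
  assumes "A \<in> spd"
  shows "A \<in> psd"
proof -
  have "0 \<le> x \<bullet> (A *v x)" for x
    by (cases "x = 0") (use assms in \<open>auto simp: spd_def intro: less_imp_le\<close>)
  then show ?thesis using assms by (simp add: psd_def spd_def)
qed

lemma spd_sym: "A \<in> spd \<Longrightarrow> transpose A = A"
  by (simp add: spd_def)

lemma spd_pos: "A \<in> spd \<Longrightarrow> x \<noteq> 0 \<Longrightarrow> 0 < x \<bullet> (A *v x)"
  by (simp add: spd_def)

lemma spd_nonneg: "A \<in> spd \<Longrightarrow> 0 \<le> x \<bullet> (A *v x)"
  using spd_psd unfolding psd_def by blast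

lemma sym_nth: "transpose A = A \<Longrightarrow> A $ j $ i = A $ i $ j"
  by (drule arg_cong[where f = "\<lambda>A. A $ i $ j"]) (simp add: transpose_def)

lemma matrix_inv_eqI:
  fixes A B :: "real ^ 'n ^ 'n"
  assumes "A ** B = mat 1"
  shows "matrix_inv A = B"
proof -
  have BA: "B ** A = mat 1" using assms matrix_left_right_inverse by blast
  have "A ** matrix_inv A = mat 1 \<and> matrix_inv A ** A = mat 1"
    unfolding matrix_inv_def by (rule someI[where x = B]) (use assms BA in simp)
  then show ?thesis
    by (metis assms matrix_mul_assoc matrix_mul_lid matrix_mul_rid)
qed

lemma
  fixes A :: "real ^ 'n ^ 'n"
  assumes "A \<in> spd"
  shows spd_inv_right: "A ** matrix_inv A = mat 1"
    and spd_inv_left: "matrix_inv A ** A = mat 1"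
proof -
  have "A *v x = 0 \<Longrightarrow> x = 0" for x
    using spd_pos[OF assms, of x] by force
  then obtain B where B: "B ** A = mat 1"
    using matrix_left_invertible_ker[of A] by blast
  then have "A ** B = mat 1" using matrix_left_right_inverse by blast
  with B matrix_inv_eqI show "A ** matrix_inv A = mat 1" "matrix_inv A ** A = mat 1"
    by metis+
qed

lemma spd_inv_spd:
  fixes A :: "real ^ 'n ^ 'n"
  assumes A: "A \<in> spd"
  shows "matrix_inv A \<in> spd"
proof -
  let ?B = "matrix_inv A"
  note [simp] = spd_inv_right[OF A] spd_inv_left[OF A]
  have "transpose (?B ** A) = A ** transpose ?B"
    by (subst matrix_transpose_mul) (simp only: spd_sym[OF A])
  then have "A ** transpose ?B = mat 1" by simp
  then have sym: "transpose ?B = ?B"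
    using matrix_inv_eqI by metis
  have "0 < x \<bullet> (?B *v x)" if "x \<noteq> 0" for x
  proof -
    have *: "A *v (?B *v x) = x" by (simp add: matrix_vector_mul_assoc)
    then have "?B *v x \<noteq> 0" using that by auto
    from spd_pos[OF A this] show ?thesis
      using * by (simp add: inner_commute)
  qed
  with sym show ?thesis by (simp add: spd_def)
qed

lemma matrix_inv_matrix_inv_spd: "A \<in> spd \<Longrightarrow> matrix_inv (matrix_inv A) = A"
  by (rule matrix_inv_eqI) (rule spd_inv_left)

lemma scaleR_spd: "A \<in> spd \<Longrightarrow> 0 < c \<Longrightarrow> c *\<^sub>R A \<in> spd"
  by (simp add: spd_def transpose_scalar scaleR_matrix_vector_assoc[symmetric])

lemma matrix_inv_scaleR:
  assumes "A \<in> spd" "c \<noteq> 0"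
  shows "matrix_inv (c *\<^sub>R A) = (1 / c) *\<^sub>R matrix_inv A"
  by (rule matrix_inv_eqI)
    (simp add: assms spd_inv_right scalar_matrix_assoc matrix_scalar_ac)

lemma mat_1_spd: "mat 1 \<in> spd"
  by (simp add: spd_def)

text \<open>Compactness of the unit sphere: \<open>c\<close> is the least value of the form
  there.\<close>

lemma spd_lower_bound:
  fixes A :: "real ^ 'n ^ 'n"
  assumes A: "A \<in> spd"
  obtains c where "0 < c" "\<And>x. c * (x \<bullet> x) \<le> x \<bullet> (A *v x)"
proof -
  let ?q = "\<lambda>x. x \<bullet> (A *v x)"
  have "continuous_on (sphere 0 1) ?q"
    by (intro continuous_intros)
  then obtain z where z: "z \<in> sphere 0 1" "\<And>x. x \<in> sphere 0 1 \<Longrightarrow> ?q z \<le> ?q x"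
    using continuous_attains_inf[of "sphere (0::real^'n) 1" ?q] by auto
  show ?thesis
  proof
    show "0 < ?q z" using z(1) by (intro spd_pos[OF A]) auto
    fix x
    show "?q z * (x \<bullet> x) \<le> ?q x"
    proof (cases "x = 0")
      case False
      let ?x = "x /\<^sub>R norm x"
      have "?q z \<le> ?q ?x" using z(2)[of ?x] False by simp
      also have "\<dots> = ?q x / (x \<bullet> x)"
        using False
        by (simp add: matrix_vector_mult_scaleR dot_square_norm power2_eq_square field_simps)
      finally show ?thesis using False by (simp add: field_simps)
    qed simp
  qed
qed

text \<open>\<open>psd_inner_nonneg\<close> applied to \<open>A - c *\<^sub>R mat 1\<close>. It
  turns a bound on \<open>K \<bullet> A\<close> into one on the trace of \<open>K\<close>, and
  thereby on its norm.\<close>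

lemma psd_inner_ge_trace:
  fixes K A :: "real ^ 'n ^ 'n"
  assumes "K \<in> psd" and "\<And>x. c * (x \<bullet> x) \<le> x \<bullet> (A *v x)"
  shows "c * (\<Sum>i\<in>UNIV. K $ i $ i) \<le> K \<bullet> A"
proof -
  have "0 \<le> K \<bullet> (A - c *\<^sub>R mat 1)"
    by (rule psd_inner_nonneg[OF assms(1)])
      (use assms(2) in \<open>simp add: matrix_vector_mult_diff_rdistrib inner_diff_right
        scaleR_matrix_vector_assoc[symmetric]\<close>)
  then show ?thesis
    by (simp add: inner_diff_right inner_mat_1)
qed

text \<open>Rewritten as \<open>?L \<bullet> B\<close> with a nonzero positive semidefinite
  \<open>?L\<close>, the product dominates a positive multiple of the trace of \<open>?L\<close>.
  Every injectivity argument below rests on this: for completions, for the linearized completion and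
  for the graphical derivative matrix.\<close>

lemma inner_congruence_pos:
  fixes A B T :: "real ^ 'n ^ 'n"
  assumes A: "A \<in> spd" and B: "B \<in> spd" and "T \<noteq> 0"
  shows "0 < T \<bullet> (A ** T ** B)"
proof -
  let ?L = "transpose T ** A ** T"
  obtain c where c: "0 < c" "\<And>x. c * (x \<bullet> x) \<le> x \<bullet> (B *v x)"
    using spd_lower_bound[OF B] by blast
  have Lx: "x \<bullet> (?L *v x) = (T *v x) \<bullet> (A *v (T *v x))" for x
    by (metis dot_lmul_matrix inner_commute matrix_vector_mul_assoc vector_transpose_matrix)
  have "transpose ?L = ?L"
    using spd_sym[OF A] by (simp add: matrix_transpose_mul matrix_mul_assoc)
  then have L: "?L \<in> psd"
    using Lx spd_nonneg[OF A] by (simp add: psd_def)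
  obtain i j where "T $ i $ j \<noteq> 0" using \<open>T \<noteq> 0\<close> by (auto simp: vec_eq_iff)
  then have "T *v axis j 1 \<noteq> 0" by (metis matrix_vector_axis zero_index)
  then have "0 < ?L $ j $ j"
    using spd_pos[OF A] Lx axis_inner_matrix by metis
  then have "0 < (\<Sum>i\<in>UNIV. ?L $ i $ i)"
    using psd_diag[OF L] by (intro sum_pos2[of _ j]) auto
  then have "0 < ?L \<bullet> B"
    using psd_inner_ge_trace[OF L c(2)] mult_pos_pos[OF c(1)] by (meson less_le_trans)
  also have "?L \<bullet> B = T \<bullet> (A ** T ** B)"
  proof -
    have "?L \<bullet> B = (A ** T) \<bullet> (T ** B)"
      by (metis inner_matrix_mult_left matrix_mul_assoc transpose_transpose)
    also have "\<dots> = (A ** T ** transpose B) \<bullet> T"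
      by (metis inner_commute inner_matrix_mult_right)
    finally show ?thesis by (simp add: spd_sym[OF B] inner_commute)
  qed
  finally show ?thesis .
qed

section \<open>Continuity of matrix multiplication, determinant and inversion\<close>

lemma bounded_bilinear_matrix_mult:
  "bounded_bilinear (\<lambda>(A::real^'n^'m) (B::real^'k^'n). A ** B)"
proof -
  have "bilinear (\<lambda>(A::real^'n^'m) (B::real^'k^'n). A ** B)"
    unfolding bilinear_def
    by (auto intro!: linearI simp: matrix_matrix_mult_def vec_eq_iff distrib_left distrib_right sum.distrib
        sum_distrib_left mult_ac)
  then show ?thesis by (simp add: bilinear_conv_bounded_bilinear)
qed

lemmas tendsto_matrix_mult [tendsto_intros] =
    bounded_bilinear.tendsto[OF bounded_bilinear_matrix_mult]
  and continuous_on_matrix_mult [continuous_intros] =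
    bounded_bilinear.continuous_on[OF bounded_bilinear_matrix_mult]

lemma tendsto_det:
  fixes f :: "'a \<Rightarrow> real ^ 'n ^ 'n"
  assumes "(f \<longlongrightarrow> A) F"
  shows "((\<lambda>x. det (f x)) \<longlongrightarrow> det A) F"
  unfolding det_def by (intro tendsto_intros assms)

lemma tendsto_matrix_inv:
  fixes f :: "'a \<Rightarrow> real ^ 'n ^ 'n"
  assumes f: "(f \<longlongrightarrow> A) F" and A: "invertible A"
  shows "((\<lambda>x. matrix_inv (f x)) \<longlongrightarrow> matrix_inv A) F"
proof -
  \<comment> \<open>Cramer's rule as a function of the matrix: a quotient of determinants, hence
    continuous at \<open>A\<close>, that agrees with the inverse wherever the determinant is
    nonzero.\<close>
  define g :: "real ^ 'n ^ 'n \<Rightarrow> real ^ 'n ^ 'n" where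
    "g = (\<lambda>B. \<chi> k j. det (\<chi> i l. if l = k then axis j 1 $ i else B $ i $ l) / det B)"
  have dA: "det A \<noteq> 0" using A invertible_det_nz by blast
  have g: "matrix_inv B = g B" if "det B \<noteq> 0" for B
  proof -
    have "invertible B" using that invertible_det_nz by blast
    then obtain C where C: "B ** C = mat 1" by (auto simp: invertible_def)
    then have "B *v (C *v axis j 1) = axis j 1" for j
      by (simp add: matrix_vector_mul_assoc)
    from cramer[OF that, THEN iffD1, OF this]
    have "C $ k $ j = g B $ k $ j" for k j
      unfolding matrix_vector_axis[symmetric, of C] by (simp add: g_def)
    then show ?thesis using matrix_inv_eqI[OF C] by (simp add: vec_eq_iff)
  qed
  have "((\<lambda>x. g (f x)) \<longlongrightarrow> g A) F"
    unfolding g_def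
    by (intro tendsto_vec_lambda tendsto_divide tendsto_det dA f)
       (auto intro!: tendsto_intros f)
  moreover have "\<forall>\<^sub>F x in F. det (f x) \<noteq> 0"
    using tendsto_imp_eventually_ne[OF tendsto_det[OF f] dA] .
  then have "\<forall>\<^sub>F x in F. g (f x) = matrix_inv (f x)"
    by (rule eventually_mono) (simp add: g)
  ultimately have "((\<lambda>x. matrix_inv (f x)) \<longlongrightarrow> g A) F"
    by (rule Lim_transform_eventually)
  then show ?thesis using g[OF dA] by simp
qed

lemma spd_invertible: "A \<in> spd \<Longrightarrow> invertible A"
  using spd_inv_left spd_inv_right unfolding invertible_def by blast

lemma continuous_on_matrix_inv_spd: "continuous_on spd matrix_inv"
  unfolding continuous_on_def
  by (auto intro!: tendsto_matrix_inv spd_invertible tendsto_ident_at)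


section \<open>Completion of a partially specified covariance matrix\<close>

text \<open>The orthogonal projection onto the matrices supported on the edges and the diagonal.
  Orthogonality is used in the form \<open>inner_graph_part\<close>.\<close>

definition graph_part :: "'p set set \<Rightarrow> real ^ 'p ^ 'p \<Rightarrow> real ^ 'p ^ 'p" where
  "graph_part E A = (\<chi> i j. if {i, j} \<in> E \<or> i = j then A $ i $ j else 0)"

definition sym_graph :: "'p set set \<Rightarrow> (real ^ 'p ^ 'p) set" where
  "sym_graph E = {A. transpose A = A \<and> graph_part E A = A}"

lemma graph_part_nth: "graph_part E A $ i $ j = (if {i, j} \<in> E \<or> i = j then A $ i $ j else 0)"
  by (simp add: graph_part_def)

lemma linear_graph_part: "linear (graph_part E)"
  by (rule linearI) (auto simp: vec_eq_iff graph_part_nth)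

lemma bounded_linear_graph_part: "bounded_linear (graph_part E)"
  using linear_graph_part by (simp add: linear_conv_bounded_linear)

lemma graph_part_add: "graph_part E (A + B) = graph_part E A + graph_part E B"
  and graph_part_diff: "graph_part E (A - B) = graph_part E A - graph_part E B"
  by (simp_all add: vec_eq_iff graph_part_nth)

lemma graph_part_idem [simp]: "graph_part E (graph_part E A) = graph_part E A"
  by (simp add: vec_eq_iff graph_part_nth)

lemma transpose_graph_part: "transpose (graph_part E A) = graph_part E (transpose A)"
  by (simp add: vec_eq_iff graph_part_nth transpose_def insert_commute eq_commute)

lemma inner_graph_part:
  assumes "graph_part E A = A"
  shows "A \<bullet> graph_part E B = A \<bullet> B"
proof -
  have "A $ i $ j = 0" if "{i, j} \<notin> E" "i \<noteq> j" for i j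
    using that graph_part_nth[of E A i j] assms by simp
  then show ?thesis
    unfolding inner_matrix graph_part_nth by (intro sum.cong refl) auto
qed

lemma graph_part_eq_iff:
  "graph_part E A = graph_part E B \<longleftrightarrow> (\<forall>i j. {i, j} \<in> E \<or> i = j \<longrightarrow> A $ i $ j = B $ i $ j)"
  by (auto simp: vec_eq_iff graph_part_nth)

lemma spd_graph_eq: "spd_graph E = spd \<inter> sym_graph E"
  by (auto simp: spd_graph_def sym_graph_def spd_def vec_eq_iff graph_part_nth)

section \<open>Topology and convexity of the positive definite cone\<close>

lemma subspace_sym: "subspace {A :: real ^ 'n ^ 'n. transpose A = A}"
  by (auto simp: subspace_def transpose_def vec_eq_iff)

lemma subspace_sym_graph: "subspace (sym_graph E)"
  unfolding sym_graph_def subspace_def using linear_graph_part[of E]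
  by (auto simp: transpose_scalar linear_add linear_scale linear_0)
    (auto simp: transpose_def vec_eq_iff)

lemma outer_norm: "norm (outer x) = x \<bullet> x"
proof -
  have "(norm (outer x))\<^sup>2 = (x \<bullet> x)\<^sup>2"
    unfolding power2_norm_eq_inner by (simp add: inner_outer outer_mult_vec power2_eq_square)
  then show ?thesis by (simp only: power2_eq_iff_nonneg norm_ge_zero inner_ge_zero)
qed

text \<open>The form at \<open>x\<close> is the inner product with the rank one matrix
  \<open>outer x\<close>, whose norm is \<open>x \<bullet> x\<close>, so Cauchy-Schwarz
  applies.\<close>

lemma quadratic_form_le_norm:
  fixes D :: "real ^ 'n ^ 'n"
  shows "\<bar>x \<bullet> (D *v x)\<bar> \<le> norm D * (x \<bullet> x)"
  using Cauchy_Schwarz_ineq2[of D "outer x"] by (simp add: inner_outer outer_norm)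

text \<open>Openness is relative to the symmetric matrices, since an asymmetric perturbation leaves
  \<open>spd\<close>. The radius is the lower bound \<open>c\<close> of the form.\<close>

lemma openin_spd: "openin (top_of_set {A. transpose A = A}) (spd :: (real ^ 'n ^ 'n) set)"
proof -
  have "\<exists>e>0. ball A e \<inter> {A. transpose A = A} \<subseteq> spd" if A: "A \<in> spd" for A :: "real ^ 'n ^ 'n"
  proof -
    obtain c where c: "0 < c" "\<And>x. c * (x \<bullet> x) \<le> x \<bullet> (A *v x)"
      using spd_lower_bound[OF A] by blast
    have "B \<in> spd" if B: "transpose B = B" "dist A B < c" for B
    proof -
      have "0 < x \<bullet> (B *v x)" if "x \<noteq> 0" for x
      proof -
        have "x \<bullet> (A *v x) - x \<bullet> (B *v x) \<le> norm (A - B) * (x \<bullet> x)"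
          using quadratic_form_le_norm[of x "A - B"]
          by (simp add: matrix_vector_mult_diff_rdistrib inner_diff_right)
        also have "\<dots> < c * (x \<bullet> x)"
          using B(2) that by (intro mult_strict_right_mono) (auto simp: dist_norm)
        finally show ?thesis using c(2)[of x] by simp
      qed
      with B(1) show ?thesis by (simp add: spd_def)
    qed
    then show ?thesis using c(1) by (intro exI[of _ c]) auto
  qed
  then show ?thesis
    by (subst openin_contains_ball) (auto simp: spd_def)
qed

lemma spd_borel [measurable]: "(spd :: (real ^ 'n ^ 'n) set) \<in> sets borel"
proof -
  obtain U where "open U" and U: "spd = {A. transpose A = A} \<inter> (U :: (real ^ 'n ^ 'n) set)"
    using openin_spd unfolding openin_open by blast
  moreover have "closed {A :: real ^ 'n ^ 'n. transpose A = A}"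
    by (rule closed_subspace[OF subspace_sym])
  ultimately show ?thesis unfolding U by (intro sets.Int borel_closed borel_open)
qed

lemma convex_spd: "convex (spd :: (real ^ 'n ^ 'n) set)"
proof (rule convexI)
  fix A B :: "real ^ 'n ^ 'n" and u v :: real
  assume A: "A \<in> spd" and B: "B \<in> spd" and uv: "0 \<le> u" "0 \<le> v" "u + v = 1"
  have "0 < u * (x \<bullet> (A *v x)) + v * (x \<bullet> (B *v x))" if "x \<noteq> 0" for x
  proof (cases "u = 0")
    case True
    then show ?thesis using spd_pos[OF B that] uv by simp
  next
    case False
    then show ?thesis using spd_pos[OF A that] spd_nonneg[OF B, of x] uv
      by (intro add_pos_nonneg) auto
  qed
  moreover have "transpose (u *\<^sub>R A + v *\<^sub>R B) = u *\<^sub>R A + v *\<^sub>R B"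
    using subspace_sym[where 'n = 'n] spd_sym[OF A] spd_sym[OF B]
    by (metis (mono_tags, lifting) mem_Collect_eq subspace_add subspace_scale)
  ultimately show "u *\<^sub>R A + v *\<^sub>R B \<in> spd"
    by (simp add: spd_def matrix_vector_mult_add_rdistrib inner_add_right
        scaleR_matrix_vector_assoc[symmetric])
qed

lemma
  fixes A :: "real ^ 'n ^ 'n"
  assumes "invertible A"
  shows invertible_inv_right: "A ** matrix_inv A = mat 1"
    and invertible_inv_left: "matrix_inv A ** A = mat 1"
proof -
  obtain B where B: "A ** B = mat 1" "B ** A = mat 1"
    using assms by (auto simp: invertible_def)
  with matrix_inv_eqI[OF B(1)] show "A ** matrix_inv A = mat 1" "matrix_inv A ** A = mat 1"
    by simp_all
qed

lemma matrix_inv_diff: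
  fixes K L :: "real ^ 'n ^ 'n"
  assumes "invertible K" "invertible L"
  shows "matrix_inv K - matrix_inv L = - (matrix_inv K ** (K - L) ** matrix_inv L)"
proof -
  have "matrix_inv K ** (K - L) ** matrix_inv L
      = (matrix_inv K ** K) ** matrix_inv L - matrix_inv K ** (L ** matrix_inv L)"
    by (simp add: bounded_bilinear.diff_left[OF bounded_bilinear_matrix_mult]
        bounded_bilinear.diff_right[OF bounded_bilinear_matrix_mult] matrix_mul_assoc)
  then show ?thesis using assms by (simp add: invertible_inv_left invertible_inv_right)
qed

text \<open>Strict monotonicity of inversion. \<open>K - L\<close> lives on the graph, where the two
  inverses agree, so it is orthogonal to the difference of the inverses; but that product is
  strictly negative unless \<open>K = L\<close>.\<close>

lemma graph_part_inv_inj: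
  assumes K: "K \<in> spd_graph E" and L: "L \<in> spd_graph E"
    and eq: "graph_part E (matrix_inv K) = graph_part E (matrix_inv L)"
  shows "K = L"
proof (rule ccontr)
  assume "K \<noteq> L"
  have Ks: "K \<in> spd" and Ls: "L \<in> spd" using K L by (auto simp: spd_graph_def)
  have "graph_part E (K - L) = K - L"
    using K L by (simp add: graph_part_diff spd_graph_eq sym_graph_def)
  from inner_graph_part[OF this]
  have "(K - L) \<bullet> (matrix_inv K - matrix_inv L) = 0"
    using eq by (metis graph_part_diff diff_self inner_zero_right)
  then have "(K - L) \<bullet> (matrix_inv K ** (K - L) ** matrix_inv L) = 0"
    by (simp add: matrix_inv_diff[OF spd_invertible[OF Ks] spd_invertible[OF Ls]])
  moreover have "0 < (K - L) \<bullet> (matrix_inv K ** (K - L) ** matrix_inv L)"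
    using \<open>K \<noteq> L\<close> by (intro inner_congruence_pos spd_inv_spd Ks Ls) simp
  ultimately show False by simp
qed

text \<open>The form at the sum and the difference of two axis vectors bounds off-diagonal entries
  by diagonal ones. The two factors \<open>CARD('n)\<close> come from passing to sums over rows and
  over entries.\<close>

lemma psd_norm_le_trace:
  fixes A :: "real ^ 'n ^ 'n"
  assumes A: "A \<in> psd"
  shows "norm A \<le> real CARD('n) * (real CARD('n) * (\<Sum>i\<in>UNIV. A $ i $ i))"
proof -
  have sym: "transpose A = A" and nn: "\<And>z. 0 \<le> z \<bullet> (A *v z)"
    using A by (auto simp: psd_def)
  have "\<bar>A $ i $ j\<bar> \<le> (\<Sum>i\<in>UNIV. A $ i $ i)" (is "_ \<le> ?t") for i j
  proof -
    have "0 \<le> A $ i $ i + A $ j $ j + 2 * A $ i $ j" "0 \<le> A $ i $ i + A $ j $ j - 2 * A $ i $ j"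
      using nn[of "axis i 1 + axis j 1"] nn[of "axis i 1 - axis j 1"] sym_nth[OF sym, of i j]
      by (simp_all add: matrix_vector_right_distrib matrix_vector_mult_diff_distrib inner_add_left
          inner_diff_left inner_add_right inner_diff_right axis_inner_matrix)
    moreover have "A $ i $ i \<le> ?t" "A $ j $ j \<le> ?t"
      using psd_diag[OF A] by (auto intro!: member_le_sum)
    ultimately show ?thesis by linarith
  qed
  then have "norm (A $ i) \<le> real CARD('n) * (\<Sum>i\<in>UNIV. A $ i $ i)" for i
    by (intro order_trans[OF norm_le_l1_cart] sum_bounded_above) auto
  then have "(\<Sum>i\<in>UNIV. norm (A $ i)) \<le> real CARD('n) * (real CARD('n) * (\<Sum>i\<in>UNIV. A $ i $ i))"
    by (intro sum_bounded_above) auto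
  moreover have "norm A \<le> (\<Sum>i\<in>UNIV. norm (A $ i))"
    unfolding norm_vec_def by (rule L2_set_le_sum) simp
  ultimately show ?thesis by simp
qed

lemma inner_matrix_inv:
  fixes K :: "real ^ 'n ^ 'n"
  assumes "K \<in> spd"
  shows "K \<bullet> matrix_inv K = real CARD('n)"
proof -
  have "K \<bullet> matrix_inv K = (K ** mat 1) \<bullet> matrix_inv K" by simp
  also have "\<dots> = mat 1 \<bullet> (K ** matrix_inv K)"
    by (subst inner_matrix_mult_left) (simp add: spd_sym[OF assms])
  also have "\<dots> = real CARD('n)"
    by (simp add: spd_inv_right[OF assms] inner_mat_1) (simp add: mat_def)
  finally show ?thesis .
qed

text \<open>Positive semidefiniteness survives limits, strictness does not. An inverse that survives
  the same limit restores it.\<close>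

lemma psd_inverse_spd:
  fixes K B :: "real ^ 'n ^ 'n"
  assumes K: "K \<in> psd" and "B ** K = mat 1"
  shows "K \<in> spd"
proof -
  have "x = 0" if "x \<bullet> (K *v x) = 0" for x
    by (metis psd_kernel[OF K that] assms(2) matrix_vector_mul_assoc matrix_vector_mul_lid
        matrix_vector_mult_0_right)
  then show ?thesis using K by (auto simp: psd_def spd_def le_less)
qed

lemma closed_psd: "closed (psd :: (real ^ 'n ^ 'n) set)"
proof -
  have "psd = {A :: real ^ 'n ^ 'n. transpose A = A} \<inter> (\<Inter>x. {A. 0 \<le> A \<bullet> outer x})"
    by (auto simp: psd_def inner_outer)

  moreover have "closed ({A :: real ^ 'n ^ 'n. transpose A = A} \<inter> (\<Inter>x. {A. 0 \<le> A \<bullet> outer x}))"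
    by (intro closed_Int closed_INT ballI closed_subspace[OF subspace_sym] closed_Collect_le
        continuous_intros)
  ultimately show ?thesis by simp
qed

lemma tendsto_quadratic_form_lower_bound:
  fixes A :: "'a \<Rightarrow> real ^ 'n ^ 'n"
  assumes "(A \<longlongrightarrow> A') F" "A' \<in> spd"
  obtains c where "0 < c" "\<forall>\<^sub>F n in F. \<forall>x. c * (x \<bullet> x) \<le> x \<bullet> (A n *v x)"
proof -
  obtain c where c: "0 < c" "\<And>x. c * (x \<bullet> x) \<le> x \<bullet> (A' *v x)"
    using spd_lower_bound[OF assms(2)] by blast
  have "\<forall>\<^sub>F n in F. dist (A n) A' < c / 2"
    using assms(1) c(1) by (intro tendstoD) auto
  then have "\<forall>\<^sub>F n in F. \<forall>x. c / 2 * (x \<bullet> x) \<le> x \<bullet> (A n *v x)"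
  proof (rule eventually_mono, intro allI)
    fix n x assume n: "dist (A n) A' < c / 2"
    have "x \<bullet> (A' *v x) - x \<bullet> (A n *v x) \<le> norm (A' - A n) * (x \<bullet> x)"
      using quadratic_form_le_norm[of x "A' - A n"]
      by (simp add: matrix_vector_mult_diff_rdistrib inner_diff_right)
    also have "\<dots> \<le> c / 2 * (x \<bullet> x)"
      using n by (intro mult_right_mono) (auto simp: dist_norm norm_minus_commute)
    finally show "c / 2 * (x \<bullet> x) \<le> x \<bullet> (A n *v x)" using c(2)[of x] by simp
  qed
  then show thesis using c(1) by (intro that[of "c / 2"]) auto
qed

text \<open>Properness of \<open>K \<mapsto> graph_part E (matrix_inv K)\<close>: the diagonal bounds the inverses, and
  \<open>K \<bullet> A = K \<bullet> matrix_inv K\<close> is the dimension, which bounds \<open>K\<close> itself.\<close>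

lemma graph_part_inv_proper:
  fixes K A :: "nat \<Rightarrow> real ^ 'n ^ 'n"
  assumes K: "\<And>n. K n \<in> spd_graph E" and A: "A \<longlonglongrightarrow> A'" "A' \<in> spd"
    and eq: "\<And>n. graph_part E (matrix_inv (K n)) = graph_part E (A n)"
  obtains r L where "strict_mono r" "L \<in> spd_graph E" "(\<lambda>n. K (r n)) \<longlonglongrightarrow> L"
    "graph_part E (matrix_inv L) = graph_part E A'"
proof -
  let ?p = "real CARD('n)" and ?B = "\<lambda>n. matrix_inv (K n)"
  have Ks: "K n \<in> spd" and Kg: "graph_part E (K n) = K n" for n
    using K by (auto simp: spd_graph_eq sym_graph_def)
  obtain c where c: "0 < c" "\<forall>\<^sub>F n in sequentially. \<forall>x. c * (x \<bullet> x) \<le> x \<bullet> (A n *v x)"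
    using tendsto_quadratic_form_lower_bound[OF A] by blast
  obtain M where M: "0 < M" "\<And>n. norm (A n) \<le> M"
    using Bseq_def convergent_imp_Bseq convergentI[OF A(1)] by blast
  obtain N where N: "\<And>n x. N \<le> n \<Longrightarrow> c * (x \<bullet> x) \<le> x \<bullet> (A n *v x)"
    using c(2) unfolding eventually_sequentially by blast
  have KA: "K n \<bullet> A n = ?p" for n
    by (metis eq inner_graph_part[OF Kg] inner_matrix_inv[OF Ks])
  have boundK: "norm (K n) \<le> ?p * (?p * (?p / c))" if "N \<le> n" for n
  proof -
    have "c * (\<Sum>i\<in>UNIV. K n $ i $ i) \<le> ?p"
      using psd_inner_ge_trace[OF spd_psd[OF Ks] N[OF that], of n] KA[of n] by simp
    then have "(\<Sum>i\<in>UNIV. K n $ i $ i) \<le> ?p / c"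
      using c(1) by (simp add: field_simps)
    then show ?thesis
      by (intro order_trans[OF psd_norm_le_trace[OF spd_psd[OF Ks]]] mult_left_mono) auto
  qed
  have boundB: "norm (?B n) \<le> ?p * (?p * (?p * M))" for n
  proof -
    have "?B n $ i $ i = A n $ i $ i" for i
      using eq[of n] by (simp add: graph_part_eq_iff)
    moreover have "A n $ i $ i \<le> M" for i
      using M(2)[of n] Finite_Cartesian_Product.norm_nth_le[of "A n" i]
        Finite_Cartesian_Product.norm_nth_le[of "A n $ i" i]
      by simp
    ultimately have "(\<Sum>i\<in>UNIV. ?B n $ i $ i) \<le> ?p * M"
      using sum_bounded_above[of UNIV "\<lambda>i. ?B n $ i $ i" M] by simp
    then show ?thesis
      by (intro order_trans[OF psd_norm_le_trace[OF spd_psd[OF spd_inv_spd[OF Ks]]]] mult_left_mono) auto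
  qed
  \<comment> \<open>The shift by \<open>N\<close> starts where the lower bound on \<open>A n\<close>
    holds. Matrices and inverses are paired so that one subsequence serves both.\<close>
  let ?S = "\<lambda>n. (K (n + N), ?B (n + N))"
  have "bounded (range (\<lambda>n. K (n + N)))" "bounded (range (\<lambda>n. ?B (n + N)))"
    unfolding bounded_iff using boundK[OF le_add2] boundB by blast+
  then have "bounded (range (\<lambda>n. K (n + N)) \<times> range (\<lambda>n. ?B (n + N)))"
    by (rule bounded_Times)
  then have "bounded (range ?S)"
    by (rule bounded_subset) auto
  then obtain L' r where r: "strict_mono r" "(?S \<circ> r) \<longlonglongrightarrow> L'"
    using bounded_imp_convergent_subsequence by blast
  define L B where "L = fst L'" and "B = snd L'"
  have limK: "(\<lambda>n. K (r n + N)) \<longlonglongrightarrow> L" and limB: "(\<lambda>n. ?B (r n + N)) \<longlonglongrightarrow> B"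
    using tendsto_fst[OF r(2)] tendsto_snd[OF r(2)] by (simp_all add: L_def B_def o_def)
  have "L \<in> psd"
    by (rule closed_sequentially[OF closed_psd _ limK]) (use Ks spd_psd in blast)
  \<comment> \<open>Passing the inverse relation to the limit shows that \<open>L\<close> has not
    reached the boundary of the cone.\<close>
  have "(\<lambda>n. ?B (r n + N) ** K (r n + N)) \<longlonglongrightarrow> B ** L"
    by (intro tendsto_intros limK limB)
  then have BL: "B ** L = mat 1"
    by (simp add: spd_inv_left[OF Ks] LIMSEQ_const_iff)
  have "L \<in> sym_graph E"
    by (rule closed_sequentially[OF closed_subspace[OF subspace_sym_graph] _ limK])
      (use K spd_graph_eq in blast)
  then have "L \<in> spd_graph E"
    using psd_inverse_spd[OF \<open>L \<in> psd\<close> BL] by (simp add: spd_graph_eq)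
  have "matrix_inv L = B"
    using BL matrix_left_right_inverse by (intro matrix_inv_eqI) blast
  have "strict_mono (\<lambda>n. r n + N)" using r(1) by (simp add: strict_mono_def)
  have "(\<lambda>n. graph_part E (?B (r n + N))) \<longlonglongrightarrow> graph_part E B"
    by (rule bounded_linear.tendsto[OF bounded_linear_graph_part limB])
  moreover have "(\<lambda>n. graph_part E (A (r n + N))) \<longlonglongrightarrow> graph_part E A'"
    by (rule bounded_linear.tendsto[OF bounded_linear_graph_part])
      (use LIMSEQ_subseq_LIMSEQ[OF A(1) \<open>strict_mono (\<lambda>n. r n + N)\<close>] in \<open>simp add: o_def\<close>)
  ultimately have "graph_part E B = graph_part E A'"
    unfolding eq by (rule LIMSEQ_unique)
  with \<open>matrix_inv L = B\<close> show thesis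
    using that[OF \<open>strict_mono (\<lambda>n. r n + N)\<close> \<open>L \<in> spd_graph E\<close> limK] by simp
qed

text \<open>The image of \<open>K \<mapsto> graph_part E (matrix_inv K)\<close> is open by invariance of domain and closed by
  properness, hence everything by connectedness.\<close>

lemma graph_completion_exists:
  fixes A :: "real ^ 'n ^ 'n"
  assumes "A \<in> spd"
  obtains K where "K \<in> spd_graph E" "graph_part E (matrix_inv K) = graph_part E A"
proof -
  let ?\<Phi> = "\<lambda>K. graph_part E (matrix_inv K)"
  let ?C = "graph_part E ` (spd :: (real ^ 'n ^ 'n) set)"
  let ?I = "?\<Phi> ` spd_graph E"
  have "spd_graph E \<subseteq> spd" by (auto simp: spd_graph_def)
  then have IC: "?I \<subseteq> ?C" using spd_inv_spd by auto
  have CL: "?C \<subseteq> sym_graph E"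
    by (auto simp: sym_graph_def transpose_graph_part spd_sym)
  have conn: "connected ?C"
    by (intro connected_continuous_image linear_continuous_on bounded_linear_graph_part
        convex_connected convex_spd)
  have cont: "continuous_on (spd_graph E) ?\<Phi>"
    by (rule continuous_on_subset[OF _ \<open>spd_graph E \<subseteq> spd\<close>])
      (intro bounded_linear.continuous_on[OF bounded_linear_graph_part] continuous_on_matrix_inv_spd)
  \<comment> \<open>Invariance of domain is applied inside the linear space
    \<open>sym_graph E\<close>, which contains both the domain, as an open part, and the
    image.\<close>
  have op: "openin (top_of_set (sym_graph E)) (spd_graph E)"
  proof -
    obtain U where "open U" and "spd = {A. transpose A = A} \<inter> (U :: (real ^ 'n ^ 'n) set)"
      using openin_spd unfolding openin_open by blast
    moreover have "sym_graph E \<subseteq> {A. transpose A = A}" by (auto simp: sym_graph_def)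
    ultimately have "spd_graph E = sym_graph E \<inter> U" unfolding spd_graph_eq by blast
    then show ?thesis unfolding openin_open using \<open>open U\<close> by blast
  qed
  have "?\<Phi> \<in> spd_graph E \<rightarrow> sym_graph E" using IC CL by blast
  moreover have "inj_on ?\<Phi> (spd_graph E)" by (rule inj_onI) (rule graph_part_inv_inj)
  ultimately have "openin (top_of_set (sym_graph E)) ?I"
    by (rule invariance_of_domain_subspaces[OF op subspace_sym_graph subspace_sym_graph order_refl cont])
  then have "openin (top_of_set ?C) ?I"
    using IC CL by (rule openin_subset_trans)
  moreover have "closedin (top_of_set ?C) ?I"
  proof -
    have "y \<in> ?I" if "y \<in> ?C" "y \<in> closure ?I" for y
    proof -
      obtain A' where A': "A' \<in> spd" "y = graph_part E A'" using \<open>y \<in> ?C\<close> by blast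
      obtain f where f: "\<And>n. f n \<in> ?I" "f \<longlonglongrightarrow> y"
        using \<open>y \<in> closure ?I\<close> unfolding closure_sequential by blast
      then have "\<forall>n. \<exists>K. K \<in> spd_graph E \<and> f n = ?\<Phi> K" by blast
      then obtain K where K: "\<And>n. K n \<in> spd_graph E" "\<And>n. f n = ?\<Phi> (K n)"
        by metis
      \<comment> \<open>An auxiliary sequence with the same graph parts as \<open>f n\<close> and
        with limit \<open>A'\<close>. Its members may fail to be positive definite; properness asks
        this only of the limit.\<close>
      have "(\<lambda>n. A' + (f n - y)) \<longlonglongrightarrow> A' + (y - y)"
        by (intro tendsto_intros f)
      then have lim: "(\<lambda>n. A' + (f n - y)) \<longlonglongrightarrow> A'" by simp
      have "?\<Phi> (K n) = graph_part E (A' + (f n - y))" for n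
        using A'(2) K(2)[of n] by (simp add: graph_part_add graph_part_diff)
      from graph_part_inv_proper[OF K(1) lim A'(1) this]
      show ?thesis using A'(2) by (metis (no_types, lifting) imageI)
    qed
    then have "?I = ?C \<inter> closure ?I" using IC closure_subset[of ?I] by blast
    then show ?thesis unfolding closedin_closed using closed_closure by blast
  qed
  moreover have "mat 1 \<in> spd_graph E"
    by (simp add: spd_graph_def mat_1_spd) (simp add: mat_def)
  then have "?I \<noteq> {}" by blast
  ultimately have "?I = ?C"
    using conn unfolding connected_clopen by blast
  then show thesis using that assms by (metis (no_types, lifting) imageE imageI)
qed

section \<open>Characterization and continuity of the completion map\<close>

lemma h_graph_eqI:
  assumes A: "A \<in> spd" and B: "B \<in> spd" "matrix_inv B \<in> spd_graph E"
    "graph_part E B = graph_part E A"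
  shows "h_graph E A = B"
  unfolding h_graph_def
proof (rule the_equality)
  show "B \<in> spd \<and> (\<forall>i j. {i, j} \<in> E \<or> i = j \<longrightarrow> B $ i $ j = A $ i $ j) \<and>
      (\<forall>i j. {i, j} \<notin> E \<and> i \<noteq> j \<longrightarrow> matrix_inv B $ i $ j = 0)"
    using B by (auto simp: graph_part_eq_iff spd_graph_def)
next
  fix C
  assume C: "C \<in> spd \<and> (\<forall>i j. {i, j} \<in> E \<or> i = j \<longrightarrow> C $ i $ j = A $ i $ j) \<and>
      (\<forall>i j. {i, j} \<notin> E \<and> i \<noteq> j \<longrightarrow> matrix_inv C $ i $ j = 0)"
  then have "matrix_inv C \<in> spd_graph E" by (simp add: spd_graph_def spd_inv_spd)
  moreover have "graph_part E C = graph_part E A" using C by (simp add: graph_part_eq_iff)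
  ultimately have "matrix_inv C = matrix_inv B"
    using B C graph_part_inv_inj[of "matrix_inv C" E "matrix_inv B"]
    by (simp add: matrix_inv_matrix_inv_spd)
  then have "matrix_inv (matrix_inv C) = matrix_inv (matrix_inv B)" by simp
  then show "C = B" using B C by (simp add: matrix_inv_matrix_inv_spd)
qed

lemma
  assumes "A \<in> spd"
  shows h_graph_spd: "h_graph E A \<in> spd"
    and h_graph_inv: "matrix_inv (h_graph E A) \<in> spd_graph E"
    and graph_part_h_graph: "graph_part E (h_graph E A) = graph_part E A"
proof -
  obtain K where K: "K \<in> spd_graph E" "graph_part E (matrix_inv K) = graph_part E A"
    using graph_completion_exists[OF assms] by blast
  then have "K \<in> spd" by (simp add: spd_graph_def)
  with K have "h_graph E A = matrix_inv K"
    by (intro h_graph_eqI[OF assms]) (simp_all add: spd_inv_spd matrix_inv_matrix_inv_spd)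
  with K \<open>K \<in> spd\<close> show "h_graph E A \<in> spd" "matrix_inv (h_graph E A) \<in> spd_graph E"
    "graph_part E (h_graph E A) = graph_part E A"
    by (simp_all add: spd_inv_spd matrix_inv_matrix_inv_spd)
qed

lemma LIMSEQ_subsubseqI:
  fixes f :: "nat \<Rightarrow> 'a::metric_space"
  assumes "\<And>r :: nat \<Rightarrow> nat. strict_mono r \<Longrightarrow>
    \<exists>s :: nat \<Rightarrow> nat. strict_mono s \<and> (\<lambda>n. f (r (s n))) \<longlonglongrightarrow> l"
  shows "f \<longlonglongrightarrow> l"
proof (rule ccontr)
  assume "\<not> f \<longlonglongrightarrow> l"
  then obtain e where e: "0 < e" "\<forall>N. \<exists>n\<ge>N. e \<le> dist (f n) l"
    unfolding LIMSEQ_def by (auto simp: not_less)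
  then have "infinite {n. e \<le> dist (f n) l}"
    unfolding infinite_nat_iff_unbounded_le by auto
  then obtain r :: "nat \<Rightarrow> nat" where r: "strict_mono r" "\<And>n. r n \<in> {n. e \<le> dist (f n) l}"
    using infinite_enumerate by blast
  from assms[OF r(1)] obtain s :: "nat \<Rightarrow> nat" where "(\<lambda>n. f (r (s n))) \<longlonglongrightarrow> l" by blast
  then obtain N where "\<And>n. N \<le> n \<Longrightarrow> dist (f (r (s n))) l < e"
    using e(1) unfolding LIMSEQ_def by blast
  then have "dist (f (r (s N))) l < e" by blast
  then show False using r(2)[of "s N"] by simp
qed

text \<open>Properness extracts a convergent subsequence of the inverses from any subsequence, and
  uniqueness of the completion identifies its limit.\<close>

lemma continuous_on_h_graph: "continuous_on spd (h_graph E :: real ^ 'n ^ 'n \<Rightarrow> _)"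
proof (rule continuous_on_sequentiallyI)
  fix A and A' :: "real ^ 'n ^ 'n"
  assume A: "\<forall>n. A n \<in> spd" "A' \<in> spd" "A \<longlonglongrightarrow> A'"
  have As: "A n \<in> spd" for n using A(1) by blast
  show "(\<lambda>n. h_graph E (A n)) \<longlonglongrightarrow> h_graph E A'"
  proof (rule LIMSEQ_subsubseqI)
    fix r :: "nat \<Rightarrow> nat" assume r: "strict_mono r"
    let ?K = "\<lambda>n. matrix_inv (h_graph E (A (r n)))"
    have "(\<lambda>n. A (r n)) \<longlonglongrightarrow> A'"
      using LIMSEQ_subseq_LIMSEQ[OF A(3) r] by (simp add: o_def)
    then obtain s L where s: "strict_mono s" "L \<in> spd_graph E" "(\<lambda>n. ?K (s n)) \<longlonglongrightarrow> L"
        "graph_part E (matrix_inv L) = graph_part E A'"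
      using graph_part_inv_proper[of ?K E "\<lambda>n. A (r n)" A'] A(2) As
      by (simp add: h_graph_inv matrix_inv_matrix_inv_spd h_graph_spd graph_part_h_graph) blast
    have L: "L \<in> spd" using s(2) by (simp add: spd_graph_def)
    have "(\<lambda>n. matrix_inv (?K (s n))) \<longlonglongrightarrow> matrix_inv L"
      by (rule tendsto_matrix_inv[OF s(3) spd_invertible[OF L]])
    then have "(\<lambda>n. h_graph E (A (r (s n)))) \<longlonglongrightarrow> matrix_inv L"
      by (simp add: matrix_inv_matrix_inv_spd h_graph_spd As)
    moreover have "h_graph E A' = matrix_inv L"
      using s L by (intro h_graph_eqI A(2)) (simp_all add: spd_inv_spd matrix_inv_matrix_inv_spd)
    ultimately show "\<exists>s. strict_mono s \<and> (\<lambda>n. h_graph E (A (r (s n)))) \<longlonglongrightarrow> h_graph E A'"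
      using s(1) by auto
  qed
qed


section \<open>Convergence and boundedness in probability\<close>

text \<open>Convergence in probability becomes convergence along a filter on pairs of a sample size and an
  outcome. This makes the limit calculus of the library available and needs no measurability.\<close>

definition outside_small :: "'a measure \<Rightarrow> real \<Rightarrow> ('a \<Rightarrow> bool) \<Rightarrow> bool" where
  "outside_small M \<delta> Q \<longleftrightarrow> (\<exists>A\<in>sets M. measure M A \<le> \<delta> \<and> (\<forall>\<omega>\<in>space M - A. Q \<omega>))"

definition in_prob :: "'a measure \<Rightarrow> (nat \<times> 'a) filter" where
  "in_prob M = Abs_filter (\<lambda>P. \<forall>\<delta>>0. \<forall>\<^sub>F n in sequentially. outside_small M \<delta> (\<lambda>\<omega>. P (n, \<omega>)))"

text \<open>Stochastic boundedness, as the property that products with null sequences are null.\<close>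

definition bounded_in_prob :: "'a measure \<Rightarrow> (nat \<times> 'a \<Rightarrow> 'b::real_normed_vector) \<Rightarrow> bool" where
  "bounded_in_prob M Y \<longleftrightarrow>
     (\<forall>Z. (Z \<longlongrightarrow> 0) (in_prob M) \<longrightarrow> ((\<lambda>z. Z z * norm (Y z)) \<longlongrightarrow> 0) (in_prob M))"

lemma outside_smallI:
  "A \<in> sets M \<Longrightarrow> measure M A \<le> \<delta> \<Longrightarrow> (\<And>\<omega>. \<omega> \<in> space M \<Longrightarrow> \<omega> \<notin> A \<Longrightarrow> Q \<omega>) \<Longrightarrow> outside_small M \<delta> Q"
  by (auto simp: outside_small_def)

lemma outside_small_mono:
  "outside_small M \<delta> Q \<Longrightarrow> (\<And>\<omega>. \<omega> \<in> space M \<Longrightarrow> Q \<omega> \<Longrightarrow> Q' \<omega>) \<Longrightarrow> outside_small M \<delta> Q'"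
  unfolding outside_small_def by blast

lemma (in finite_measure) outside_small_conj:
  assumes "outside_small M (\<delta> / 2) Q" "outside_small M (\<delta> / 2) Q'"
    and "\<And>\<omega>. \<omega> \<in> space M \<Longrightarrow> Q \<omega> \<Longrightarrow> Q' \<omega> \<Longrightarrow> R \<omega>"
  shows "outside_small M \<delta> R"
proof -
  obtain A B where A: "A \<in> sets M" "measure M A \<le> \<delta> / 2" "\<forall>\<omega>\<in>space M - A. Q \<omega>"
    and B: "B \<in> sets M" "measure M B \<le> \<delta> / 2" "\<forall>\<omega>\<in>space M - B. Q' \<omega>"
    using assms(1,2) by (auto simp: outside_small_def)
  have "measure M (A \<union> B) \<le> measure M A + measure M B"
    using A(1) B(1) by (rule measure_Un_le)
  with A B assms(3) show ?thesis by (intro outside_smallI[of "A \<union> B"]) auto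
qed

lemma (in finite_measure) eventually_in_prob:
  "eventually P (in_prob M) \<longleftrightarrow>
    (\<forall>\<delta>>0. \<forall>\<^sub>F n in sequentially. outside_small M \<delta> (\<lambda>\<omega>. P (n, \<omega>)))"
  unfolding in_prob_def
proof (rule eventually_Abs_filter, rule is_filter.intro)
  show "\<forall>\<delta>>0. \<forall>\<^sub>F n in sequentially. outside_small M \<delta> (\<lambda>\<omega>. True)"
    by (auto intro!: always_eventually outside_smallI[of "{}"])
next
  fix P Q :: "nat \<times> 'a \<Rightarrow> bool"
  assume P: "\<forall>\<delta>>0. \<forall>\<^sub>F n in sequentially. outside_small M \<delta> (\<lambda>\<omega>. P (n, \<omega>))"
    and Q: "\<forall>\<delta>>0. \<forall>\<^sub>F n in sequentially. outside_small M \<delta> (\<lambda>\<omega>. Q (n, \<omega>))"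
  show "\<forall>\<delta>>0. \<forall>\<^sub>F n in sequentially. outside_small M \<delta> (\<lambda>\<omega>. P (n, \<omega>) \<and> Q (n, \<omega>))"
  proof (intro allI impI)
    fix \<delta> :: real assume "0 < \<delta>"
    then have "0 < \<delta> / 2" by simp
    from P[rule_format, OF this] Q[rule_format, OF this]
    show "\<forall>\<^sub>F n in sequentially. outside_small M \<delta> (\<lambda>\<omega>. P (n, \<omega>) \<and> Q (n, \<omega>))"
      by eventually_elim (erule (1) outside_small_conj, blast)
  qed
next
  fix P Q :: "nat \<times> 'a \<Rightarrow> bool"
  assume "\<forall>x. P x \<longrightarrow> Q x"
    and "\<forall>\<delta>>0. \<forall>\<^sub>F n in sequentially. outside_small M \<delta> (\<lambda>\<omega>. P (n, \<omega>))"
  then show "\<forall>\<delta>>0. \<forall>\<^sub>F n in sequentially. outside_small M \<delta> (\<lambda>\<omega>. Q (n, \<omega>))"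
    by (auto elim!: eventually_mono outside_small_mono)
qed

lemma (in finite_measure) eventually_in_prob_AE:
  assumes "\<forall>\<^sub>F n in sequentially. AE \<omega> in M. P n \<omega>"
  shows "\<forall>\<^sub>F z in in_prob M. P (fst z) (snd z)"
  unfolding eventually_in_prob
proof (intro allI impI)
  fix \<delta> :: real assume "0 < \<delta>"
  from assms show "\<forall>\<^sub>F n in sequentially. outside_small M \<delta> (\<lambda>\<omega>. P (fst (n, \<omega>)) (snd (n, \<omega>)))"
  proof eventually_elim
    case (elim n)
    then obtain N where N: "N \<in> null_sets M" "{\<omega> \<in> space M. \<not> P n \<omega>} \<subseteq> N"
      by (auto simp: eventually_ae_filter)
    then show ?case using \<open>0 < \<delta>\<close>
      by (intro outside_smallI[of N]) (auto simp: measure_eq_0_null_sets)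
  qed
qed

lemma (in finite_measure) eventually_in_prob_space:
  assumes "\<forall>\<^sub>F n in sequentially. \<forall>\<omega>\<in>space M. P n \<omega>"
  shows "\<forall>\<^sub>F z in in_prob M. P (fst z) (snd z)"
  by (rule eventually_in_prob_AE) (use assms in \<open>auto elim!: eventually_mono intro: AE_I2\<close>)

lemma (in finite_measure) filterlim_fst_in_prob: "filterlim fst sequentially (in_prob M)"
  unfolding filterlim_iff
proof (intro allI impI)
  fix P :: "nat \<Rightarrow> bool" assume "eventually P sequentially"
  then show "\<forall>\<^sub>F z in in_prob M. P (fst z)"
    by (intro eventually_in_prob_space) (auto elim!: eventually_mono)
qed

section \<open>Translation to and from convergence in probability, and stochastic
  boundedness\<close>

lemma (in finite_measure) tendsto_in_probI:
  assumes meas: "\<And>n. Y n \<in> borel_measurable M"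
    and lim: "((\<lambda>z. Y (fst z) (snd z)) \<longlongrightarrow> c) (in_prob M)"
  shows "tendsto_in_prob M Y c"
  unfolding tendsto_in_prob_def
proof (intro conjI allI impI meas)
  fix \<epsilon> :: real assume "0 < \<epsilon>"
  have ev: "\<forall>\<^sub>F z in in_prob M. dist (Y (fst z) (snd z)) c < \<epsilon>"
    using lim \<open>0 < \<epsilon>\<close> by (rule tendstoD)
  show "(\<lambda>n. measure M {\<omega> \<in> space M. \<epsilon> < dist (Y n \<omega>) c}) \<longlonglongrightarrow> 0"
  proof (rule tendstoI)
    fix e :: real assume "0 < e"
    then have "0 < e / 2" by simp
    from ev[unfolded eventually_in_prob, rule_format, OF this]
    show "\<forall>\<^sub>F n in sequentially. dist (measure M {\<omega> \<in> space M. \<epsilon> < dist (Y n \<omega>) c}) 0 < e"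
    proof eventually_elim
      case (elim n)
      then obtain A where A: "A \<in> sets M" "measure M A \<le> e / 2"
          "\<And>\<omega>. \<omega> \<in> space M - A \<Longrightarrow> dist (Y n \<omega>) c < \<epsilon>"
        by (auto simp: outside_small_def)
      have "{\<omega> \<in> space M. \<epsilon> < dist (Y n \<omega>) c} \<subseteq> A"
        using A(3) by force
      then have "measure M {\<omega> \<in> space M. \<epsilon> < dist (Y n \<omega>) c} \<le> measure M A"
        using A(1) by (rule finite_measure_mono)
      then show ?case using A(2) \<open>0 < e\<close> by simp
    qed
  qed
qed

lemma (in finite_measure) tendsto_in_probD:
  assumes "tendsto_in_prob M Y c"
  shows "((\<lambda>z. Y (fst z) (snd z)) \<longlongrightarrow> c) (in_prob M)"
proof (rule tendstoI)
  fix e :: real assume "0 < e"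
  have meas [measurable]: "Y n \<in> borel_measurable M" for n
    using assms by (simp add: tendsto_in_prob_def)
  have dmeas [measurable]: "(\<lambda>\<omega>. dist (Y n \<omega>) c) \<in> borel_measurable M" for n
    by (rule measurable_compose[OF meas]) (intro borel_measurable_continuous_onI continuous_intros)
  \<comment> \<open>The definition only gives \<open>dist \<le> \<epsilon>\<close> off the
    exceptional event; the level \<open>e / 2\<close> turns this into a strict bound by
    \<open>e\<close>.\<close>
  have lim: "(\<lambda>n. measure M {\<omega> \<in> space M. e / 2 < dist (Y n \<omega>) c}) \<longlonglongrightarrow> 0"
    using assms half_gt_zero[OF \<open>0 < e\<close>] unfolding tendsto_in_prob_def by blast
  show "\<forall>\<^sub>F z in in_prob M. dist (Y (fst z) (snd z)) c < e"
    unfolding eventually_in_prob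
  proof (intro allI impI)
    fix \<delta> :: real assume "0 < \<delta>"
    from order_tendstoD(2)[OF lim this]
    show "\<forall>\<^sub>F n in sequentially. outside_small M \<delta> (\<lambda>\<omega>. dist (Y (fst (n, \<omega>)) (snd (n, \<omega>))) c < e)"
    proof eventually_elim
      case (elim n)
      have "{\<omega> \<in> space M. e / 2 < dist (Y n \<omega>) c} \<in> sets M" by measurable
      then show ?case by (rule outside_smallI) (use elim \<open>0 < e\<close> in auto)
    qed
  qed
qed

lemma bounded_in_probD:
  "bounded_in_prob M Y \<Longrightarrow> (Z \<longlongrightarrow> 0) (in_prob M) \<Longrightarrow> ((\<lambda>z. Z z * norm (Y z)) \<longlongrightarrow> 0) (in_prob M)"
  by (simp add: bounded_in_prob_def)

lemma bounded_in_prob_dominated: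
  fixes M :: "'a measure"
  assumes Y: "bounded_in_prob M Y" and le: "\<forall>\<^sub>F z in in_prob M. norm (Y' z) \<le> C * norm (Y z)"
  shows "bounded_in_prob M Y'"
  unfolding bounded_in_prob_def
proof (intro allI impI)
  fix Z :: "nat \<times> 'a \<Rightarrow> real" assume "(Z \<longlongrightarrow> 0) (in_prob M)"
  then have lim: "((\<lambda>z. C * (Z z * norm (Y z))) \<longlongrightarrow> 0) (in_prob M)"
    by (intro tendsto_mult_right_zero bounded_in_probD[OF Y])
  show "((\<lambda>z. Z z * norm (Y' z)) \<longlongrightarrow> 0) (in_prob M)"
  proof (rule tendsto_0_le[OF lim, where K = 1])
    show "\<forall>\<^sub>F z in in_prob M. norm (Z z * norm (Y' z)) \<le> norm (C * (Z z * norm (Y z))) * 1"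
      using le
    proof eventually_elim
      case (elim z)
      have "C * norm (Y z) \<le> \<bar>C\<bar> * norm (Y z)" by (simp add: mult_right_mono)
      then have "\<bar>Z z\<bar> * norm (Y' z) \<le> \<bar>Z z\<bar> * (\<bar>C\<bar> * norm (Y z))"
        using elim by (intro mult_left_mono) auto
      then show ?case by (simp add: abs_mult mult_ac)
    qed
  qed
qed

lemma bounded_in_prob_sum:
  fixes M :: "'a measure"
  assumes "\<And>i. i \<in> I \<Longrightarrow> bounded_in_prob M (Y i)"
  shows "bounded_in_prob M (\<lambda>z. \<Sum>i\<in>I. norm (Y i z))"
  unfolding bounded_in_prob_def
proof (intro allI impI)
  fix Z :: "nat \<times> 'a \<Rightarrow> real" assume "(Z \<longlongrightarrow> 0) (in_prob M)"
  then have "((\<lambda>z. \<Sum>i\<in>I. Z z * norm (Y i z)) \<longlongrightarrow> 0) (in_prob M)"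
    by (intro tendsto_null_sum bounded_in_probD[OF assms])
  then show "((\<lambda>z. Z z * norm (\<Sum>i\<in>I. norm (Y i z))) \<longlongrightarrow> 0) (in_prob M)"
    by (simp add: sum_distrib_left sum_nonneg)
qed

text \<open>Markov's inequality for the squares bounds \<open>Y n\<close> by a constant
  \<open>K\<close> outside an event whose probability is small uniformly in \<open>n\<close>; there
  a null factor beats \<open>K\<close>.\<close>

lemma (in prob_space) second_moment_bounded_in_prob:
  fixes Y :: "nat \<Rightarrow> 'a \<Rightarrow> real"
  assumes meas [measurable]: "\<And>n. Y n \<in> borel_measurable M"
    and int: "\<And>n. integrable M (\<lambda>\<omega>. (Y n \<omega>)\<^sup>2)" and bound: "\<And>n. expectation (\<lambda>\<omega>. (Y n \<omega>)\<^sup>2) \<le> C"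
  shows "bounded_in_prob M (\<lambda>z. Y (fst z) (snd z))"
  unfolding bounded_in_prob_def
proof (intro allI impI, rule tendstoI)
  fix Z :: "nat \<times> 'a \<Rightarrow> real" and e :: real
  assume Z: "(Z \<longlongrightarrow> 0) (in_prob M)" and "0 < e"
  show "\<forall>\<^sub>F z in in_prob M. dist (Z z * norm (Y (fst z) (snd z))) 0 < e"
    unfolding eventually_in_prob
  proof (intro allI impI)
    fix \<delta> :: real assume \<delta>: "0 < \<delta>"
    \<comment> \<open>Chosen so that Markov's bound equals \<open>\<delta> / 2\<close>; the summand
      1 keeps \<open>K\<close> positive.\<close>
    define K where "K = sqrt (2 * (\<bar>C\<bar> + 1) / \<delta>)"
    have K: "0 < K" "K\<^sup>2 = 2 * (\<bar>C\<bar> + 1) / \<delta>" using \<delta> by (simp_all add: K_def)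
    let ?B = "\<lambda>n. {\<omega> \<in> space M. K\<^sup>2 \<le> (Y n \<omega>)\<^sup>2}"
    have B: "?B n \<in> sets M" for n by measurable
    have PB: "measure M (?B n) \<le> \<delta> / 2" for n
    proof -
      have "measure M (?B n) \<le> expectation (\<lambda>\<omega>. (Y n \<omega>)\<^sup>2) / K\<^sup>2"
        using K(1) by (intro integral_Markov_inequality_measure[OF int, of "space M"]) auto
      also have "\<dots> \<le> (\<bar>C\<bar> + 1) / K\<^sup>2"
        using bound[of n] by (intro divide_right_mono) auto
      also have "\<dots> = \<delta> / 2"
      proof -
        have "a / (2 * a / \<delta>) = \<delta> / 2" if "0 < a" for a
          using that \<delta> by (simp add: field_simps)
        from this[of "\<bar>C\<bar> + 1"] show ?thesis by (simp add: K(2))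
      qed
      finally show ?thesis .
    qed
    have "\<forall>\<^sub>F z in in_prob M. dist (Z z) 0 < e / K"
      using Z \<open>0 < e\<close> K(1) by (intro tendstoD) auto
    moreover have "0 < \<delta> / 2" using \<delta> by simp
    ultimately have "\<forall>\<^sub>F n in sequentially. outside_small M (\<delta> / 2) (\<lambda>\<omega>. dist (Z (n, \<omega>)) 0 < e / K)"
      unfolding eventually_in_prob by blast
    then show "\<forall>\<^sub>F n in sequentially. outside_small M \<delta>
      (\<lambda>\<omega>. dist (Z (n, \<omega>) * norm (Y (fst (n, \<omega>)) (snd (n, \<omega>)))) 0 < e)"
    proof eventually_elim
      case (elim n)
      have "outside_small M (\<delta> / 2) (\<lambda>\<omega>. (Y n \<omega>)\<^sup>2 < K\<^sup>2)"
        using B[of n] PB[of n] by (rule outside_smallI) auto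
      with elim show ?case
      proof (rule outside_small_conj)
        fix \<omega> assume Z: "dist (Z (n, \<omega>)) 0 < e / K" and "(Y n \<omega>)\<^sup>2 < K\<^sup>2"
        then have "\<bar>Y n \<omega>\<bar> < K"
          using K(1) by (intro power2_less_imp_less[of "\<bar>Y n \<omega>\<bar>" K]) auto
        with Z have "\<bar>Z (n, \<omega>)\<bar> * \<bar>Y n \<omega>\<bar> < e / K * K"
          using K(1) \<open>0 < e\<close> by (intro mult_strict_mono) auto
        then show "dist (Z (n, \<omega>) * norm (Y (fst (n, \<omega>)) (snd (n, \<omega>)))) 0 < e"
          using K(1) by (simp add: abs_mult)
      qed
    qed
  qed
qed


section \<open>Sample means\<close>

locale iid_sample = prob_space M for M :: "'a measure" +
  fixes X :: "nat \<Rightarrow> 'a \<Rightarrow> 'x::topological_space" and F :: "'x measure"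
  assumes indep: "indep_vars (\<lambda>_. borel) X UNIV"
    and distr_X: "\<And>i. distr M borel (X i) = F"
begin

definition sample_mean :: "('x \<Rightarrow> real) \<Rightarrow> nat \<times> 'a \<Rightarrow> real" where
  "sample_mean f z = (1 / real (fst z)) * (\<Sum>i<fst z. f (X i (snd z)))"

lemma measurable_X [measurable]: "X i \<in> borel_measurable M"
  using indep by (simp add: indep_vars_def)

lemma sets_F [simp, measurable_cong]: "sets F = sets borel"
  using distr_X[of 0] by auto

lemma prob_space_F: "prob_space F"
  using prob_space_distr[OF measurable_X, of 0] distr_X[of 0] by simp

lemma integrable_sample: "integrable F f \<Longrightarrow> integrable M (\<lambda>\<omega>. f (X i \<omega>))"
  and integral_sample: "f \<in> borel_measurable borel \<Longrightarrow> expectation (\<lambda>\<omega>. f (X i \<omega>)) = integral\<^sup>L F f"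
  for f :: "'x \<Rightarrow> real"
proof -
  show "integrable F f \<Longrightarrow> integrable M (\<lambda>\<omega>. f (X i \<omega>))"
    unfolding distr_X[of i, symmetric] by (rule integrable_distr[OF measurable_X])
  show "f \<in> borel_measurable borel \<Longrightarrow> expectation (\<lambda>\<omega>. f (X i \<omega>)) = integral\<^sup>L F f"
    unfolding distr_X[of i, symmetric] by (rule integral_distr[OF measurable_X, symmetric])
qed

text \<open>Variances add: the new term is independent of the partial sum and has mean zero, so the
  cross term has expectation zero.\<close>

lemma centered_sum_second_moment:
  fixes f :: "'x \<Rightarrow> real"
  assumes [measurable]: "f \<in> borel_measurable borel" and int: "integrable F (\<lambda>x. (f x)\<^sup>2)"
    and zero: "integral\<^sup>L F f = 0"
  shows "integrable M (\<lambda>\<omega>. (\<Sum>i<n. f (X i \<omega>))\<^sup>2) \<and>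
    expectation (\<lambda>\<omega>. (\<Sum>i<n. f (X i \<omega>))\<^sup>2) = real n * (\<integral>x. (f x)\<^sup>2 \<partial>F)"
proof (induction n)
  case (Suc n)
  interpret F: prob_space F by (rule prob_space_F)
  have intf: "integrable F f"
    by (rule F.square_integrable_imp_integrable[OF _ int]) simp
  let ?S = "\<lambda>\<omega>. \<Sum>i<n. f (X i \<omega>)" and ?Y = "\<lambda>\<omega>. f (X n \<omega>)"
  have ind: "indep_vars (\<lambda>_. borel) (\<lambda>i \<omega>. f (X i \<omega>)) UNIV"
    by (rule indep_vars_compose2[OF indep]) simp
  have "indep_vars (\<lambda>_. borel) (\<lambda>i \<omega>. f (X i \<omega>)) (insert n {..<n})"
    by (rule indep_vars_subset[OF ind]) simp
  from indep_vars_sum[OF _ _ this]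
  have ind2: "indep_var borel ?Y borel ?S" by simp
  have intS: "integrable M ?S" and intY: "integrable M ?Y"
    by (intro Bochner_Integration.integrable_sum integrable_sample intf)+
  have int2: "integrable M (\<lambda>\<omega>. ?Y \<omega> * ?S \<omega>)"
    and "expectation (\<lambda>\<omega>. ?Y \<omega> * ?S \<omega>) = expectation ?Y * expectation ?S"
    using indep_var_integrable[OF ind2 intY intS] indep_var_lebesgue_integral[OF ind2 intY intS] by auto
  moreover have "expectation ?Y = 0" using zero by (simp add: integral_sample)
  ultimately have cross: "expectation (\<lambda>\<omega>. ?Y \<omega> * ?S \<omega>) = 0" by simp
  have intY2: "integrable M (\<lambda>\<omega>. (?Y \<omega>)\<^sup>2)" by (rule integrable_sample[OF int])
  have eq: "(\<Sum>i<Suc n. f (X i \<omega>))\<^sup>2 = (?S \<omega>)\<^sup>2 + (2 * (?Y \<omega> * ?S \<omega>) + (?Y \<omega>)\<^sup>2)" for \<omega>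
    by (simp add: power2_eq_square algebra_simps)
  have "expectation (\<lambda>\<omega>. (?Y \<omega>)\<^sup>2) = (\<integral>x. (f x)\<^sup>2 \<partial>F)"
    by (rule integral_sample) measurable
  then show ?case
    unfolding eq using Suc int2 intY2 cross by (simp add: algebra_simps)
qed simp

lemma centered_mean_bounded_in_prob:
  assumes [measurable]: "f \<in> borel_measurable borel" and int: "integrable F (\<lambda>x. (f x)\<^sup>2)"
    and zero: "integral\<^sup>L F f = 0"
  shows "bounded_in_prob M (\<lambda>z. sqrt (real (fst z)) * sample_mean f z)"
proof -
  let ?Y = "\<lambda>n \<omega>. sqrt (real n) * sample_mean f (n, \<omega>)"
  \<comment> \<open>For \<open>n = 0\<close> both sides are zero because division by zero gives
    zero.\<close>
  have sq: "(?Y n \<omega>)\<^sup>2 = (1 / real n) * (\<Sum>i<n. f (X i \<omega>))\<^sup>2" for n \<omega>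
    by (cases "n = 0") (simp_all add: sample_mean_def power_mult_distrib power2_eq_square[of "1 / real n"]
        power_divide power2_eq_square[of "real n"])
  note S = centered_sum_second_moment[OF assms]
  have "?Y n \<in> borel_measurable M" for n
    unfolding sample_mean_def fst_conv snd_conv by measurable
  moreover have "integrable M (\<lambda>\<omega>. (?Y n \<omega>)\<^sup>2)" for n
    unfolding sq using S[of n] by simp
  moreover have "expectation (\<lambda>\<omega>. (?Y n \<omega>)\<^sup>2) \<le> (\<integral>x. (f x)\<^sup>2 \<partial>F)" for n
    unfolding sq using S[of n] by (cases "n = 0") auto
  ultimately have "bounded_in_prob M (\<lambda>z. ?Y (fst z) (snd z))"
    by (rule second_moment_bounded_in_prob)
  then show ?thesis by simp
qed

text \<open>The centered mean is the product of \<open>1 / sqrt n\<close> and a stochastically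
  bounded quantity.\<close>

lemma bounded_mean_tendsto:
  assumes [measurable]: "f \<in> borel_measurable borel" and bound: "\<And>x. \<bar>f x\<bar> \<le> C"
  shows "(sample_mean f \<longlongrightarrow> integral\<^sup>L F f) (in_prob M)"
proof -
  interpret F: prob_space F by (rule prob_space_F)
  let ?m = "integral\<^sup>L F f"
  let ?g = "\<lambda>x. f x - ?m"
  have int: "integrable F f"
    by (rule F.integrable_const_bound[where B = C]) (use bound in auto)
  have "\<bar>?g x\<bar> \<le> C + \<bar>?m\<bar>" for x using bound[of x] by linarith
  then have "(?g x)\<^sup>2 \<le> (C + \<bar>?m\<bar>)\<^sup>2" for x by (rule power2_le_iff_abs_le[THEN iffD2, rotated])
      (use bound[of x] in linarith)
  then have int2: "integrable F (\<lambda>x. (?g x)\<^sup>2)"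
    by (intro F.integrable_const_bound[where B = "(C + \<bar>?m\<bar>)\<^sup>2"]) auto
  have "bounded_in_prob M (\<lambda>z. sqrt (real (fst z)) * sample_mean ?g z)"
    by (rule centered_mean_bounded_in_prob) (use int int2 F.prob_space in simp_all)
  moreover have "((\<lambda>z. 1 / sqrt (real (fst z))) \<longlongrightarrow> 0) (in_prob M)"
  proof (rule filterlim_compose[OF _ filterlim_fst_in_prob])
    show "(\<lambda>n. 1 / sqrt (real n)) \<longlonglongrightarrow> 0" by real_asymp
  qed
  ultimately have lim: "((\<lambda>z. 1 / sqrt (real (fst z)) * norm (sqrt (real (fst z)) * sample_mean ?g z)) \<longlongrightarrow> 0) (in_prob M)"
    by (rule bounded_in_probD)
  have pos: "\<forall>\<^sub>F z in in_prob M. 0 < fst z"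
    using filterlim_fst_in_prob eventually_gt_at_top[of 0] by (rule eventually_compose_filterlim[rotated])
  have "((\<lambda>z. sample_mean f z - ?m) \<longlongrightarrow> 0) (in_prob M)"
  proof (rule tendsto_0_le[OF lim, where K = 1])
    show "\<forall>\<^sub>F z in in_prob M. norm (sample_mean f z - ?m) \<le>
       norm (1 / sqrt (real (fst z)) * norm (sqrt (real (fst z)) * sample_mean ?g z)) * 1"
      using pos
    proof eventually_elim
      case (elim z)
      have "sample_mean ?g z = sample_mean f z - ?m"
        using elim by (simp add: sample_mean_def sum_subtractf field_simps)
      then show ?case using elim by (simp add: abs_mult)
    qed
  qed
  then show ?thesis by (simp add: Lim_null[symmetric])
qed

text \<open>The weak law of large numbers, by truncation: the truncated part has a second moment, the
  remainder is small in mean.\<close>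

lemma sample_mean_tendsto:
  assumes int: "integrable F f"
  shows "(sample_mean f \<longlongrightarrow> integral\<^sup>L F f) (in_prob M)"
proof (rule tendstoI)
  interpret F: prob_space F by (rule prob_space_F)
  fix e :: real assume e: "0 < e"
  have [measurable]: "f \<in> borel_measurable borel"
    using borel_measurable_integrable[OF int] by simp
  show "\<forall>\<^sub>F z in in_prob M. dist (sample_mean f z) (integral\<^sup>L F f) < e"
    unfolding eventually_in_prob
  proof (intro allI impI)
    fix \<delta> :: real assume \<delta>: "0 < \<delta>"
    \<comment> \<open>The first bound keeps the truncation bias below \<open>e / 3\<close>; the
      second makes Markov's inequality at level \<open>e / 3\<close> give probability at most
      \<open>\<delta> / 2\<close>.\<close>
    define \<eta> where "\<eta> = min (e / 3) (\<delta> / 2 * (e / 3))"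
    have \<eta>: "0 < \<eta>" "\<eta> \<le> e / 3" "\<eta> \<le> \<delta> / 2 * (e / 3)" using e \<delta> by (auto simp: \<eta>_def)
    let ?f = "\<lambda>k x. if \<bar>f x\<bar> \<le> real k then f x else 0"
    have "(\<lambda>k. \<integral>x. \<bar>f x - ?f k x\<bar> \<partial>F) \<longlonglongrightarrow> (\<integral>x. 0 \<partial>F)"
    proof (rule integral_dominated_convergence[where w = "\<lambda>x. \<bar>f x\<bar>"])
      show "AE x in F. (\<lambda>k. \<bar>f x - ?f k x\<bar>) \<longlonglongrightarrow> 0"
      proof (rule AE_I2)
        fix x
        have "\<forall>\<^sub>F k in sequentially. \<bar>f x\<bar> \<le> real k"
          using filterlim_real_sequentially unfolding filterlim_at_top by blast
        then have "\<forall>\<^sub>F k in sequentially. \<bar>f x - ?f k x\<bar> = 0"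
          by (rule eventually_mono) simp
        then show "(\<lambda>k. \<bar>f x - ?f k x\<bar>) \<longlonglongrightarrow> 0"
          by (rule tendsto_eventually)
      qed
    qed (use int in auto)
    then have "\<forall>\<^sub>F k in sequentially. (\<integral>x. \<bar>f x - ?f k x\<bar> \<partial>F) < \<eta>"
      using \<eta>(1) by (intro order_tendstoD(2)) auto
    then obtain k where k: "(\<integral>x. \<bar>f x - ?f k x\<bar> \<partial>F) < \<eta>"
      using eventually_happens'[OF sequentially_bot] by blast
    let ?t = "?f k" and ?r = "\<lambda>x. f x - ?f k x"
    have intt: "integrable F ?t"
      by (rule F.integrable_const_bound[where B = "real k"]) auto
    have intr: "integrable F ?r" using int intt by (rule Bochner_Integration.integrable_diff)
    have "(sample_mean ?t \<longlongrightarrow> integral\<^sup>L F ?t) (in_prob M)"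
      by (rule bounded_mean_tendsto[where C = "real k"]) auto
    then have "\<forall>\<^sub>F z in in_prob M. dist (sample_mean ?t z) (integral\<^sup>L F ?t) < e / 3"
      using e by (intro tendstoD) auto
    moreover have "0 < \<delta> / 2" using \<delta> by simp
    ultimately have "\<forall>\<^sub>F n in sequentially. outside_small M (\<delta> / 2)
        (\<lambda>\<omega>. dist (sample_mean ?t (n, \<omega>)) (integral\<^sup>L F ?t) < e / 3)"
      unfolding eventually_in_prob by blast
    then show "\<forall>\<^sub>F n in sequentially. outside_small M \<delta>
        (\<lambda>\<omega>. dist (sample_mean f (n, \<omega>)) (integral\<^sup>L F f) < e)"
    proof eventually_elim
      case (elim n)
      let ?R = "\<lambda>\<omega>. sample_mean (\<lambda>x. \<bar>?r x\<bar>) (n, \<omega>)"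
      let ?B = "{\<omega> \<in> space M. e / 3 \<le> ?R \<omega>}"
      have intR: "integrable M ?R"
        unfolding sample_mean_def fst_conv snd_conv
        by (intro integrable_mult_right Bochner_Integration.integrable_sum
            integrable_sample[of "\<lambda>x. \<bar>?r x\<bar>"] integrable_abs intr)
      have B: "?B \<in> sets M" using borel_measurable_integrable[OF intR] by measurable
      have ER: "expectation ?R \<le> \<eta>"
      proof -
        have "expectation ?R = (1 / real n) * (\<Sum>i<n. expectation (\<lambda>\<omega>. \<bar>?r (X i \<omega>)\<bar>))"
          unfolding sample_mean_def fst_conv snd_conv
          by (subst integral_mult_right_zero, subst Bochner_Integration.integral_sum)
            (use intr in \<open>auto intro!: integrable_sample[of "\<lambda>x. \<bar>?r x\<bar>"]\<close>)
        also have "\<dots> = (1 / real n) * (real n * (\<integral>x. \<bar>?r x\<bar> \<partial>F))"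
          by (subst integral_sample[of "\<lambda>x. \<bar>?r x\<bar>"]) auto
        also have "\<dots> \<le> \<eta>" using k \<eta>(1) by (cases "n = 0") auto
        finally show ?thesis .
      qed
      have Rnn: "0 \<le> ?R \<omega>" for \<omega> by (simp add: sample_mean_def sum_nonneg)
      have "measure M ?B \<le> expectation ?R / (e / 3)"
        using e Rnn by (intro integral_Markov_inequality_measure[OF intR, of "space M"]) auto
      also have "\<dots> \<le> \<delta> / 2" using ER \<eta>(3) e by (simp add: field_simps)
      finally have PB: "measure M ?B \<le> \<delta> / 2" .
      have Er: "\<bar>integral\<^sup>L F ?r\<bar> < e / 3"
        using integral_abs_bound[of F ?r] k \<eta>(2) by linarith
      have "outside_small M (\<delta> / 2) (\<lambda>\<omega>. ?R \<omega> < e / 3)"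
        using B PB by (rule outside_smallI) auto
      with elim show ?case
      proof (rule outside_small_conj)
        fix \<omega> assume t: "dist (sample_mean ?t (n, \<omega>)) (integral\<^sup>L F ?t) < e / 3" and "?R \<omega> < e / 3"
        have "sample_mean f (n, \<omega>) = sample_mean ?t (n, \<omega>) + sample_mean ?r (n, \<omega>)"
          unfolding sample_mean_def distrib_left[symmetric] sum.distrib[symmetric]
          by (intro arg_cong2[where f = "(*)"] sum.cong refl) simp
        moreover have "integral\<^sup>L F f = integral\<^sup>L F ?t + integral\<^sup>L F ?r"
          using int intt by (subst Bochner_Integration.integral_diff) auto
        moreover have "\<bar>sample_mean ?r (n, \<omega>)\<bar> \<le> ?R \<omega>"
          unfolding sample_mean_def abs_mult by (intro mult_mono sum_abs) auto
        ultimately show "dist (sample_mean f (n, \<omega>)) (integral\<^sup>L F f) < e"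
          using Er t \<open>?R \<omega> < e / 3\<close> unfolding dist_real_def by linarith
      qed
    qed
  qed
qed

end


section \<open>Symmetry of elliptical distributions\<close>

text \<open>The reflection that maps \<open>S *v d\<close> to its negative and preserves the inner product given by the
  inverse of \<open>S\<close>.\<close>

definition reflection :: "real ^ 'n ^ 'n \<Rightarrow> real ^ 'n \<Rightarrow> real ^ 'n ^ 'n" where
  "reflection S d = mat 1 - (2 / (d \<bullet> (S *v d))) *\<^sub>R (\<chi> i j. (S *v d) $ i * d $ j)"

lemma reflection_vec: "reflection S d *v v = v - (2 * (d \<bullet> v) / (d \<bullet> (S *v d))) *\<^sub>R (S *v d)"
proof -
  have "(\<chi> i j. w $ i * d $ j) *v v = (d \<bullet> v) *\<^sub>R w" for w :: "real ^ 'n"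
    by (simp add: vec_eq_iff matrix_vector_mult_def inner_vec_def sum_distrib_left sum_distrib_right mult_ac)
  from this[of "S *v d"] show ?thesis
    by (simp add: reflection_def matrix_vector_mult_diff_rdistrib scaleR_matrix_vector_assoc[symmetric])
qed

lemma reflection_scaleR: "\<eta> \<noteq> 0 \<Longrightarrow> reflection (\<eta> *\<^sub>R S) d = reflection S d"
  by (simp add: matrix_eq reflection_vec scaleR_matrix_vector_assoc[symmetric])

context
  fixes S :: "real ^ 'n ^ 'n"
  assumes S: "S \<in> spd"
begin

lemma reflection_involution: "reflection S d *v (reflection S d *v v) = v"
proof (cases "d = 0")
  case False
  then have "d \<bullet> (S *v d) \<noteq> 0" using spd_pos[OF S] by fastforce
  then show ?thesis
    by (simp add: reflection_vec inner_diff_right field_simps)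
qed (simp add: reflection_vec)

lemma reflection_preserves: "(reflection S d *v v) \<bullet> (matrix_inv S *v (reflection S d *v v)) = v \<bullet> (matrix_inv S *v v)"
proof (cases "d = 0")
  case False
  then have "d \<bullet> (S *v d) \<noteq> 0" using spd_pos[OF S] by fastforce
  moreover have "matrix_inv S *v (S *v d) = d"
    by (simp add: matrix_vector_mul_assoc spd_inv_left[OF S])
  moreover have "(S *v d) \<bullet> (matrix_inv S *v v) = d \<bullet> v"
    by (metis calculation(2) inner_commute spd_inv_spd[OF S] spd_sym symmetric_inner_commute)
  ultimately show ?thesis
    by (simp add: reflection_vec matrix_vector_mult_diff_distrib matrix_vector_mult_scaleR inner_diff_left
        inner_diff_right inner_commute[of v d] inner_commute[of "S *v d" d] power2_eq_square field_simps)
qed (simp add: reflection_vec)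

text \<open>The adjoint of the reflection along \<open>a - b\<close> carries \<open>a\<close> to
  \<open>b\<close>. Thus the symmetries act transitively on vectors of equal length with respect to
  \<open>S\<close>, and an invariant function of \<open>a\<close> depends only on
  \<open>a \<bullet> (S *v a)\<close>.\<close>

lemma reflection_moves:
  assumes "a \<bullet> (S *v a) = b \<bullet> (S *v b)"
  shows "a \<bullet> (reflection S (a - b) *v v) = b \<bullet> v"
proof (cases "a = b")
  case False
  define d where "d = a - b"
  have pos: "d \<bullet> (S *v d) \<noteq> 0" using spd_pos[OF S, of d] False by (auto simp: d_def)
  \<comment> \<open>Equal lengths make \<open>a + b\<close> orthogonal to \<open>d\<close> with
    respect to \<open>S\<close>.\<close>
  have "d \<bullet> (S *v d) = 2 * (a \<bullet> (S *v d))"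
    using assms symmetric_inner_commute[OF spd_sym[OF S], of a b]
    by (simp add: d_def matrix_vector_mult_diff_distrib inner_diff_left inner_diff_right)
  then have "a \<bullet> (reflection S d *v v) = a \<bullet> v - d \<bullet> v"
    using pos by (simp add: reflection_vec inner_diff_right)
  then show ?thesis by (simp add: d_def inner_diff_left)
qed (simp add: reflection_vec)

end

text \<open>The library computes the measure of linear images only for well-ordered index types. Here the
  argument is uniqueness of translation invariant measures, compared on the ellipsoid
  \<open>x \<bullet> (K *v x) \<le> 1\<close>, which the map preserves.\<close>

lemma lborel_distr_form_preserving:
  fixes f :: "real ^ 'n \<Rightarrow> real ^ 'n"
  assumes f: "linear f" and K: "K \<in> spd" and pres: "\<And>x. f x \<bullet> (K *v f x) = x \<bullet> (K *v x)"
  shows "distr lborel borel f = lborel"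
proof -
  have [measurable]: "f \<in> borel_measurable borel"
    using f by (intro borel_measurable_continuous_onI linear_continuous_on) (simp add: linear_conv_bounded_linear)
  define E where "E r = {x. x \<bullet> (K *v x) \<le> r}" for r
  define \<nu> where "\<nu> = distr lborel borel f"
  obtain c where c: "0 < c" "\<And>x. c * (x \<bullet> x) \<le> x \<bullet> (K *v x)"
    using spd_lower_bound[OF K] by blast
  have contq: "continuous_on UNIV (\<lambda>x. x \<bullet> (K *v x))" by (intro continuous_intros)
  have E_closed: "closed (E r)" for r
    unfolding E_def by (intro closed_Collect_le contq continuous_on_const)
  then have E_meas [measurable]: "E r \<in> sets borel" for r by auto
  have "bounded (E r)" for r
    unfolding bounded_iff
  proof (intro exI ballI)
    fix x assume "x \<in> E r"
    then have "x \<bullet> x \<le> r / c" using c(2)[of x] c(1) by (simp add: E_def field_simps)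
    then show "norm x \<le> sqrt (r / c)" by (simp add: norm_eq_sqrt_inner)
  qed
  then have E_fin: "emeasure lborel (E r) < \<infinity>" for r
    using E_closed emeasure_bounded_finite by (auto simp: less_top)
  have E_pos: "emeasure lborel (E 1) \<noteq> 0"
  proof -
    have op: "open {x. x \<bullet> (K *v x) < 1}"
      by (intro open_Collect_less contq continuous_on_const)
    have "emeasure lborel {x. x \<bullet> (K *v x) < 1} \<noteq> 0"
    proof
      assume "emeasure lborel {x. x \<bullet> (K *v x) < 1} = 0"
      then have "negligible {x. x \<bullet> (K *v x) < 1}"
        using op by (auto simp: negligible_iff_null_sets null_sets_completionI null_setsI)
      then have "{x. x \<bullet> (K *v x) < 1} = {}"
        using op open_not_negligible by blast
      then show False by (metis (mono_tags, lifting) empty_iff inner_zero_left mem_Collect_eq zero_less_one)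
    qed
    moreover have "emeasure lborel {x. x \<bullet> (K *v x) < 1} \<le> emeasure lborel (E 1)"
      using E_meas[of 1] by (intro emeasure_mono) (auto simp: E_def)
    ultimately show ?thesis by (metis le_zero_eq)
  qed
  have \<nu>E: "emeasure \<nu> (E r) = emeasure lborel (E r)" for r
  proof -
    have "f -` E r = E r" by (auto simp: E_def pres)
    then show ?thesis by (simp add: \<nu>_def emeasure_distr)
  qed
  interpret \<nu>: sigma_finite_measure \<nu>
  proof
    show "\<exists>A. countable A \<and> A \<subseteq> sets \<nu> \<and> \<Union> A = space \<nu> \<and> (\<forall>a\<in>A. emeasure \<nu> a \<noteq> \<infinity>)"
    proof (intro exI conjI)
      show "countable (range (\<lambda>k. E (real k)))" by simp
      show "range (\<lambda>k. E (real k)) \<subseteq> sets \<nu>" by (auto simp: \<nu>_def)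
      show "\<Union> (range (\<lambda>k. E (real k))) = space \<nu>"
        using real_arch_simple by (auto simp: \<nu>_def E_def)
      show "\<forall>a\<in>range (\<lambda>k. E (real k)). emeasure \<nu> a \<noteq> \<infinity>"
        using E_fin by (auto simp: \<nu>E less_top)
    qed
  qed
  have sets\<nu> [measurable_cong]: "sets \<nu> = sets borel" by (simp add: \<nu>_def)
  have "f x = 0 \<Longrightarrow> x = 0" for x
    using pres[of x] spd_pos[OF K, of x] by force
  then have "inj f" using f linear_injective_0 by blast
  then have "surj f" using f linear_injective_imp_surjective by blast
  have \<nu>_shift: "(\<integral>\<^sup>+y. h (y + v) \<partial>\<nu>) = (\<integral>\<^sup>+y. h y \<partial>\<nu>)"
    if [measurable]: "h \<in> borel_measurable borel" for h v
  proof -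
    obtain u where u: "f u = v" using \<open>surj f\<close> by (metis surjD)
    have "(\<integral>\<^sup>+y. h (y + v) \<partial>\<nu>) = (\<integral>\<^sup>+x. h (f (u + x)) \<partial>lborel)"
      by (simp add: \<nu>_def nn_integral_distr linear_add[OF f] u add.commute)
    also have "\<dots> = (\<integral>\<^sup>+x. h (f x) \<partial>distr lborel borel ((+) u))"
      by (simp add: nn_integral_distr)
    also have "\<dots> = (\<integral>\<^sup>+y. h y \<partial>\<nu>)"
      by (simp add: \<nu>_def nn_integral_distr lborel_distr_plus)
    finally show ?thesis .
  qed
  have lborel_shift: "(\<integral>\<^sup>+x. h (x + v) \<partial>lborel) = (\<integral>\<^sup>+x. h x \<partial>lborel)"
    if [measurable]: "h \<in> borel_measurable borel" for h and v :: "real ^ 'n"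
  proof -
    have "(\<integral>\<^sup>+x. h x \<partial>lborel) = (\<integral>\<^sup>+x. h x \<partial>distr lborel borel ((+) v))"
      by (simp add: lborel_distr_plus)
    then show ?thesis by (simp add: nn_integral_distr add.commute)
  qed
  interpret P: pair_sigma_finite lborel \<nu> ..
  \<comment> \<open>The double integral of \<open>indicator (E 1) y * indicator A (x + y)\<close> is
    evaluated in both orders. Translation invariance of \<open>lborel\<close> gives one side, that
    of \<open>\<nu>\<close> the other.\<close>
  have main: "emeasure \<nu> (E 1) * emeasure lborel A = emeasure lborel (E 1) * emeasure \<nu> A"
    if [measurable]: "A \<in> sets borel" for A
  proof -
    have "emeasure \<nu> (E 1) * emeasure lborel A
        = (\<integral>\<^sup>+y. indicator (E 1) y * (\<integral>\<^sup>+x. indicator A (x + y) \<partial>lborel) \<partial>\<nu>)"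
      by (subst lborel_shift) (simp_all add: nn_integral_multc)
    also have "\<dots> = (\<integral>\<^sup>+y. \<integral>\<^sup>+x. indicator (E 1) y * indicator A (x + y) \<partial>lborel \<partial>\<nu>)"
      by (simp add: nn_integral_cmult)
    also have "\<dots> = (\<integral>\<^sup>+x. \<integral>\<^sup>+y. indicator (E 1) y * indicator A (x + y) \<partial>\<nu> \<partial>lborel)"
      by (intro P.Fubini') measurable
    also have "\<dots> = (\<integral>\<^sup>+x. \<integral>\<^sup>+y. indicator (E 1) (y - x) * indicator A y \<partial>\<nu> \<partial>lborel)"
    proof (rule nn_integral_cong)
      fix x
      have "(\<integral>\<^sup>+y. indicator (E 1) (y - x) * indicator A y \<partial>\<nu>)
          = (\<integral>\<^sup>+y. indicator (E 1) (y + x - x) * indicator A (y + x) \<partial>\<nu>)"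
        by (rule \<nu>_shift[symmetric]) measurable
      then show "(\<integral>\<^sup>+y. indicator (E 1) y * indicator A (x + y) \<partial>\<nu>)
          = (\<integral>\<^sup>+y. indicator (E 1) (y - x) * indicator A y \<partial>\<nu> :: ennreal)"
        by (simp add: add.commute)
    qed
    also have "\<dots> = (\<integral>\<^sup>+y. \<integral>\<^sup>+x. indicator (E 1) (y - x) * indicator A y \<partial>lborel \<partial>\<nu>)"
      by (intro P.Fubini'[symmetric]) measurable
    also have "\<dots> = (\<integral>\<^sup>+y. indicator A y * (\<integral>\<^sup>+x. indicator (E 1) (x + - y) \<partial>lborel) \<partial>\<nu>)"
    proof (rule nn_integral_cong)
      fix y
      \<comment> \<open>The ellipsoid is symmetric about the origin.\<close>
      have "indicator (E 1) (y - x) = (indicator (E 1) (x + - y) :: ennreal)" for x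
        unfolding indicator_def E_def
        by (simp add: matrix_vector_mult_diff_distrib inner_diff_left inner_diff_right)
      then show "(\<integral>\<^sup>+x. indicator (E 1) (y - x) * indicator A y \<partial>lborel)
          = indicator A y * (\<integral>\<^sup>+x. indicator (E 1) (x + - y) \<partial>lborel)"
        by (subst nn_integral_multc) (auto simp: mult.commute)
    qed
    also have "\<dots> = emeasure lborel (E 1) * emeasure \<nu> A"
      by (subst lborel_shift) (simp_all add: nn_integral_multc mult.commute)
    finally show ?thesis .
  qed
  have "\<nu> = lborel"
  proof (rule measure_eqI)
    fix A assume "A \<in> sets \<nu>"
    then have "emeasure lborel (E 1) * emeasure lborel A = emeasure lborel (E 1) * emeasure \<nu> A"
      using main \<nu>E by (simp add: sets\<nu>)
    then show "emeasure \<nu> A = emeasure lborel A"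
      using E_pos E_fin[of 1] by (auto simp: ennreal_mult_cancel_left)
  qed (simp add: sets\<nu>)
  then show ?thesis by (simp add: \<nu>_def)
qed

lemma distr_density_form_preserving:
  fixes f :: "real ^ 'n \<Rightarrow> real ^ 'n"
  assumes f: "linear f" and K: "K \<in> spd" and pres: "\<And>x. f x \<bullet> (K *v f x) = x \<bullet> (K *v x)"
    and [measurable]: "\<phi> \<in> borel_measurable borel" and inv: "\<And>x. \<phi> (\<mu> + f (x - \<mu>)) = \<phi> x"
  shows "distr (density lborel \<phi>) borel (\<lambda>x. \<mu> + f (x - \<mu>)) = density lborel \<phi>"
proof -
  have [measurable]: "f \<in> borel_measurable borel"
    using f by (intro borel_measurable_continuous_onI linear_continuous_on) (simp add: linear_conv_bounded_linear)
  have "distr lborel borel (\<lambda>x. \<mu> + f (x - \<mu>))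
      = distr (distr (distr lborel borel ((+) (- \<mu>))) borel f) borel ((+) \<mu>)"
    by (simp add: distr_distr o_def)
  also have "\<dots> = lborel"
    by (simp add: lborel_distr_plus lborel_distr_form_preserving[OF f K pres])
  finally have inv_lborel: "distr lborel borel (\<lambda>x. \<mu> + f (x - \<mu>)) = lborel" .
  have "distr (density lborel \<phi>) borel (\<lambda>x. \<mu> + f (x - \<mu>))
      = distr (density lborel (\<lambda>x. \<phi> (\<mu> + f (x - \<mu>)))) borel (\<lambda>x. \<mu> + f (x - \<mu>))"
    by (simp add: inv)
  also have "\<dots> = density (distr lborel borel (\<lambda>x. \<mu> + f (x - \<mu>))) \<phi>"
    by (subst density_distr) auto
  also have "\<dots> = density lborel \<phi>"
    by (simp add: inv_lborel)
  finally show ?thesis .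
qed

section \<open>Fourth moments of a law with the symmetries of an ellipsoid\<close>

lemma borel_measurable_vec_nth [measurable (raw)]:
  fixes f :: "'a \<Rightarrow> real ^ 'n"
  assumes "f \<in> borel_measurable M"
  shows "(\<lambda>x. f x $ i) \<in> borel_measurable M"
  by (rule borel_measurable_continuous_on[OF _ assms]) (intro continuous_intros)

text \<open>Fourth powers are even, so the first sign can be fixed. The signed sum over the
  remaining eight patterns retains only the mixed monomial, with coefficient 8 * 24 = 192.\<close>

lemma fourth_power_polarization:
  "u * v * w * z = (1 / 192) * ((u + v + w + z) ^ 4 - (u + v + w - z) ^ 4
     - (u + v - w + z) ^ 4 + (u + v - w - z) ^ 4 - (u - v + w + z) ^ 4 + (u - v + w - z) ^ 4
     + (u - v - w + z) ^ 4 - (u - v - w - z) ^ 4)" for u v w z :: real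
  by (simp add: power4_eq_xxxx) algebra

text \<open>The same polarization with each fourth power replaced by \<open>\<kappa>\<close> times
  the squared value of a quadratic form; \<open>p\<close> collects the diagonal terms and
  \<open>ab\<close>, ..., \<open>cd\<close> are the mixed ones. The result is the sum over the three
  pairings familiar from Gaussian fourth moments.\<close>

lemma square_form_polarization:
  "(1 / 192) * (\<kappa> * (p + 2 * (ab + ac + ad + bc + bd + cd))\<^sup>2
     - \<kappa> * (p + 2 * (ab + ac - ad + bc - bd - cd))\<^sup>2
     - \<kappa> * (p + 2 * (ab - ac + ad - bc + bd - cd))\<^sup>2
     + \<kappa> * (p + 2 * (ab - ac - ad - bc - bd + cd))\<^sup>2
     - \<kappa> * (p + 2 * (- ab + ac + ad - bc - bd + cd))\<^sup>2
     + \<kappa> * (p + 2 * (- ab + ac - ad - bc + bd - cd))\<^sup>2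
     + \<kappa> * (p + 2 * (- ab - ac + ad + bc - bd - cd))\<^sup>2
     - \<kappa> * (p + 2 * (- ab - ac - ad + bc + bd + cd))\<^sup>2)
   = \<kappa> / 3 * (ab * cd + ac * bd + ad * bc)" for \<kappa> p :: real
  by (simp add: power2_eq_square) algebra

text \<open>What later arguments use of the density. The reflections determine \<open>S\<close> only
  up to a positive factor, so the same locale applies with the population scatter in place of
  \<open>S\<close>.\<close>

locale elliptical_law = prob_space F for F :: "(real ^ 'p) measure" +
  fixes \<mu> :: "real ^ 'p" and S :: "real ^ 'p ^ 'p"
  assumes sets_F [simp, measurable_cong]: "sets F = sets borel"
    and S: "S \<in> spd"
    and refl_invariant: "\<And>d. distr F borel (\<lambda>x. \<mu> + reflection S d *v (x - \<mu>)) = F"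
    and center_invariant: "distr F borel (\<lambda>x. \<mu> - (x - \<mu>)) = F"
    and hyperplane_null: "\<And>i. AE x in F. x $ i \<noteq> \<mu> $ i"
begin

lemma space_F [simp]: "space F = UNIV"
  using sets_eq_imp_space_eq[OF sets_F] by simp

abbreviation T :: "real ^ 'p \<Rightarrow> real ^ 'p \<Rightarrow> real ^ 'p" where
  "T d x \<equiv> \<mu> + reflection S d *v (x - \<mu>)"

lemma T_measurable [measurable]: "T d \<in> borel_measurable borel"
  by (intro borel_measurable_continuous_onI continuous_intros
      bounded_linear.continuous_on[OF matrix_vector_mul_bounded_linear])

lemma integral_refl:
  fixes h :: "real ^ 'p \<Rightarrow> real"
  assumes "h \<in> borel_measurable borel"
  shows "(\<integral>x. h (T d x) \<partial>F) = (\<integral>x. h x \<partial>F)"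
  using integral_distr[of "T d" F borel h] assms by (simp add: refl_invariant)

lemma AE_refl:
  assumes "AE x in F. P x"
  shows "AE x in F. P (T d x)"
proof -
  have "T d \<in> borel_measurable F" by measurable
  then show ?thesis
    by (rule AE_distrD) (subst refl_invariant, rule assms)
qed

text \<open>The arithmetic-geometric inequality, used twice. It carries integrability from pure
  fourth powers to all mixed monomials.\<close>

lemma quartic_monomial_bound:
  "\<bar>a * b * c * d\<bar> \<le> a ^ 4 + b ^ 4 + c ^ 4 + d ^ 4" for a b c d :: real
proof -
  have *: "\<bar>u * v\<bar> \<le> (u\<^sup>2 + v\<^sup>2) / 2" for u v :: real
  proof -
    have "0 \<le> (\<bar>u\<bar> - \<bar>v\<bar>)\<^sup>2" by simp
    then show ?thesis by (simp add: power2_eq_square algebra_simps abs_mult)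
  qed
  have "\<bar>a * b * c * d\<bar> = \<bar>(a * b) * (c * d)\<bar>" by (simp add: mult.assoc)
  also have "\<dots> \<le> ((a * b)\<^sup>2 + (c * d)\<^sup>2) / 2" by (rule *)
  also have "\<dots> \<le> a ^ 4 + b ^ 4 + c ^ 4 + d ^ 4"
  proof -
    have "a\<^sup>2 * b\<^sup>2 \<le> (a ^ 4 + b ^ 4) / 2" "c\<^sup>2 * d\<^sup>2 \<le> (c ^ 4 + d ^ 4) / 2"
      using *[of "a\<^sup>2" "b\<^sup>2"] *[of "c\<^sup>2" "d\<^sup>2"] by (simp_all flip: power_mult)
    moreover have "0 \<le> a ^ 4" "0 \<le> b ^ 4" "0 \<le> c ^ 4" "0 \<le> d ^ 4" by simp_all
    moreover have "(u + v) / 2 \<le> p + q + r + s"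
      if "u \<le> (p + q) / 2" "v \<le> (r + s) / 2" "0 \<le> p" "0 \<le> q" "0 \<le> r" "0 \<le> s" for u v p q r s :: real
      using that by (simp add: field_simps)
    ultimately show ?thesis unfolding power_mult_distrib by blast
  qed
  finally show ?thesis .
qed

text \<open>The weighted fourth moment \<open>Q a\<close> of the projection on \<open>a\<close>
  inherits the reflection symmetry, so it is a multiple of the squared form of \<open>S\<close>;
  polarization then yields all mixed moments.\<close>

lemma fourth_moments:
  fixes W :: "real ^ 'p \<Rightarrow> real"
  assumes [measurable]: "W \<in> borel_measurable borel"
    and W: "\<And>d. AE x in F. W (T d x) = W x"
    and int: "\<And>i. integrable F (\<lambda>x. W x * (x - \<mu>) $ i ^ 4)"
  obtains c where "\<And>i j k l. integrable F (\<lambda>x. W x * ((x - \<mu>) $ i * (x - \<mu>) $ j * (x - \<mu>) $ k * (x - \<mu>) $ l))"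
    and "\<And>i j k l. (\<integral>x. W x * ((x - \<mu>) $ i * (x - \<mu>) $ j * (x - \<mu>) $ k * (x - \<mu>) $ l) \<partial>F)
      = c * (S $ i $ j * S $ k $ l + S $ i $ k * S $ j $ l + S $ i $ l * S $ j $ k)"
proof -
  let ?m = "\<lambda>i j k l x. W x * ((x - \<mu>) $ i * (x - \<mu>) $ j * (x - \<mu>) $ k * (x - \<mu>) $ l)"
  have m_int: "integrable F (?m i j k l)" for i j k l
  proof (rule Bochner_Integration.integrable_bound)
    show "integrable F (\<lambda>x. W x * (x - \<mu>) $ i ^ 4 + W x * (x - \<mu>) $ j ^ 4 + W x * (x - \<mu>) $ k ^ 4 + W x * (x - \<mu>) $ l ^ 4)"
      by (intro Bochner_Integration.integrable_add int)
    show "?m i j k l \<in> borel_measurable F" by measurable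
    show "AE x in F. norm (?m i j k l x) \<le>
      norm (W x * (x - \<mu>) $ i ^ 4 + W x * (x - \<mu>) $ j ^ 4 + W x * (x - \<mu>) $ k ^ 4 + W x * (x - \<mu>) $ l ^ 4)"
    proof (rule AE_I2)
      fix x
      let ?b = "(x - \<mu>) $ i ^ 4 + (x - \<mu>) $ j ^ 4 + (x - \<mu>) $ k ^ 4 + (x - \<mu>) $ l ^ 4"
      have "norm (?m i j k l x) \<le> \<bar>W x\<bar> * ?b"
        unfolding real_norm_def abs_mult[of "W x"]
        by (intro mult_left_mono quartic_monomial_bound) auto
      also have "\<dots> = \<bar>W x * ?b\<bar>" by (simp add: abs_mult)
      finally show "norm (?m i j k l x) \<le>
        norm (W x * (x - \<mu>) $ i ^ 4 + W x * (x - \<mu>) $ j ^ 4 + W x * (x - \<mu>) $ k ^ 4 + W x * (x - \<mu>) $ l ^ 4)"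
        by (simp add: distrib_left)
    qed
  qed
  define q where "q a x = W x * (a \<bullet> (x - \<mu>)) ^ 4" for a x
  define Q where "Q a = (\<integral>x. q a x \<partial>F)" for a
  have Q_int: "integrable F (q a)" for a
  proof -
    have eq: "q a x
      = (\<Sum>i\<in>UNIV. \<Sum>j\<in>UNIV. \<Sum>k\<in>UNIV. \<Sum>l\<in>UNIV. (a $ i * a $ j * a $ k * a $ l) * ?m i j k l x)" for x
      by (simp add: q_def power4_eq_xxxx inner_vec_def sum_product sum_distrib_left mult_ac)
    show ?thesis unfolding eq[abs_def]
      by (intro Bochner_Integration.integrable_sum integrable_mult_right m_int)
  qed
  have Q_inv: "Q a = Q b" if "a \<bullet> (S *v a) = b \<bullet> (S *v b)" for a b
  proof -
    let ?d = "a - b"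
    have "Q a = (\<integral>x. W (T ?d x) * (a \<bullet> (T ?d x - \<mu>)) ^ 4 \<partial>F)"
      unfolding Q_def q_def by (rule integral_refl[symmetric]) measurable
    also have "\<dots> = (\<integral>x. W x * (b \<bullet> (x - \<mu>)) ^ 4 \<partial>F)"
    proof (rule integral_cong_AE)
      show "AE x in F. W (T ?d x) * (a \<bullet> (T ?d x - \<mu>)) ^ 4 = W x * (b \<bullet> (x - \<mu>)) ^ 4"
        using W[of ?d] by eventually_elim (simp add: reflection_moves[OF S that])
    qed measurable
    finally show ?thesis by (simp add: Q_def q_def)
  qed
  \<comment> \<open>The index \<open>undefined\<close> only serves as some element of the index
    type.\<close>
  define e :: "real ^ 'p" where "e = axis undefined 1"
  have e: "0 < e \<bullet> (S *v e)" by (rule spd_pos[OF S]) (simp add: e_def axis_eq_0_iff)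
  define \<kappa> where "\<kappa> = Q e / (e \<bullet> (S *v e))\<^sup>2"
  have Q: "Q a = \<kappa> * (a \<bullet> (S *v a))\<^sup>2" for a
  proof -
    \<comment> \<open>This factor gives \<open>t *\<^sub>R e\<close> the same length as
      \<open>a\<close> with respect to \<open>S\<close>; homogeneity of degree four then reduces
      \<open>Q a\<close> to \<open>Q e\<close>.\<close>
    define t where "t = sqrt (a \<bullet> (S *v a) / (e \<bullet> (S *v e)))"
    have t2: "t\<^sup>2 = a \<bullet> (S *v a) / (e \<bullet> (S *v e))"
      using spd_nonneg[OF S, of a] e by (simp add: t_def)
    have "(t *\<^sub>R e) \<bullet> (S *v (t *\<^sub>R e)) = t\<^sup>2 * (e \<bullet> (S *v e))"
      by (simp add: matrix_vector_mult_scaleR power2_eq_square)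
    also have "\<dots> = a \<bullet> (S *v a)" using e by (simp add: t2)
    finally have "Q a = Q (t *\<^sub>R e)" by (intro Q_inv) simp
    also have "\<dots> = (\<integral>x. t ^ 4 * (W x * (e \<bullet> (x - \<mu>)) ^ 4) \<partial>F)"
      unfolding Q_def q_def by (simp add: power_mult_distrib mult_ac)
    also have "\<dots> = t ^ 4 * Q e" by (simp add: Q_def q_def)
    also have "t ^ 4 = (t\<^sup>2)\<^sup>2" by simp
    finally show ?thesis by (simp add: t2 \<kappa>_def power_divide)
  qed
  have "(\<integral>x. ?m i j k l x \<partial>F) = \<kappa> / 3 * (S $ i $ j * S $ k $ l + S $ i $ k * S $ j $ l + S $ i $ l * S $ j $ k)" for i j k l
  proof -
    let ?a = "axis i 1 :: real ^ 'p" and ?b = "axis j 1 :: real ^ 'p"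
      and ?c = "axis k 1 :: real ^ 'p" and ?d = "axis l 1 :: real ^ 'p"
    let ?p = "S $ i $ i + S $ j $ j + S $ k $ k + S $ l $ l"
    note sym = sym_nth[OF spd_sym[OF S]]
    have form: "(\<epsilon>1 *\<^sub>R ?a + \<epsilon>2 *\<^sub>R ?b + \<epsilon>3 *\<^sub>R ?c + \<epsilon>4 *\<^sub>R ?d) \<bullet> (S *v (\<epsilon>1 *\<^sub>R ?a + \<epsilon>2 *\<^sub>R ?b + \<epsilon>3 *\<^sub>R ?c + \<epsilon>4 *\<^sub>R ?d))
      = \<epsilon>1\<^sup>2 * S $ i $ i + \<epsilon>2\<^sup>2 * S $ j $ j + \<epsilon>3\<^sup>2 * S $ k $ k + \<epsilon>4\<^sup>2 * S $ l $ l
        + 2 * (\<epsilon>1 * \<epsilon>2 * S $ i $ j + \<epsilon>1 * \<epsilon>3 * S $ i $ k + \<epsilon>1 * \<epsilon>4 * S $ i $ l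
          + \<epsilon>2 * \<epsilon>3 * S $ j $ k + \<epsilon>2 * \<epsilon>4 * S $ j $ l + \<epsilon>3 * \<epsilon>4 * S $ k $ l)" for \<epsilon>1 \<epsilon>2 \<epsilon>3 \<epsilon>4
      by (simp only: matrix_vector_right_distrib matrix_vector_mult_scaleR inner_add_left
          inner_add_right inner_scaleR_left inner_scaleR_right axis_inner_matrix
          sym[of j i] sym[of k i] sym[of l i] sym[of k j] sym[of l j] sym[of l k])
        (simp add: power2_eq_square algebra_simps)
    have m: "?m i j k l x = (1 / 192) * (q (?a + ?b + ?c + ?d) x - q (?a + ?b + ?c - ?d) x
       - q (?a + ?b - ?c + ?d) x + q (?a + ?b - ?c - ?d) x - q (?a - ?b + ?c + ?d) x
       + q (?a - ?b + ?c - ?d) x + q (?a - ?b - ?c + ?d) x - q (?a - ?b - ?c - ?d) x)" for x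
      by (subst fourth_power_polarization)
        (simp add: q_def inner_add_left inner_diff_left inner_axis' algebra_simps)
    have "(\<integral>x. ?m i j k l x \<partial>F) = (1 / 192) * (Q (?a + ?b + ?c + ?d)
       - Q (?a + ?b + ?c - ?d) - Q (?a + ?b - ?c + ?d)
       + Q (?a + ?b - ?c - ?d) - Q (?a - ?b + ?c + ?d)
       + Q (?a - ?b + ?c - ?d) + Q (?a - ?b - ?c + ?d) - Q (?a - ?b - ?c - ?d))"
      unfolding m using Q_int by (simp add: Q_def)
    also have "\<dots> = \<kappa> / 3 * (S $ i $ j * S $ k $ l + S $ i $ k * S $ j $ l + S $ i $ l * S $ j $ k)"
      unfolding Q square_form_polarization[symmetric, of _ _ _ _ _ _ _ ?p]
      using form[of 1 1 1 1] form[of 1 1 1 "-1"] form[of 1 1 "-1" 1] form[of 1 1 "-1" "-1"]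
        form[of 1 "-1" 1 1] form[of 1 "-1" 1 "-1"] form[of 1 "-1" "-1" 1] form[of 1 "-1" "-1" "-1"]
      by simp
    finally show ?thesis .
  qed
  then show thesis using that m_int by blast
qed

end


section \<open>Coordinates\<close>

text \<open>The direction in which the symmetric matrix moves when its coordinate at
  \<open>c\<close> moves: two entries off the diagonal, one on it.\<close>

definition unit_sym :: "'p \<times> 'p \<Rightarrow> real ^ 'p ^ 'p" where
  "unit_sym c = (\<chi> i j. if (i, j) = c \<or> (j, i) = c then 1 else 0)"

definition supported_on :: "('p \<times> 'p) set \<Rightarrow> real ^ 'p ^ 'p \<Rightarrow> bool" where
  "supported_on K A \<longleftrightarrow> (\<forall>i j. (i, j) \<notin> K \<and> (j, i) \<notin> K \<longrightarrow> A $ i $ j = 0)"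

lemma coordinates_Inl [simp]: "coordinates K m A (Inl i) = m $ i"
  by (simp add: coordinates_def Plus_def)

lemma coordinates_Inr [simp]: "c \<in> K \<Longrightarrow> coordinates K m A (Inr c) = A $ fst c $ snd c"
  by (auto simp: coordinates_def Plus_def split: prod.splits)

lemma Inl_mem_Plus [simp]: "Inl i \<in> UNIV <+> K" by (simp add: Plus_def)

lemma Inr_mem_Plus [simp]: "Inr c \<in> UNIV <+> K \<longleftrightarrow> c \<in> K" by (auto simp: Plus_def)

lemma ball_Plus: "(\<forall>j\<in>UNIV <+> K. P j) \<longleftrightarrow> (\<forall>i. P (Inl i)) \<and> (\<forall>c\<in>K. P (Inr c))"
  by (auto simp: Plus_def)

lemma coordinates_eq_iff:
  "coordinates K m A = coordinates K m' A' \<longleftrightarrow> m = m' \<and> (\<forall>(i, j)\<in>K. A $ i $ j = A' $ i $ j)"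
proof
  assume eq: "coordinates K m A = coordinates K m' A'"
  have "m $ i = m' $ i" for i using fun_cong[OF eq, of "Inl i"] by simp
  moreover have "A $ i $ j = A' $ i $ j" if "(i, j) \<in> K" for i j
    using fun_cong[OF eq, of "Inr (i, j)"] that by simp
  ultimately show "m = m' \<and> (\<forall>(i, j)\<in>K. A $ i $ j = A' $ i $ j)" by (auto simp: vec_eq_iff)
next
  assume "m = m' \<and> (\<forall>(i, j)\<in>K. A $ i $ j = A' $ i $ j)"
  then show "coordinates K m A = coordinates K m' A'"
    unfolding coordinates_def by (intro restrict_ext) (auto split: sum.splits)
qed

lemma location_of_coordinates [simp]: "location_of (coordinates K m A) = m"
  by (simp add: location_of_def vec_eq_iff)

lemma symmetric_of_coordinates:
  assumes "transpose A = A" "supported_on K A"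
  shows "symmetric_of K (coordinates K m A) = A"
  using assms sym_nth[OF assms(1)] by (auto simp: symmetric_of_def supported_on_def vec_eq_iff)

lemma transpose_unit_sym [simp]: "transpose (unit_sym c) = unit_sym c"
  by (auto simp: unit_sym_def transpose_def vec_eq_iff)

lemma location_of_upd_Inl: "location_of (\<theta>(Inl k := t)) = location_of \<theta> + (t - \<theta> (Inl k)) *\<^sub>R axis k 1"
  by (auto simp: location_of_def vec_eq_iff axis_def)

lemma location_of_upd_Inr [simp]: "location_of (\<theta>(Inr c := t)) = location_of \<theta>"
  by (simp add: location_of_def vec_eq_iff)

lemma symmetric_of_upd_Inl [simp]: "symmetric_of K (\<theta>(Inl k := t)) = symmetric_of K \<theta>"
  by (simp add: symmetric_of_def vec_eq_iff)

text \<open>Inside the lower triangle a position and its transpose never both occur off the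
  diagonal, so a coordinate line is a straight line of matrices.\<close>

lemma symmetric_of_upd_Inr:
  assumes "K \<subseteq> lower_triangle" "c \<in> K"
  shows "symmetric_of K (\<theta>(Inr c := t)) = symmetric_of K \<theta> + (t - \<theta> (Inr c)) *\<^sub>R unit_sym c"
proof -
  obtain k l where c: "c = (k, l)" by (cases c)
  have "l \<le> k" using assms by (auto simp: c lower_triangle_def)
  moreover have "(i, j) \<in> K \<Longrightarrow> j \<le> i" for i j using assms(1) by (auto simp: lower_triangle_def)
  ultimately have anti: "(l, k) \<in> K \<Longrightarrow> k = l" by force
  have "symmetric_of K (\<theta>(Inr c := t)) $ i $ j
      = (symmetric_of K \<theta> + (t - \<theta> (Inr c)) *\<^sub>R unit_sym c) $ i $ j" for i j
    using assms(2) anti by (auto simp: symmetric_of_def unit_sym_def c)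
  then show ?thesis by (simp add: vec_eq_iff)
qed

lemma sum_unit_sym:
  fixes A :: "real ^ 'p::{finite,linorder} ^ 'p::{finite,linorder}"
  assumes K: "K \<subseteq> lower_triangle" and A: "transpose A = A" "supported_on K A"
  shows "(\<Sum>c\<in>K. A $ fst c $ snd c *\<^sub>R unit_sym c) = A"
proof -
  have "(\<Sum>c\<in>K. A $ fst c $ snd c * unit_sym c $ i $ j) = A $ i $ j" for i j
  proof -
    define d where "d = (if j \<le> i then (i, j) else (j, i))"
    have d: "A $ fst d $ snd d = A $ i $ j" using sym_nth[OF A(1)] by (auto simp: d_def)
    have "unit_sym c $ i $ j = (if c = d then 1 else 0)" if "c \<in> K" for c
      using that K by (fastforce simp: unit_sym_def d_def lower_triangle_def)
    then have "(\<Sum>c\<in>K. A $ fst c $ snd c * unit_sym c $ i $ j)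
        = (\<Sum>c\<in>K. if c = d then A $ fst c $ snd c else 0)"
      by (intro sum.cong) auto
    also have "\<dots> = (if d \<in> K then A $ i $ j else 0)" by (simp add: d)
    also have "\<dots> = A $ i $ j"
    proof (cases "d \<in> K")
      case False
      then have "(i, j) \<notin> K \<and> (j, i) \<notin> K"
        using K by (cases "i = j") (auto simp: d_def lower_triangle_def split: if_splits)
      then show ?thesis using A(2) by (simp add: supported_on_def)
    qed simp
    finally show ?thesis .
  qed
  then show ?thesis by (simp add: vec_eq_iff)
qed

text \<open>Turns a row of the derivative matrix, summed against scatter coordinates, into a linear
  functional evaluated at the matrix itself.\<close>

lemma sum_coordinates:
  fixes f :: "real ^ 'p::{finite,linorder} ^ 'p::{finite,linorder} \<Rightarrow> real"
  assumes f: "linear f" and K: "K \<subseteq> lower_triangle" and A: "transpose A = A" "supported_on K A"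
  shows "(\<Sum>c\<in>K. f (unit_sym c) * A $ fst c $ snd c) = f A"
proof -
  have "f A = f (\<Sum>c\<in>K. A $ fst c $ snd c *\<^sub>R unit_sym c)"
    by (simp add: sum_unit_sym[OF K A])
  then show ?thesis by (simp add: linear_sum[OF f] linear_scale[OF f] mult.commute)
qed

lemma supported_on_lower [simp]: "supported_on lower_triangle A"
  by (auto simp: supported_on_def lower_triangle_def)

lemma graph_positions_lower: "graph_positions E \<subseteq> lower_triangle"
  by (auto simp: graph_positions_def lower_triangle_def)

lemma supported_on_graph_positions: "supported_on (graph_positions E) A \<longleftrightarrow> graph_part E A = A"
  by (auto simp: supported_on_def graph_positions_def vec_eq_iff graph_part_nth insert_commute
      linorder_neq_iff)

lemma sum_sum_Plus:
  fixes f :: "'a::finite + 'b::finite \<Rightarrow> real"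
  shows "(\<Sum>k\<in>UNIV <+> K. f k) = (\<Sum>i\<in>UNIV. f (Inl i)) + (\<Sum>c\<in>K. f (Inr c))"
  by (simp add: sum.Plus)

lemma unconstrained_psi_Inl:
  "unconstrained_psi u\<^sub>1 u\<^sub>2 x \<theta> (Inl i)
    = u\<^sub>1 (mahalanobis (location_of \<theta>) (symmetric_of lower_triangle \<theta>) x) * (x - location_of \<theta>) $ i"
  by (simp add: unconstrained_psi_def Let_def)

lemma unconstrained_psi_Inr:
  assumes "c \<in> lower_triangle"
  shows "unconstrained_psi u\<^sub>1 u\<^sub>2 x \<theta> (Inr c)
    = u\<^sub>2 (mahalanobis (location_of \<theta>) (symmetric_of lower_triangle \<theta>) x)
        * ((x - location_of \<theta>) $ fst c * (x - location_of \<theta>) $ snd c)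
      - symmetric_of lower_triangle \<theta> $ fst c $ snd c"
  using assms by (simp add: unconstrained_psi_def Let_def outer_def)

lemma graphical_psi_Inl:
  "graphical_psi E u\<^sub>1 u\<^sub>2 x \<theta> (Inl i)
    = u\<^sub>1 ((x - location_of \<theta>) \<bullet> (symmetric_of (graph_positions E) \<theta> *v (x - location_of \<theta>)))
        * (x - location_of \<theta>) $ i"
  by (simp add: graphical_psi_def Let_def)

lemma graphical_psi_Inr:
  assumes "c \<in> graph_positions E"
  shows "graphical_psi E u\<^sub>1 u\<^sub>2 x \<theta> (Inr c)
    = matrix_inv (symmetric_of (graph_positions E) \<theta>) $ fst c $ snd c
      - u\<^sub>2 ((x - location_of \<theta>) \<bullet> (symmetric_of (graph_positions E) \<theta> *v (x - location_of \<theta>)))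
        * ((x - location_of \<theta>) $ fst c * (x - location_of \<theta>) $ snd c)"
  using assms by (simp add: graphical_psi_def Let_def outer_def)

section \<open>The population parameters\<close>

lemma AE_lborel_coordinate_neq: "AE x in lborel. (x :: real ^ 'n) $ i \<noteq> c"
proof -
  have "negligible {x :: real ^ 'n. x $ i = c}"
    using negligible_standard_hyperplane[of "axis i 1 :: real ^ 'n" c]
    by (simp add: inner_axis axis_in_Basis_iff)
  then have "AE x in lebesgue. x \<notin> {x :: real ^ 'n. x $ i = c}"
    by (intro AE_not_in) (simp add: negligible_iff_null_sets)
  then show ?thesis by (simp add: AE_completion_iff)
qed

lemma elliptical_law_elliptical:
  fixes S :: "real ^ 'n ^ 'n"
  assumes S: "S \<in> spd" and prob: "prob_space (elliptical \<mu> S g)"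
    and meas: "(\<lambda>x. ennreal (elliptical_density \<mu> S g x)) \<in> borel_measurable borel"
  shows "elliptical_law (elliptical \<mu> S g) \<mu> S"
proof -
  let ?\<phi> = "\<lambda>x. ennreal (elliptical_density \<mu> S g x)"
  interpret prob_space "elliptical \<mu> S g" by (rule prob)
  show ?thesis
  proof
    show "sets (elliptical \<mu> S g) = sets borel" by (simp add: elliptical_def)
    show "S \<in> spd" by (rule S)
    fix d
    have "distr (density lborel ?\<phi>) borel (\<lambda>x. \<mu> + reflection S d *v (x - \<mu>)) = density lborel ?\<phi>"
      by (intro distr_density_form_preserving[where K = "matrix_inv S"] spd_inv_spd S meas
          reflection_preserves[OF S] matrix_vector_mul_linear)
        (simp add: elliptical_density_def mahalanobis_def reflection_preserves[OF S])
    then show "distr (elliptical \<mu> S g) borel (\<lambda>x. \<mu> + reflection S d *v (x - \<mu>)) = elliptical \<mu> S g"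
      by (simp add: elliptical_def)
  next
    have neg: "(- v) \<bullet> (A *v (- v)) = v \<bullet> (A *v v)" for A :: "real ^ 'n ^ 'n" and v
      using matrix_vector_mult_scaleR[of A "-1" v] by simp
    have "distr (density lborel ?\<phi>) borel (\<lambda>x. \<mu> + - (x - \<mu>)) = density lborel ?\<phi>"
    proof (rule distr_density_form_preserving[where K = "matrix_inv S" and f = uminus])
      show "linear (uminus :: real ^ 'n \<Rightarrow> _)" by (simp add: linear_uminus)
      have "\<mu> + - (x - \<mu>) - \<mu> = - (x - \<mu>)" for x by simp
      then show "?\<phi> (\<mu> + - (x - \<mu>)) = ?\<phi> x" for x
        unfolding elliptical_density_def mahalanobis_def by (simp only: neg)
    qed (simp_all only: spd_inv_spd S meas neg)
    then show "distr (elliptical \<mu> S g) borel (\<lambda>x. \<mu> - (x - \<mu>)) = elliptical \<mu> S g"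
      by (simp add: elliptical_def)
  next
    fix i
    show "AE x in elliptical \<mu> S g. x $ i \<noteq> \<mu> $ i"
      unfolding elliptical_def using AE_lborel_coordinate_neq[of i "\<mu> $ i"] meas
      by (subst AE_density) auto
  qed
qed

context elliptical_law
begin

lemma elliptical_law_scaleR:
  assumes "0 < \<eta>"
  shows "elliptical_law F \<mu> (\<eta> *\<^sub>R S)"
proof
  show "\<eta> *\<^sub>R S \<in> spd" by (rule scaleR_spd[OF S assms])
  show "distr F borel (\<lambda>x. \<mu> + reflection (\<eta> *\<^sub>R S) d *v (x - \<mu>)) = F" for d
    using assms by (subst reflection_scaleR) (simp_all only: refl_invariant less_imp_neq[symmetric] simp_thms)
qed (fact sets_F center_invariant hyperplane_null)+

lemma integral_center:
  fixes h :: "real ^ 'p \<Rightarrow> real"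
  assumes "h \<in> borel_measurable borel"
  shows "(\<integral>x. h (\<mu> - (x - \<mu>)) \<partial>F) = (\<integral>x. h x \<partial>F)"
proof -
  have "(\<lambda>x. \<mu> - (x - \<mu>)) \<in> borel_measurable F" by measurable
  from integral_distr[OF this assms] show ?thesis unfolding center_invariant by (rule sym)
qed

end

section \<open>Equivariance of the population equations\<close>

lemma matrix_inv_congruence:
  fixes Q \<Sigma> :: "real ^ 'n ^ 'n"
  assumes "\<Sigma> \<in> spd" "Q ** Q = mat 1"
  shows "matrix_inv (Q ** \<Sigma> ** transpose Q) = transpose Q ** matrix_inv \<Sigma> ** Q"
proof (rule matrix_inv_eqI)
  have QT: "transpose Q ** transpose Q = mat 1"
    by (metis assms(2) matrix_transpose_mul transpose_mat)
  have "Q ** \<Sigma> ** transpose Q ** (transpose Q ** matrix_inv \<Sigma> ** Q)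
      = Q ** \<Sigma> ** (transpose Q ** transpose Q) ** matrix_inv \<Sigma> ** Q"
    by (simp add: matrix_mul_assoc)
  also have "\<dots> = Q ** (\<Sigma> ** matrix_inv \<Sigma>) ** Q"
    by (simp add: QT matrix_mul_assoc)
  also have "\<dots> = mat 1" by (simp add: spd_inv_right[OF assms(1)] assms(2))
  finally show "Q ** \<Sigma> ** transpose Q ** (transpose Q ** matrix_inv \<Sigma> ** Q) = mat 1" .
qed

lemma inner_mult_transpose: "(Q *v x) \<bullet> y = x \<bullet> (transpose Q *v y)"
  for Q :: "real ^ 'n ^ 'm"
  by (metis dot_lmul_matrix inner_commute transpose_transpose vector_transpose_matrix)

lemma congruence_spd:
  fixes Q \<Sigma> :: "real ^ 'n ^ 'n"
  assumes "\<Sigma> \<in> spd" "Q ** Q = mat 1"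
  shows "Q ** \<Sigma> ** transpose Q \<in> spd"
proof -
  have QT: "transpose Q ** transpose Q = mat 1"
    by (metis assms(2) matrix_transpose_mul transpose_mat)
  have "0 < x \<bullet> ((Q ** \<Sigma> ** transpose Q) *v x)" if "x \<noteq> 0" for x
  proof -
    have "transpose Q *v x \<noteq> 0"
      using that QT by (metis matrix_vector_mul_assoc matrix_vector_mul_lid matrix_vector_mult_0_right)
    from spd_pos[OF assms(1) this] show ?thesis
      by (metis inner_commute inner_mult_transpose matrix_vector_mul_assoc)
  qed
  moreover have "transpose (Q ** \<Sigma> ** transpose Q) = Q ** \<Sigma> ** transpose Q"
    using spd_sym[OF assms(1)] by (simp add: matrix_transpose_mul matrix_mul_assoc)
  ultimately show ?thesis by (simp add: spd_def)
qed

lemma congruence_nth: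
  "(Q ** \<Sigma> ** transpose Q) $ i $ j = (\<Sum>a\<in>UNIV. \<Sum>b\<in>UNIV. Q $ i $ a * Q $ j $ b * \<Sigma> $ a $ b)"
  for Q \<Sigma> :: "real ^ 'n ^ 'n"
proof -
  have "(Q ** \<Sigma> ** transpose Q) $ i $ j = (\<Sum>b\<in>UNIV. \<Sum>a\<in>UNIV. Q $ i $ a * Q $ j $ b * \<Sigma> $ a $ b)"
    by (simp add: matrix_matrix_mult_def transpose_def sum_distrib_left sum_distrib_right mult_ac)
  then show ?thesis by (subst sum.swap)
qed

text \<open>Change of variables. Since \<open>Q\<close> is its own inverse, residuals at the
  transformed parameter are \<open>Q\<close> applied to residuals at the transformed point, and the
  distances agree. The estimating functions therefore transform linearly, by \<open>Q\<close> for
  location and by congruence for scatter.\<close>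

lemma population_solution_transform:
  fixes F :: "(real ^ 'p::{finite,linorder}) measure" and Q :: "real ^ 'p::{finite,linorder} ^ 'p::{finite,linorder}"
  assumes F: "sets F = sets borel" and inv: "distr F borel (\<lambda>x. \<mu> + Q *v (x - \<mu>)) = F"
    and Q: "Q ** Q = mat 1" and \<Sigma>: "\<Sigma> \<in> spd"
    and sol: "population_solution F (UNIV <+> lower_triangle) unconstrained_params
      (unconstrained_psi u\<^sub>1 u\<^sub>2) (coordinates lower_triangle m \<Sigma>)"
  shows "population_solution F (UNIV <+> lower_triangle) unconstrained_params
      (unconstrained_psi u\<^sub>1 u\<^sub>2)
      (coordinates lower_triangle (\<mu> + Q *v (m - \<mu>)) (Q ** \<Sigma> ** transpose Q))"
proof -
  let ?g = "\<lambda>x. \<mu> + Q *v (x - \<mu>)" and ?\<Sigma>' = "Q ** \<Sigma> ** transpose Q"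
  let ?m' = "?g m"
  let ?\<theta> = "coordinates lower_triangle m \<Sigma>" and ?\<theta>' = "coordinates lower_triangle ?m' ?\<Sigma>'"
  let ?z = "\<lambda>x. ?g x - m" and ?r = "\<lambda>x. mahalanobis m \<Sigma> (?g x)"
  have QQ: "Q *v (Q *v v) = v" for v by (simp add: matrix_vector_mul_assoc Q)
  have \<Sigma>': "?\<Sigma>' \<in> spd" by (rule congruence_spd[OF \<Sigma> Q])
  have sym: "symmetric_of lower_triangle ?\<theta> = \<Sigma>" "symmetric_of lower_triangle ?\<theta>' = ?\<Sigma>'"
    using spd_sym[OF \<Sigma>] spd_sym[OF \<Sigma>'] by (simp_all add: symmetric_of_coordinates)
  have z: "x - ?m' = Q *v ?z x" for x
    by (simp add: matrix_vector_mult_diff_distrib matrix_vector_right_distrib QQ)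
  have r: "mahalanobis ?m' ?\<Sigma>' x = ?r x" for x
  proof -
    have "mahalanobis ?m' ?\<Sigma>' x = (Q *v ?z x) \<bullet> (transpose Q *v (matrix_inv \<Sigma> *v (Q *v (Q *v ?z x))))"
      unfolding mahalanobis_def z matrix_inv_congruence[OF \<Sigma> Q] matrix_vector_mul_assoc[symmetric] ..
    also have "\<dots> = (Q *v (Q *v ?z x)) \<bullet> (matrix_inv \<Sigma> *v ?z x)"
      by (simp only: inner_mult_transpose[symmetric] QQ)
    finally show ?thesis unfolding QQ mahalanobis_def .
  qed
  have meas_g: "?g \<in> borel_measurable F"
    unfolding measurable_cong_sets[OF F refl]
    by (intro borel_measurable_continuous_onI continuous_intros
      bounded_linear.continuous_on[OF matrix_vector_mul_bounded_linear])
  define f1 where "f1 i x = u\<^sub>1 (mahalanobis m \<Sigma> x) * (x - m) $ i" for i x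
  define f2 where "f2 i j x = u\<^sub>2 (mahalanobis m \<Sigma> x) * ((x - m) $ i * (x - m) $ j) - \<Sigma> $ i $ j" for i j x
  have f1: "integrable F (f1 i)" "(\<integral>x. f1 i x \<partial>F) = 0" for i
    using sol by (simp_all add: population_solution_def ball_Plus unconstrained_psi_Inl sym f1_def[abs_def])
  have f2_lower: "integrable F (f2 i j) \<and> (\<integral>x. f2 i j x \<partial>F) = 0" if "(i, j) \<in> lower_triangle" for i j
    using sol that by (auto simp: population_solution_def ball_Plus unconstrained_psi_Inr sym f2_def[abs_def])
  \<comment> \<open>The congruence mixes all entries, so the equations are also needed above the
    diagonal, where symmetry supplies them.\<close>
  have f2: "integrable F (f2 i j)" "(\<integral>x. f2 i j x \<partial>F) = 0" for i j
  proof -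
    have "f2 i j = f2 j i"
      using sym_nth[OF spd_sym[OF \<Sigma>], of i j] by (simp add: f2_def[abs_def] mult.commute)
    then show "integrable F (f2 i j)" "(\<integral>x. f2 i j x \<partial>F) = 0"
      using f2_lower[of i j] f2_lower[of j i] by (cases "j \<le> i"; auto simp: lower_triangle_def)+
  qed
  have trans: "integrable F (\<lambda>x. f (?g x)) \<and> (\<integral>x. f (?g x) \<partial>F) = (\<integral>x. f x \<partial>F)"
    if "integrable F f" for f :: "_ \<Rightarrow> real"
  proof -
    have "f \<in> borel_measurable borel"
      using borel_measurable_integrable[OF that] unfolding measurable_cong_sets[OF F refl] .
    then show ?thesis
      using integral_distr[OF meas_g, of f] integrable_distr[OF meas_g, of f] that by (simp add: inv)
  qed
  have psi1: "unconstrained_psi u\<^sub>1 u\<^sub>2 x ?\<theta>' (Inl i) = (\<Sum>a\<in>UNIV. Q $ i $ a * f1 a (?g x))" for i x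
    unfolding unconstrained_psi_Inl sym location_of_coordinates r z
    by (simp add: f1_def matrix_vector_mult_def sum_distrib_left mult_ac)
  have quadratic_sum: "u * ((Q *v z) $ i * (Q *v z) $ j) - (\<Sum>a\<in>UNIV. \<Sum>b\<in>UNIV. Q $ i $ a * Q $ j $ b * \<Sigma> $ a $ b)
      = (\<Sum>a\<in>UNIV. \<Sum>b\<in>UNIV. Q $ i $ a * Q $ j $ b * (u * (z $ a * z $ b) - \<Sigma> $ a $ b))" for u z i j
  proof -
    have "u * ((Q *v z) $ i * (Q *v z) $ j)
        = (\<Sum>a\<in>UNIV. \<Sum>b\<in>UNIV. Q $ i $ a * Q $ j $ b * (u * (z $ a * z $ b)))"
    proof -
      have "(Q *v z) $ i * (Q *v z) $ j = (\<Sum>a\<in>UNIV. \<Sum>b\<in>UNIV. (Q $ i $ a * z $ a) * (Q $ j $ b * z $ b))"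
        by (simp only: matrix_vector_mult_def vec_lambda_beta sum_product)
      then show ?thesis by (simp only: sum_distrib_left) (intro sum.cong refl, simp add: mult_ac)
    qed
    then show ?thesis by (simp add: right_diff_distrib sum_subtractf)
  qed
  have psi2: "unconstrained_psi u\<^sub>1 u\<^sub>2 x ?\<theta>' (Inr c)
      = (\<Sum>a\<in>UNIV. \<Sum>b\<in>UNIV. Q $ fst c $ a * Q $ snd c $ b * f2 a b (?g x))"
    if "c \<in> lower_triangle" for c x
    unfolding unconstrained_psi_Inr[OF that] sym location_of_coordinates r z congruence_nth
    unfolding f2_def by (rule quadratic_sum)
  show ?thesis
    unfolding population_solution_def
  proof (intro conjI ballI)
    show "?\<theta>' \<in> unconstrained_params" using \<Sigma>' by (auto simp: unconstrained_params_def)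
    fix j :: "'p + 'p \<times> 'p" assume j: "j \<in> UNIV <+> lower_triangle"
    have "integrable F (\<lambda>x. unconstrained_psi u\<^sub>1 u\<^sub>2 x ?\<theta>' j) \<and> (\<integral>x. unconstrained_psi u\<^sub>1 u\<^sub>2 x ?\<theta>' j \<partial>F) = 0"
    proof (cases j)
      case (Inl i)
      have "integrable F (\<lambda>x. f1 a (?g x))" "(\<integral>x. f1 a (?g x) \<partial>F) = 0" for a
        using trans[OF f1(1)] f1(2) by auto
      then show ?thesis unfolding Inl psi1 by simp
    next
      case (Inr c)
      then have c: "c \<in> lower_triangle" using j by simp
      have "integrable F (\<lambda>x. f2 a b (?g x))" "(\<integral>x. f2 a b (?g x) \<partial>F) = 0" for a b
        using trans[OF f2(1)] f2(2) by auto
      then show ?thesis unfolding Inr psi2[OF c] by simp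
    qed
    then show "integrable F (\<lambda>x. unconstrained_psi u\<^sub>1 u\<^sub>2 x ?\<theta>' j)"
      "(\<integral>x. unconstrained_psi u\<^sub>1 u\<^sub>2 x ?\<theta>' j \<partial>F) = 0" by auto
  qed
qed

text \<open>By uniqueness the population solution is invariant under the symmetries of the distribution.\<close>

lemma unconstrained_theta_F:
  fixes F :: "(real ^ 'p::{finite,linorder}) measure"
  assumes "elliptical_law F \<mu> S"
    and ex1: "\<exists>!\<theta>. population_solution F (UNIV <+> lower_triangle) unconstrained_params
      (unconstrained_psi u\<^sub>1 u\<^sub>2) \<theta>"
  obtains \<eta> where "0 < \<eta>"
    "theta_F F (UNIV <+> lower_triangle) unconstrained_params (unconstrained_psi u\<^sub>1 u\<^sub>2)
      = coordinates lower_triangle \<mu> (\<eta> *\<^sub>R S)"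
proof -
  interpret elliptical_law F \<mu> S by (rule assms(1))
  let ?sol = "population_solution F (UNIV <+> lower_triangle) unconstrained_params (unconstrained_psi u\<^sub>1 u\<^sub>2)"
  let ?\<theta> = "theta_F F (UNIV <+> lower_triangle) unconstrained_params (unconstrained_psi u\<^sub>1 u\<^sub>2)"
  have sol: "?sol ?\<theta>" unfolding theta_F_def by (rule theI'[OF ex1])
  then obtain m \<Sigma> where \<theta>: "?\<theta> = coordinates lower_triangle m \<Sigma>" and \<Sigma>: "\<Sigma> \<in> spd"
    by (auto simp: population_solution_def unconstrained_params_def)
  have invariant: "\<mu> + Q *v (m - \<mu>) = m \<and> Q ** \<Sigma> ** transpose Q = \<Sigma>"
    if Q: "distr F borel (\<lambda>x. \<mu> + Q *v (x - \<mu>)) = F" "Q ** Q = mat 1" for Q :: "real ^ 'p::{finite,linorder} ^ 'p::{finite,linorder}"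
  proof -
    have "?sol (coordinates lower_triangle (\<mu> + Q *v (m - \<mu>)) (Q ** \<Sigma> ** transpose Q))"
      by (rule population_solution_transform[OF sets_F Q \<Sigma>]) (use sol \<theta> in simp)
    then have eq: "coordinates lower_triangle (\<mu> + Q *v (m - \<mu>)) (Q ** \<Sigma> ** transpose Q)
        = coordinates lower_triangle m \<Sigma>"
      using ex1 sol \<theta> by metis
    have "transpose (Q ** \<Sigma> ** transpose Q) = Q ** \<Sigma> ** transpose Q"
      by (rule spd_sym[OF congruence_spd[OF \<Sigma> Q(2)]])
    then have "Q ** \<Sigma> ** transpose Q = \<Sigma>"
      using eq symmetric_of_coordinates[OF spd_sym[OF \<Sigma>] supported_on_lower]
        symmetric_of_coordinates[of "Q ** \<Sigma> ** transpose Q" lower_triangle] by (metis supported_on_lower)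
    then show ?thesis using eq by (simp add: coordinates_eq_iff)
  qed
  have neg: "(- mat 1 :: real ^ 'p::{finite,linorder} ^ 'p::{finite,linorder}) *v v = - v" for v
    using scaleR_matrix_vector_assoc[of "-1" "mat 1 :: real ^ 'p::{finite,linorder} ^ 'p::{finite,linorder}" v] by simp
  \<comment> \<open>The central symmetry is the case \<open>Q = - mat 1\<close>; invariance of the
    location then reads \<open>2 *\<^sub>R m = 2 *\<^sub>R \<mu>\<close>.\<close>
  have "(- mat 1 :: real ^ 'p::{finite,linorder} ^ 'p::{finite,linorder}) ** (- mat 1) = mat 1"
    by (simp add: matrix_eq neg flip: matrix_vector_mul_assoc)
  moreover have "distr F borel (\<lambda>x. \<mu> + (- mat 1) *v (x - \<mu>)) = F"
    using center_invariant unfolding neg by simp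
  ultimately have "\<mu> + (- mat 1) *v (m - \<mu>) = m" using invariant by blast
  then have "2 *\<^sub>R m = 2 *\<^sub>R \<mu>" unfolding neg scaleR_2 by (simp add: algebra_simps)
  then have m: "m = \<mu>" by simp
  have quad: "a \<bullet> (\<Sigma> *v a) = b \<bullet> (\<Sigma> *v b)" if ab: "a \<bullet> (S *v a) = b \<bullet> (S *v b)" for a b
  proof -
    let ?Q = "reflection S (a - b)"
    have "?Q ** ?Q = mat 1"
      by (simp add: matrix_eq reflection_involution[OF S] flip: matrix_vector_mul_assoc)
    then have \<Sigma>Q: "?Q ** \<Sigma> ** transpose ?Q = \<Sigma>" using invariant refl_invariant by blast
    have "b \<bullet> v = (transpose ?Q *v a) \<bullet> v" for v
      using reflection_moves[OF S ab, of v] by (metis inner_commute inner_mult_transpose)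
    then have Qa: "transpose ?Q *v a = b" by (metis vector_eq_rdot)
    have "a \<bullet> (\<Sigma> *v a) = a \<bullet> (?Q *v (\<Sigma> *v (transpose ?Q *v a)))"
      by (simp only: \<Sigma>Q matrix_vector_mul_assoc matrix_mul_assoc)
    also have "\<dots> = b \<bullet> (\<Sigma> *v b)"
      unfolding Qa by (metis Qa inner_commute inner_mult_transpose)
    finally show ?thesis .
  qed
  define e :: "real ^ 'p::{finite,linorder}" where "e = axis undefined 1"
  have e: "0 < e \<bullet> (S *v e)" "0 < e \<bullet> (\<Sigma> *v e)"
    by (auto intro!: spd_pos S \<Sigma> simp: e_def axis_eq_0_iff)
  \<comment> \<open>By \<open>quad\<close> the form of \<open>\<Sigma>\<close> is a function of the
    form of \<open>S\<close>. Both are homogeneous of degree two, so their ratio is constant, and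
    \<open>\<eta>\<close> is its value at \<open>e\<close>.\<close>
  define \<eta> where "\<eta> = (e \<bullet> (\<Sigma> *v e)) / (e \<bullet> (S *v e))"
  have \<eta>: "0 < \<eta>" using e by (simp add: \<eta>_def)
  have zero: "a \<bullet> ((\<Sigma> - \<eta> *\<^sub>R S) *v a) = 0" for a
  proof -
    define t where "t = sqrt (a \<bullet> (S *v a) / (e \<bullet> (S *v e)))"
    have t2: "t\<^sup>2 = a \<bullet> (S *v a) / (e \<bullet> (S *v e))"
      using spd_nonneg[OF S, of a] e by (simp add: t_def)
    have scale: "(t *\<^sub>R e) \<bullet> (A *v (t *\<^sub>R e)) = t\<^sup>2 * (e \<bullet> (A *v e))" for A :: "real ^ 'p::{finite,linorder} ^ 'p::{finite,linorder}"
      by (simp add: matrix_vector_mult_scaleR power2_eq_square)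
    have "(t *\<^sub>R e) \<bullet> (S *v (t *\<^sub>R e)) = a \<bullet> (S *v a)"
      unfolding scale using e by (simp add: t2)
    then have "a \<bullet> (\<Sigma> *v a) = t\<^sup>2 * (e \<bullet> (\<Sigma> *v e))"
      using quad[of a "t *\<^sub>R e"] scale[of \<Sigma>] by simp
    then show ?thesis
      using e by (simp add: t2 \<eta>_def matrix_vector_mult_diff_rdistrib inner_diff_right
          scaleR_matrix_vector_assoc[symmetric])
  qed
  \<comment> \<open>A form that vanishes identically is nonnegative, so \<open>psd_kernel\<close>
    applies at every vector and gives the zero matrix.\<close>
  have "\<Sigma> - \<eta> *\<^sub>R S \<in> psd"
    using zero spd_sym[OF \<Sigma>] spd_sym[OF S]
    by (auto simp: psd_def) (simp add: transpose_def vec_eq_iff)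
  then have "(\<Sigma> - \<eta> *\<^sub>R S) *v a = 0" for a using zero psd_kernel by blast
  then have "\<Sigma> - \<eta> *\<^sub>R S = 0" unfolding matrix_eq by simp
  then show thesis using that[OF \<eta>] \<theta> m by simp
qed

text \<open>At corresponding parameters both systems see the same residual and distance. The sign
  comes from the graphical system subtracting the weighted outer product from the matrix instead of
  the reverse.\<close>

lemma psi_inverse_parameter:
  fixes \<Sigma> :: "real ^ 'p::{finite,linorder} ^ 'p::{finite,linorder}" and \<mu>
  assumes \<Sigma>: "\<Sigma> \<in> spd" and K: "matrix_inv \<Sigma> \<in> spd_graph E"
  defines "\<theta> \<equiv> coordinates lower_triangle \<mu> \<Sigma>"
    and "\<theta>' \<equiv> coordinates (graph_positions E) \<mu> (matrix_inv \<Sigma>)"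
  shows "graphical_psi E u\<^sub>1 u\<^sub>2 x \<theta>' (Inl i) = unconstrained_psi u\<^sub>1 u\<^sub>2 x \<theta> (Inl i)"
    and "c \<in> graph_positions E \<Longrightarrow>
      graphical_psi E u\<^sub>1 u\<^sub>2 x \<theta>' (Inr c) = - unconstrained_psi u\<^sub>1 u\<^sub>2 x \<theta> (Inr c)"
proof -
  have 1: "symmetric_of lower_triangle \<theta> = \<Sigma>"
    using spd_sym[OF \<Sigma>] by (simp add: \<theta>_def symmetric_of_coordinates)
  have 2: "symmetric_of (graph_positions E) \<theta>' = matrix_inv \<Sigma>"
    using K by (simp add: \<theta>'_def symmetric_of_coordinates supported_on_graph_positions
        spd_graph_eq sym_graph_def)
  have loc: "location_of \<theta> = \<mu>" "location_of \<theta>' = \<mu>" by (simp_all add: \<theta>_def \<theta>'_def)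
  show "graphical_psi E u\<^sub>1 u\<^sub>2 x \<theta>' (Inl i) = unconstrained_psi u\<^sub>1 u\<^sub>2 x \<theta> (Inl i)"
    by (simp add: graphical_psi_Inl unconstrained_psi_Inl 1 2 loc mahalanobis_def)
  show "graphical_psi E u\<^sub>1 u\<^sub>2 x \<theta>' (Inr c) = - unconstrained_psi u\<^sub>1 u\<^sub>2 x \<theta> (Inr c)"
    if "c \<in> graph_positions E"
    using that subsetD[OF graph_positions_lower that]
    by (simp add: graphical_psi_Inr unconstrained_psi_Inr 1 2 loc mahalanobis_def
        matrix_inv_matrix_inv_spd[OF \<Sigma>])
qed

lemma graphical_theta_F:
  fixes F :: "(real ^ 'p::{finite,linorder}) measure"
  assumes \<Sigma>: "\<Sigma> \<in> spd" and K: "matrix_inv \<Sigma> \<in> spd_graph E"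
    and sol: "population_solution F (UNIV <+> lower_triangle) unconstrained_params
      (unconstrained_psi u\<^sub>1 u\<^sub>2) (coordinates lower_triangle \<mu> \<Sigma>)"
    and ex1: "\<exists>!\<theta>. population_solution F (UNIV <+> graph_positions E) (graphical_params E)
      (graphical_psi E u\<^sub>1 u\<^sub>2) \<theta>"
  shows "theta_F F (UNIV <+> graph_positions E) (graphical_params E) (graphical_psi E u\<^sub>1 u\<^sub>2)
    = coordinates (graph_positions E) \<mu> (matrix_inv \<Sigma>)"
proof -
  note psi = psi_inverse_parameter[OF \<Sigma> K]
  have "population_solution F (UNIV <+> graph_positions E) (graphical_params E)
      (graphical_psi E u\<^sub>1 u\<^sub>2) (coordinates (graph_positions E) \<mu> (matrix_inv \<Sigma>))"
    using sol K graph_positions_lower[of E]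
    by (auto simp: population_solution_def ball_Plus psi graphical_params_def subset_iff)
  then show ?thesis unfolding theta_F_def by (rule the1_equality[OF ex1])
qed


section \<open>The matrices of expected derivatives\<close>

text \<open>The identity \<open>matrix_inv_diff\<close> gives the difference quotient exactly, so
  continuity of inversion suffices to pass to the limit.\<close>

lemma matrix_inv_has_derivative:
  fixes A B :: "real ^ 'n ^ 'n" and f :: "real ^ 'n ^ 'n \<Rightarrow> real"
  assumes A: "invertible A" and f: "linear f"
  shows "((\<lambda>t. f (matrix_inv (A + (t - t0) *\<^sub>R B))) has_real_derivative
    - f (matrix_inv A ** B ** matrix_inv A)) (at t0)"
proof -
  let ?A = "\<lambda>t. A + (t - t0) *\<^sub>R B"
  have f': "bounded_linear f" using f by (simp add: linear_conv_bounded_linear)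
  have "(?A \<longlongrightarrow> A + (t0 - t0) *\<^sub>R B) (at t0)"
    by (intro tendsto_intros)
  then have lim: "(?A \<longlongrightarrow> A) (at t0)" by simp
  have "det A \<noteq> 0" using A invertible_det_nz by blast
  from tendsto_imp_eventually_ne[OF tendsto_det[OF lim] this]
  have inv: "\<forall>\<^sub>F t in at t0. invertible (?A t)"
    by (simp add: invertible_det_nz)
  have "((\<lambda>t. - f (matrix_inv (?A t) ** B ** matrix_inv A)) \<longlongrightarrow> - f (matrix_inv A ** B ** matrix_inv A)) (at t0)"
    by (intro tendsto_intros bounded_linear.tendsto[OF f'] tendsto_matrix_inv lim A)
  moreover have "\<forall>\<^sub>F t in at t0. - f (matrix_inv (?A t) ** B ** matrix_inv A)
      = (f (matrix_inv (?A t)) - f (matrix_inv (?A t0))) / (t - t0)"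
    using inv eventually_neq_at_within[of t0 t0 UNIV]
  proof eventually_elim
    case (elim t)
    have "matrix_inv (?A t) - matrix_inv A = - (matrix_inv (?A t) ** ((t - t0) *\<^sub>R B) ** matrix_inv A)"
      using matrix_inv_diff[OF elim(1) A] by simp
    also have "\<dots> = (t - t0) *\<^sub>R - (matrix_inv (?A t) ** B ** matrix_inv A)"
      by (simp add: scalar_matrix_assoc matrix_scalar_ac)
    finally have "f (matrix_inv (?A t) - matrix_inv A) = (t - t0) * - f (matrix_inv (?A t) ** B ** matrix_inv A)"
      by (simp only: linear_scale[OF f] linear_neg[OF f] real_scaleR_def)
    then show ?case using elim(2) by (simp add: linear_diff[OF f] field_simps)
  qed
  ultimately show ?thesis
    unfolding has_field_derivative_iff by (rule Lim_transform_eventually)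
qed

lemma linear_matrix_nth: "linear (\<lambda>A :: real ^ 'n ^ 'm. A $ i $ j)"
  by (rule linearI) simp_all

lemma linear_quadratic_form: "linear (\<lambda>A :: real ^ 'n ^ 'n. y \<bullet> (A *v y))"
  by (rule linearI)
    (simp_all add: matrix_vector_mult_add_rdistrib inner_add_right scaleR_matrix_vector_assoc[symmetric])

lemma deriv_uminus:
  fixes f :: "real \<Rightarrow> real"
  assumes "f differentiable (at a)"
  shows "deriv (\<lambda>t. - f t) a = - deriv f a"
proof -
  obtain D where D: "(f has_real_derivative D) (at a)" using assms real_differentiableE by blast
  then have "((\<lambda>t. - f t) has_real_derivative - D) (at a)" by (rule DERIV_minus)
  with D show ?thesis by (simp add: DERIV_imp_deriv)
qed

lemma deriv_reflected:
  fixes f :: "real \<Rightarrow> real"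
  assumes "f differentiable (at a)"
  shows "deriv (\<lambda>t. f (2 * a - t)) a = - deriv f a"
proof -
  obtain D where D: "(f has_real_derivative D) (at a)" using assms real_differentiableE by blast
  have "((\<lambda>t. f (2 * a - t)) has_real_derivative D * - 1) (at a)"
    by (rule DERIV_chain2[where g = "\<lambda>t. 2 * a - t"]) (use D in \<open>auto intro!: derivative_eq_intros\<close>)
  with D show ?thesis by (simp add: DERIV_imp_deriv)
qed

text \<open>Collects the derivative conditions of both systems at corresponding parameters. The
  inherited \<open>S\<close> is instantiated by the population scatter \<open>\<Sigma>\<close>, so
  the symmetry facts refer to \<open>\<Sigma>\<close>.\<close>

locale M_population = elliptical_law F \<mu> \<Sigma>
  for F :: "(real ^ 'p::{finite,linorder}) measure" and \<mu> :: "real ^ 'p::{finite,linorder}"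
    and \<Sigma> :: "real ^ 'p::{finite,linorder} ^ 'p::{finite,linorder}" +
  fixes E :: "'p::{finite,linorder} set set" and u\<^sub>1 u\<^sub>2 :: "real \<Rightarrow> real"
    and \<theta>\<^sub>U \<theta>\<^sub>G :: "'p::{finite,linorder} + 'p::{finite,linorder} \<times> 'p::{finite,linorder} \<Rightarrow> real"
  defines "\<theta>\<^sub>U \<equiv> coordinates lower_triangle \<mu> \<Sigma>"
    and "\<theta>\<^sub>G \<equiv> coordinates (graph_positions E) \<mu> (matrix_inv \<Sigma>)"
  assumes K: "matrix_inv \<Sigma> \<in> spd_graph E"
    and diff_U: "\<And>j k. j \<in> UNIV <+> lower_triangle \<Longrightarrow> k \<in> UNIV <+> lower_triangle \<Longrightarrow>
      AE x in F. (\<lambda>t. unconstrained_psi u\<^sub>1 u\<^sub>2 x (\<theta>\<^sub>U(k := t)) j) differentiable (at (\<theta>\<^sub>U k))"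
    and int_U: "\<And>j k. j \<in> UNIV <+> lower_triangle \<Longrightarrow> k \<in> UNIV <+> lower_triangle \<Longrightarrow>
      integrable F (\<lambda>x. partial_psi (unconstrained_psi u\<^sub>1 u\<^sub>2) x \<theta>\<^sub>U j k)"
    and diff_G: "\<And>j k. j \<in> UNIV <+> graph_positions E \<Longrightarrow> k \<in> UNIV <+> graph_positions E \<Longrightarrow>
      AE x in F. (\<lambda>t. graphical_psi E u\<^sub>1 u\<^sub>2 x (\<theta>\<^sub>G(k := t)) j) differentiable (at (\<theta>\<^sub>G k))"
    and int_G: "\<And>j k. j \<in> UNIV <+> graph_positions E \<Longrightarrow> k \<in> UNIV <+> graph_positions E \<Longrightarrow>
      integrable F (\<lambda>x. partial_psi (graphical_psi E u\<^sub>1 u\<^sub>2) x \<theta>\<^sub>G j k)"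
begin

abbreviation "L \<equiv> matrix_inv \<Sigma>"
abbreviation "\<psi>\<^sub>U \<equiv> unconstrained_psi u\<^sub>1 u\<^sub>2"
abbreviation "\<psi>\<^sub>G \<equiv> graphical_psi E u\<^sub>1 u\<^sub>2"
abbreviation "\<beta>\<^sub>U j k \<equiv> (\<integral>x. partial_psi \<psi>\<^sub>U x \<theta>\<^sub>U j k \<partial>F)"
abbreviation "\<beta>\<^sub>G j k \<equiv> (\<integral>x. partial_psi \<psi>\<^sub>G x \<theta>\<^sub>G j k \<partial>F)"

lemma L_spd: "L \<in> spd" and L_graph: "graph_part E L = L"
  using K by (auto simp: spd_graph_eq sym_graph_def)

lemma symmetric_of_U: "symmetric_of lower_triangle \<theta>\<^sub>U = \<Sigma>"
  using spd_sym[OF S] by (simp add: \<theta>\<^sub>U_def symmetric_of_coordinates)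

lemma symmetric_of_G: "symmetric_of (graph_positions E) \<theta>\<^sub>G = L"
  using spd_sym[OF L_spd] L_graph
  by (simp add: \<theta>\<^sub>G_def symmetric_of_coordinates supported_on_graph_positions)

lemma location_of_U: "location_of \<theta>\<^sub>U = \<mu>" and location_of_G: "location_of \<theta>\<^sub>G = \<mu>"
  by (simp_all add: \<theta>\<^sub>U_def \<theta>\<^sub>G_def)

text \<open>The scatter coordinates stay at their true values, where both systems measure distance
  by \<open>L\<close>; hence the two location blocks of derivatives coincide.\<close>

lemma psi_location_derivative: "\<psi>\<^sub>G x (\<theta>\<^sub>G(Inl k := t)) (Inl i) = \<psi>\<^sub>U x (\<theta>\<^sub>U(Inl k := t)) (Inl i)"
  by (simp add: graphical_psi_Inl unconstrained_psi_Inl location_of_upd_Inl mahalanobis_def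
      symmetric_of_U symmetric_of_G location_of_U location_of_G)
    (simp add: \<theta>\<^sub>U_def \<theta>\<^sub>G_def)

lemma beta_location: "\<beta>\<^sub>G (Inl i) (Inl k) = \<beta>\<^sub>U (Inl i) (Inl k)"
  by (simp add: partial_psi_def psi_location_derivative) (simp add: \<theta>\<^sub>U_def \<theta>\<^sub>G_def)

section \<open>Vanishing of the blocks that couple location and scatter\<close>

lemma center_AE_integral_zero:
  fixes h :: "real ^ 'p::{finite,linorder} \<Rightarrow> real"
  assumes int: "integrable F h" and odd: "AE x in F. h (\<mu> - (x - \<mu>)) = - h x"
  shows "(\<integral>x. h x \<partial>F) = 0"
proof -
  have [measurable]: "h \<in> borel_measurable borel"
    using borel_measurable_integrable[OF int] by simp
  have "(\<integral>x. h x \<partial>F) = (\<integral>x. h (\<mu> - (x - \<mu>)) \<partial>F)"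
    by (rule integral_center[of h, symmetric]) measurable
  also have "\<dots> = (\<integral>x. - h x \<partial>F)"
    by (rule integral_cong_AE) (use odd in auto)
  also have "\<dots> = - (\<integral>x. h x \<partial>F)" by simp
  finally show ?thesis by linarith
qed

lemma quadratic_form_neg: "(- v) \<bullet> (A *v (- v)) = v \<bullet> (A *v v)"
  for A :: "real ^ 'p::{finite,linorder} ^ 'p::{finite,linorder}"
  using matrix_vector_mult_scaleR[of A "-1" v] by simp

lemma center_diff: "\<mu> - (x - \<mu>) - (\<mu> + v) = - (x - (\<mu> - v))"
  for x :: "real ^ 'p::{finite,linorder}"
  by simp

text \<open>Parity under the central symmetry. A location equation is odd along a scatter
  coordinate. For a scatter equation, reflecting \<open>x\<close> amounts to reflecting the location
  coordinate about its true value, which reverses the derivative. Either way the partial derivative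
  is odd about \<open>\<mu>\<close>.\<close>

lemma partial_integral_zero:
  assumes int: "integrable F (\<lambda>x. partial_psi \<psi> x \<theta> j k)"
    and diff: "AE x in F. (\<lambda>t. \<psi> x (\<theta>(k := t)) j) differentiable (at (\<theta> k))"
    and odd: "(\<forall>x t. \<psi> (\<mu> - (x - \<mu>)) (\<theta>(k := t)) j = - \<psi> x (\<theta>(k := t)) j) \<or>
      (\<forall>x t. \<psi> (\<mu> - (x - \<mu>)) (\<theta>(k := t)) j = \<psi> x (\<theta>(k := 2 * \<theta> k - t)) j)"
  shows "(\<integral>x. partial_psi \<psi> x \<theta> j k \<partial>F) = 0"
proof (rule center_AE_integral_zero[OF int])
  show "AE x in F. partial_psi \<psi> (\<mu> - (x - \<mu>)) \<theta> j k = - partial_psi \<psi> x \<theta> j k"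
    using diff
  proof eventually_elim
    case (elim x)
    from deriv_uminus[OF this] deriv_reflected[OF this] odd show ?case
      unfolding partial_psi_def by auto
  qed
qed

lemma reflected_axis:
  "(2 * a - t - a) *\<^sub>R (axis i 1 :: real ^ 'p::{finite,linorder}) = - ((t - a) *\<^sub>R axis i 1)"
  by (simp flip: scaleR_minus_left)

lemma beta_cross_U:
  assumes c: "c \<in> lower_triangle"
  shows "\<beta>\<^sub>U (Inl i) (Inr c) = 0" and "\<beta>\<^sub>U (Inr c) (Inl i) = 0"
proof -
  have "\<psi>\<^sub>U (\<mu> - (x - \<mu>)) (\<theta>\<^sub>U(Inr c := t)) (Inl i) = - \<psi>\<^sub>U x (\<theta>\<^sub>U(Inr c := t)) (Inl i)" for x t
    using center_diff[of x 0] quadratic_form_neg[of "x - \<mu>"]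
    by (simp add: unconstrained_psi_Inl location_of_U mahalanobis_def) (simp add: algebra_simps)
  then show "\<beta>\<^sub>U (Inl i) (Inr c) = 0"
    using c by (intro partial_integral_zero int_U diff_U) auto
  have "\<psi>\<^sub>U (\<mu> - (x - \<mu>)) (\<theta>\<^sub>U(Inl i := t)) (Inr c)
      = \<psi>\<^sub>U x (\<theta>\<^sub>U(Inl i := 2 * \<theta>\<^sub>U (Inl i) - t)) (Inr c)" for x t
    unfolding unconstrained_psi_Inr[OF c] location_of_upd_Inl symmetric_of_upd_Inl location_of_U
      symmetric_of_U reflected_axis mahalanobis_def center_diff quadratic_form_neg
    by (simp only: vector_uminus_component minus_mult_minus add_uminus_conv_diff)
  then show "\<beta>\<^sub>U (Inr c) (Inl i) = 0"
    using c by (intro partial_integral_zero int_U diff_U) auto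
qed

lemma beta_cross_G:
  assumes c: "c \<in> graph_positions E"
  shows "\<beta>\<^sub>G (Inl i) (Inr c) = 0" and "\<beta>\<^sub>G (Inr c) (Inl i) = 0"
proof -
  have "\<psi>\<^sub>G (\<mu> - (x - \<mu>)) (\<theta>\<^sub>G(Inr c := t)) (Inl i) = - \<psi>\<^sub>G x (\<theta>\<^sub>G(Inr c := t)) (Inl i)" for x t
    using center_diff[of x 0] quadratic_form_neg[of "x - \<mu>"]
    by (simp add: graphical_psi_Inl location_of_G) (simp add: algebra_simps)
  then show "\<beta>\<^sub>G (Inl i) (Inr c) = 0"
    using c by (intro partial_integral_zero int_G diff_G) auto
  have "\<psi>\<^sub>G (\<mu> - (x - \<mu>)) (\<theta>\<^sub>G(Inl i := t)) (Inr c)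
      = \<psi>\<^sub>G x (\<theta>\<^sub>G(Inl i := 2 * \<theta>\<^sub>G (Inl i) - t)) (Inr c)" for x t
    unfolding graphical_psi_Inr[OF c] location_of_upd_Inl symmetric_of_upd_Inl location_of_G
      symmetric_of_G reflected_axis center_diff quadratic_form_neg
    by (simp only: vector_uminus_component minus_mult_minus add_uminus_conv_diff)
  then show "\<beta>\<^sub>G (Inr c) (Inl i) = 0"
    using c by (intro partial_integral_zero int_G diff_G) auto
qed

section \<open>Derivatives in the scatter coordinates\<close>

abbreviation "r x \<equiv> (x - \<mu>) \<bullet> (L *v (x - \<mu>))"

lemma psi_U_path:
  assumes "c \<in> lower_triangle" "d \<in> lower_triangle"
  shows "\<psi>\<^sub>U x (\<theta>\<^sub>U(Inr c := t)) (Inr d)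
    = u\<^sub>2 ((x - \<mu>) \<bullet> (matrix_inv (\<Sigma> + (t - \<theta>\<^sub>U (Inr c)) *\<^sub>R unit_sym c) *v (x - \<mu>)))
        * ((x - \<mu>) $ fst d * (x - \<mu>) $ snd d)
      - (\<Sigma> $ fst d $ snd d + (t - \<theta>\<^sub>U (Inr c)) * unit_sym c $ fst d $ snd d)"
  unfolding unconstrained_psi_Inr[OF assms(2)] symmetric_of_upd_Inr[OF order_refl assms(1)]
    location_of_upd_Inr location_of_U symmetric_of_U mahalanobis_def
  by simp

text \<open>Parametrized by the inverse, the distance is affine in \<open>t\<close>, which makes the
  derivative of \<open>u\<^sub>2\<close> accessible.\<close>

lemma psi_G_path:
  assumes "c \<in> graph_positions E" "d \<in> graph_positions E"
  shows "\<psi>\<^sub>G x (\<theta>\<^sub>G(Inr c := t)) (Inr d)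
    = matrix_inv (L + (t - \<theta>\<^sub>G (Inr c)) *\<^sub>R unit_sym c) $ fst d $ snd d
      - u\<^sub>2 (r x + (t - \<theta>\<^sub>G (Inr c)) * ((x - \<mu>) \<bullet> (unit_sym c *v (x - \<mu>))))
        * ((x - \<mu>) $ fst d * (x - \<mu>) $ snd d)"
  unfolding graphical_psi_Inr[OF assms(2)] symmetric_of_upd_Inr[OF graph_positions_lower assms(1)]
    location_of_upd_Inr location_of_G symmetric_of_G
  by (simp add: matrix_vector_mult_add_rdistrib inner_add_right scaleR_matrix_vector_assoc[symmetric])

lemma unit_sym_diag_form: "y \<bullet> (unit_sym (i, i) *v y) = (y $ i)\<^sup>2"
proof -
  have "unit_sym (i, i) = outer (axis i 1)"
    by (auto simp: unit_sym_def outer_def vec_eq_iff axis_def)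
  then show ?thesis
    by (simp add: outer_mult_vec inner_axis inner_axis' power2_eq_square)
qed

lemma diag_graph_positions: "(i, i) \<in> graph_positions E"
  by (simp add: graph_positions_def)

text \<open>Along a diagonal entry of the inverse scatter matrix, \<open>r x\<close> moves with the nonzero speed
  \<open>(x - \<mu>) $ i ^ 2\<close>, so that differentiability of the graphical system gives that of \<open>u\<^sub>2\<close>.\<close>

lemma u2_differentiable: "AE x in F. u\<^sub>2 differentiable (at (r x))"
proof -
  fix i :: 'p
  let ?c = "(i, i)"
  let ?t = "\<theta>\<^sub>G (Inr ?c)"
  have "AE x in F. (\<lambda>t. \<psi>\<^sub>G x (\<theta>\<^sub>G(Inr ?c := t)) (Inr ?c)) differentiable (at ?t)"
    by (rule diff_G) (simp_all add: diag_graph_positions)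
  then show ?thesis
    using hyperplane_null[of i]
  proof eventually_elim
    case (elim x)
    define s where "s = ((x - \<mu>) $ i)\<^sup>2"
    have s: "s \<noteq> 0" using elim(2) by (simp add: s_def)
    obtain D where D: "((\<lambda>t. \<psi>\<^sub>G x (\<theta>\<^sub>G(Inr ?c := t)) (Inr ?c)) has_real_derivative D) (at ?t)"
      using elim(1) real_differentiableE by blast
    let ?N = "\<lambda>t. matrix_inv (L + (t - ?t) *\<^sub>R unit_sym ?c) $ i $ i"
    have path: "\<psi>\<^sub>G x (\<theta>\<^sub>G(Inr ?c := t)) (Inr ?c) = ?N t - u\<^sub>2 (r x + (t - ?t) * s) * s" for t
      by (simp only: psi_G_path[OF diag_graph_positions diag_graph_positions] unit_sym_diag_form
          s_def fst_conv snd_conv power2_eq_square)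
    obtain D' where D': "(?N has_real_derivative D') (at ?t)"
      using matrix_inv_has_derivative[OF spd_invertible[OF L_spd] linear_matrix_nth[of i i]] by blast
    \<comment> \<open>Solves \<open>path\<close> for the term with \<open>u\<^sub>2\<close>; the
      inverse \<open>?N\<close> is differentiable in its own right.\<close>
    have "((\<lambda>t. (?N t - \<psi>\<^sub>G x (\<theta>\<^sub>G(Inr ?c := t)) (Inr ?c)) / s) has_real_derivative (D' - D) / s) (at ?t)"
      by (intro DERIV_cdivide DERIV_diff D D')
    then have "((\<lambda>t. u\<^sub>2 (r x + (t - ?t) * s)) has_real_derivative (D' - D) / s) (at ?t)"
      using s by (simp add: path)
    \<comment> \<open>The coordinate value at which the distance equals \<open>\<rho>\<close>;
      composing with it turns differentiability along the path into differentiability of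
      \<open>u\<^sub>2\<close>.\<close>
    moreover have "((\<lambda>\<rho>. ?t + (\<rho> - r x) / s) has_real_derivative 1 / s) (at (r x))"
      using s by (auto intro!: derivative_eq_intros)
    ultimately have "((\<lambda>\<rho>. u\<^sub>2 (r x + (?t + (\<rho> - r x) / s - ?t) * s)) has_real_derivative (D' - D) / s * (1 / s)) (at (r x))"
      by (intro DERIV_chain2[where g = "\<lambda>\<rho>. ?t + (\<rho> - r x) / s"]) (simp_all add: s)
    then have "(u\<^sub>2 has_real_derivative (D' - D) / s * (1 / s)) (at (r x))"
      using s by simp
    then show ?case unfolding real_differentiable_def by blast
  qed
qed

lemma partial_U:
  assumes c: "c \<in> lower_triangle" and d: "d \<in> lower_triangle"
    and D: "(u\<^sub>2 has_real_derivative D) (at (r x))"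
  shows "partial_psi \<psi>\<^sub>U x \<theta>\<^sub>U (Inr d) (Inr c)
    = - (D * ((x - \<mu>) \<bullet> ((L ** unit_sym c ** L) *v (x - \<mu>)) * ((x - \<mu>) $ fst d * (x - \<mu>) $ snd d)))
      - unit_sym c $ fst d $ snd d"
proof -
  let ?t = "\<theta>\<^sub>U (Inr c)" and ?y = "x - \<mu>"
  let ?q = "\<lambda>t. ?y \<bullet> (matrix_inv (\<Sigma> + (t - ?t) *\<^sub>R unit_sym c) *v ?y)"
  have "(?q has_real_derivative - (?y \<bullet> ((L ** unit_sym c ** L) *v ?y))) (at ?t)"
    by (rule matrix_inv_has_derivative[OF spd_invertible[OF S] linear_quadratic_form])
  then have "((\<lambda>t. u\<^sub>2 (?q t)) has_real_derivative D * - (?y \<bullet> ((L ** unit_sym c ** L) *v ?y))) (at ?t)"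
    by (rule DERIV_chain2[rotated]) (use D in simp)
  then have "((\<lambda>t. u\<^sub>2 (?q t) * (?y $ fst d * ?y $ snd d)
        - (\<Sigma> $ fst d $ snd d + (t - ?t) * unit_sym c $ fst d $ snd d)) has_real_derivative
      D * - (?y \<bullet> ((L ** unit_sym c ** L) *v ?y)) * (?y $ fst d * ?y $ snd d)
        - unit_sym c $ fst d $ snd d) (at ?t)"
    by (intro DERIV_diff DERIV_cmult_right) (auto intro!: derivative_eq_intros)
  then show ?thesis
    unfolding partial_psi_def psi_U_path[OF c d] by (simp add: DERIV_imp_deriv)
qed

lemma partial_G:
  assumes c: "c \<in> graph_positions E" and d: "d \<in> graph_positions E"
    and D: "(u\<^sub>2 has_real_derivative D) (at (r x))"
  shows "partial_psi \<psi>\<^sub>G x \<theta>\<^sub>G (Inr d) (Inr c)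
    = - ((\<Sigma> ** unit_sym c ** \<Sigma>) $ fst d $ snd d)
      - D * ((x - \<mu>) \<bullet> (unit_sym c *v (x - \<mu>)) * ((x - \<mu>) $ fst d * (x - \<mu>) $ snd d))"
proof -
  let ?t = "\<theta>\<^sub>G (Inr c)" and ?y = "x - \<mu>"
  let ?q = "\<lambda>t. r x + (t - ?t) * (?y \<bullet> (unit_sym c *v ?y))"
  have "(?q has_real_derivative ?y \<bullet> (unit_sym c *v ?y)) (at ?t)"
    by (auto intro!: derivative_eq_intros)
  then have "((\<lambda>t. u\<^sub>2 (?q t)) has_real_derivative D * (?y \<bullet> (unit_sym c *v ?y))) (at ?t)"
    by (rule DERIV_chain2[rotated]) (use D in simp)
  then have "((\<lambda>t. matrix_inv (L + (t - ?t) *\<^sub>R unit_sym c) $ fst d $ snd d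
        - u\<^sub>2 (?q t) * (?y $ fst d * ?y $ snd d)) has_real_derivative
      - ((matrix_inv L ** unit_sym c ** matrix_inv L) $ fst d $ snd d)
        - D * (?y \<bullet> (unit_sym c *v ?y)) * (?y $ fst d * ?y $ snd d)) (at ?t)"
    by (intro DERIV_diff DERIV_cmult_right
        matrix_inv_has_derivative[OF spd_invertible[OF L_spd] linear_matrix_nth])
  then show ?thesis
    unfolding partial_psi_def psi_G_path[OF c d] by (simp add: DERIV_imp_deriv matrix_inv_matrix_inv_spd[OF S])
qed

text \<open>The derivative of \<open>u\<^sub>2\<close> exists only almost everywhere along
  \<open>r\<close>, with no measurability at hand. \<open>W\<close> is instead solved from a
  diagonal partial derivative of the graphical system, which is integrable and therefore
  measurable.\<close>

lemma measurable_weight: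
  obtains W where "W \<in> borel_measurable borel"
    "AE x in F. (u\<^sub>2 has_real_derivative W x) (at (r x))"
proof -
  fix i :: 'p
  define p where "p x = partial_psi \<psi>\<^sub>G x \<theta>\<^sub>G (Inr (i, i)) (Inr (i, i))" for x
  have "integrable F p"
    unfolding p_def[abs_def] by (rule int_G) (simp_all add: diag_graph_positions)
  then have [measurable]: "p \<in> borel_measurable borel"
    using borel_measurable_integrable by fastforce
  define W where "W x = (- ((\<Sigma> ** unit_sym (i, i) ** \<Sigma>) $ i $ i) - p x) / (x - \<mu>) $ i ^ 4" for x
  have "W \<in> borel_measurable borel" unfolding W_def[abs_def] by measurable
  moreover have "AE x in F. (u\<^sub>2 has_real_derivative W x) (at (r x))"
    using u2_differentiable hyperplane_null[of i]
  proof eventually_elim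
    case (elim x)
    obtain D where D: "(u\<^sub>2 has_real_derivative D) (at (r x))"
      using elim(1) real_differentiableE by blast
    have "p x = - ((\<Sigma> ** unit_sym (i, i) ** \<Sigma>) $ i $ i) - D * (x - \<mu>) $ i ^ 4"
      unfolding p_def partial_G[OF diag_graph_positions diag_graph_positions D] unit_sym_diag_form
      by (simp add: power4_eq_xxxx power2_eq_square)
    then have "W x = D" using elim(2) by (simp add: W_def)
    with D show ?case by simp
  qed
  ultimately show thesis by (rule that)
qed

text \<open>Contraction of the three pairings with \<open>M\<close>: one produces the trace term,
  the other two the congruence, and these two agree by symmetry of \<open>M\<close>.\<close>

lemma inner_congruence_trace:
  assumes "transpose M = M"
  shows "(\<Sum>a\<in>UNIV. \<Sum>b\<in>UNIV. M $ a $ b *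
      (c * (\<Sigma> $ a $ b * \<Sigma> $ i $ j + \<Sigma> $ a $ i * \<Sigma> $ b $ j + \<Sigma> $ a $ j * \<Sigma> $ b $ i)))
    = c * ((\<Sigma> \<bullet> M) * \<Sigma> $ i $ j + 2 * (\<Sigma> ** M ** \<Sigma>) $ i $ j)"
proof -
  note sym = sym_nth[OF spd_sym[OF S]]
  have 1: "(\<Sigma> ** M ** \<Sigma>) $ i $ j = (\<Sum>a\<in>UNIV. \<Sum>b\<in>UNIV. M $ a $ b * (\<Sigma> $ a $ i * \<Sigma> $ b $ j))" for i j
  proof -
    have "(\<Sigma> ** M ** transpose \<Sigma>) $ i $ j = (\<Sum>a\<in>UNIV. \<Sum>b\<in>UNIV. \<Sigma> $ i $ a * \<Sigma> $ j $ b * M $ a $ b)"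
      by (rule congruence_nth)
    then show ?thesis by (simp add: spd_sym[OF S] sym[of i] sym[of j] mult_ac)
  qed
  have "(\<Sigma> ** M ** \<Sigma>) $ j $ i = (\<Sigma> ** M ** \<Sigma>) $ i $ j"
    by (rule sym_nth) (simp add: matrix_transpose_mul spd_sym[OF S] assms matrix_mul_assoc)
  then have 2: "(\<Sigma> ** M ** \<Sigma>) $ i $ j = (\<Sum>a\<in>UNIV. \<Sum>b\<in>UNIV. M $ a $ b * (\<Sigma> $ a $ j * \<Sigma> $ b $ i))"
    using 1[of j i] by simp
  have 3: "\<Sigma> \<bullet> M = (\<Sum>a\<in>UNIV. \<Sum>b\<in>UNIV. M $ a $ b * \<Sigma> $ a $ b)"
    by (simp add: inner_matrix mult.commute)
  have "c * ((\<Sigma> \<bullet> M) * \<Sigma> $ i $ j + 2 * (\<Sigma> ** M ** \<Sigma>) $ i $ j)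
      = c * ((\<Sigma> \<bullet> M) * \<Sigma> $ i $ j + (\<Sigma> ** M ** \<Sigma>) $ i $ j + (\<Sigma> ** M ** \<Sigma>) $ i $ j)"
    by simp
  also have "\<dots> = c * ((\<Sum>a\<in>UNIV. \<Sum>b\<in>UNIV. M $ a $ b * \<Sigma> $ a $ b) * \<Sigma> $ i $ j
      + (\<Sum>a\<in>UNIV. \<Sum>b\<in>UNIV. M $ a $ b * (\<Sigma> $ a $ i * \<Sigma> $ b $ j))
      + (\<Sum>a\<in>UNIV. \<Sum>b\<in>UNIV. M $ a $ b * (\<Sigma> $ a $ j * \<Sigma> $ b $ i)))"
    using 1[of i j] 2 3 by simp
  finally show ?thesis
    by (simp add: sum_distrib_left sum_distrib_right distrib_left sum.distrib mult_ac)
qed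

text \<open>\<open>op_U\<close> and \<open>op_G\<close> are the actions of \<open>\<beta>\<^sub>U\<close> and \<open>\<beta>\<^sub>G\<close> on symmetric matrices. Rotation invariance
  leaves only the parameter \<open>\<kappa>\<close>, which comes from the fourth moments of \<open>x - \<mu>\<close> weighted with the
  derivative of \<open>u\<^sub>2\<close>.\<close>

definition op_U :: "real \<Rightarrow> real ^ 'p::{finite,linorder} ^ 'p::{finite,linorder} \<Rightarrow> real ^ 'p::{finite,linorder} ^ 'p::{finite,linorder}" where
  "op_U \<kappa> V = - ((1 + 2 * \<kappa>) *\<^sub>R V + (\<kappa> * (L \<bullet> V)) *\<^sub>R \<Sigma>)"

definition op_G :: "real \<Rightarrow> real ^ 'p::{finite,linorder} ^ 'p::{finite,linorder} \<Rightarrow> real ^ 'p::{finite,linorder} ^ 'p::{finite,linorder}" where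
  "op_G \<kappa> \<Delta> = - ((1 + 2 * \<kappa>) *\<^sub>R (\<Sigma> ** \<Delta> ** \<Sigma>) + (\<kappa> * (\<Sigma> \<bullet> \<Delta>)) *\<^sub>R \<Sigma>)"

definition scatter_form :: "real \<Rightarrow> bool" where
  "scatter_form \<kappa> \<longleftrightarrow>
    (\<forall>c\<in>lower_triangle. \<forall>d\<in>lower_triangle.
      \<beta>\<^sub>U (Inr d) (Inr c) = op_U \<kappa> (unit_sym c) $ fst d $ snd d) \<and>
    (\<forall>c\<in>graph_positions E. \<forall>d\<in>graph_positions E.
      \<beta>\<^sub>G (Inr d) (Inr c) = op_G \<kappa> (unit_sym c) $ fst d $ snd d)"

text \<open>Both derivatives contain the same weight times quartic monomials, so one constant serves
  both. The unconstrained one contracts them with \<open>L ** unit_sym c ** L\<close>, and the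
  congruence by \<open>\<Sigma>\<close> in the moment formula cancels the factors
  \<open>L\<close>.\<close>

lemma scatter_form_exists: "\<exists>\<kappa>. scatter_form \<kappa>"
proof -
  obtain W where W [measurable]: "W \<in> borel_measurable borel"
    and D: "AE x in F. (u\<^sub>2 has_real_derivative W x) (at (r x))"
    using measurable_weight by blast
  \<comment> \<open>Reflections preserve \<open>r\<close>, and a derivative at a given point is
    unique, so \<open>W\<close> is invariant almost everywhere.\<close>
  have W_inv: "AE x in F. W (T d x) = W x" for d
    using D AE_refl[OF D, of d]
  proof eventually_elim
    case (elim x)
    have "r (T d x) = r x" by (simp add: reflection_preserves[OF S])
    with elim show ?case by (metis DERIV_unique)
  qed
  \<comment> \<open>At a diagonal position the weight multiplies a pure fourth power, so
    integrability of that partial derivative is what the moment lemma asks for.\<close>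
  have W_int: "integrable F (\<lambda>x. W x * (x - \<mu>) $ i ^ 4)" for i
  proof -
    let ?p = "\<lambda>x. partial_psi \<psi>\<^sub>G x \<theta>\<^sub>G (Inr (i, i)) (Inr (i, i))"
    let ?h = "\<lambda>x. - ((\<Sigma> ** unit_sym (i, i) ** \<Sigma>) $ i $ i) - ?p x"
    have h: "integrable F ?h"
      by (intro Bochner_Integration.integrable_diff integrable_const int_G)
        (simp_all add: diag_graph_positions)
    have "AE x in F. ?h x = W x * (x - \<mu>) $ i ^ 4"
      using D
    proof eventually_elim
      case (elim x)
      show ?case
        unfolding partial_G[OF diag_graph_positions diag_graph_positions elim] unit_sym_diag_form
        by (simp add: power4_eq_xxxx power2_eq_square)
    qed
    then show ?thesis
      using h borel_measurable_integrable[OF h] by (subst integrable_cong_AE[symmetric]) auto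
  qed
  let ?m = "\<lambda>i j k l x. W x * ((x - \<mu>) $ i * (x - \<mu>) $ j * (x - \<mu>) $ k * (x - \<mu>) $ l)"
  obtain \<kappa> where m_int: "\<And>i j k l. integrable F (?m i j k l)"
    and m: "\<And>i j k l. (\<integral>x. ?m i j k l x \<partial>F)
      = \<kappa> * (\<Sigma> $ i $ j * \<Sigma> $ k $ l + \<Sigma> $ i $ k * \<Sigma> $ j $ l + \<Sigma> $ i $ l * \<Sigma> $ j $ k)"
    using fourth_moments[OF W W_inv W_int] by blast
  have form: "integrable F (\<lambda>x. W x * ((x - \<mu>) \<bullet> (M *v (x - \<mu>)) * ((x - \<mu>) $ i * (x - \<mu>) $ j)))"
      "(\<integral>x. W x * ((x - \<mu>) \<bullet> (M *v (x - \<mu>)) * ((x - \<mu>) $ i * (x - \<mu>) $ j)) \<partial>F)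
        = \<kappa> * ((\<Sigma> \<bullet> M) * \<Sigma> $ i $ j + 2 * (\<Sigma> ** M ** \<Sigma>) $ i $ j)"
    if M: "transpose M = M" for M :: "real ^ 'p::{finite,linorder} ^ 'p::{finite,linorder}" and i j
  proof -
    have eq: "W x * ((x - \<mu>) \<bullet> (M *v (x - \<mu>)) * ((x - \<mu>) $ i * (x - \<mu>) $ j))
        = (\<Sum>a\<in>UNIV. \<Sum>b\<in>UNIV. M $ a $ b * ?m a b i j x)" for x
    proof -
      have "W x * (y \<bullet> (M *v y) * (y $ i * y $ j)) = (\<Sum>a\<in>UNIV. \<Sum>b\<in>UNIV. M $ a $ b * (W x * (y $ a * y $ b * y $ i * y $ j)))" for y
        unfolding inner_vec_def matrix_vector_mult_def vec_lambda_beta inner_real_def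
          sum_distrib_left sum_distrib_right
        by (intro sum.cong refl) (simp add: mult_ac)
      then show ?thesis .
    qed
    show "integrable F (\<lambda>x. W x * ((x - \<mu>) \<bullet> (M *v (x - \<mu>)) * ((x - \<mu>) $ i * (x - \<mu>) $ j)))"
      unfolding eq by (intro Bochner_Integration.integrable_sum integrable_mult_right m_int)
    have "(\<integral>x. W x * ((x - \<mu>) \<bullet> (M *v (x - \<mu>)) * ((x - \<mu>) $ i * (x - \<mu>) $ j)) \<partial>F)
        = (\<Sum>a\<in>UNIV. \<Sum>b\<in>UNIV. M $ a $ b * (\<integral>x. ?m a b i j x \<partial>F))"
      unfolding eq by (subst Bochner_Integration.integral_sum,
        intro Bochner_Integration.integrable_sum integrable_mult_right m_int,
        subst Bochner_Integration.integral_sum, intro integrable_mult_right m_int,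
        subst integral_mult_right_zero, rule refl)
    then show "(\<integral>x. W x * ((x - \<mu>) \<bullet> (M *v (x - \<mu>)) * ((x - \<mu>) $ i * (x - \<mu>) $ j)) \<partial>F)
        = \<kappa> * ((\<Sigma> \<bullet> M) * \<Sigma> $ i $ j + 2 * (\<Sigma> ** M ** \<Sigma>) $ i $ j)"
      unfolding m inner_congruence_trace[OF M] .
  qed
  have prob_UNIV: "prob UNIV = 1" using prob_space by simp
  show ?thesis
    unfolding scatter_form_def
  proof (intro exI[of _ \<kappa>] conjI ballI)
    fix c d :: "'p \<times> 'p" assume c: "c \<in> lower_triangle" and d: "d \<in> lower_triangle"
    let ?M = "L ** unit_sym c ** L"
    have M: "transpose ?M = ?M"
      by (simp add: matrix_transpose_mul spd_sym[OF L_spd] matrix_mul_assoc)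
    have "\<beta>\<^sub>U (Inr d) (Inr c)
        = (\<integral>x. - (W x * ((x - \<mu>) \<bullet> (?M *v (x - \<mu>)) * ((x - \<mu>) $ fst d * (x - \<mu>) $ snd d)))
          - unit_sym c $ fst d $ snd d \<partial>F)"
    proof (rule integral_cong_AE)
      show "(\<lambda>x. partial_psi \<psi>\<^sub>U x \<theta>\<^sub>U (Inr d) (Inr c)) \<in> borel_measurable F"
        using c d by (intro borel_measurable_integrable int_U) auto
      show "AE x in F. partial_psi \<psi>\<^sub>U x \<theta>\<^sub>U (Inr d) (Inr c)
          = - (W x * ((x - \<mu>) \<bullet> (?M *v (x - \<mu>)) * ((x - \<mu>) $ fst d * (x - \<mu>) $ snd d)))
          - unit_sym c $ fst d $ snd d"
        using D by eventually_elim (rule partial_U[OF c d])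
    qed (use borel_measurable_integrable[OF form(1)[OF M]] in measurable)
    also have "\<dots> = - (\<kappa> * ((\<Sigma> \<bullet> ?M) * \<Sigma> $ fst d $ snd d + 2 * (\<Sigma> ** ?M ** \<Sigma>) $ fst d $ snd d))
        - unit_sym c $ fst d $ snd d"
      using form[OF M, of "fst d" "snd d"] by (simp add: prob_UNIV)
    also have "\<Sigma> ** ?M ** \<Sigma> = (\<Sigma> ** L) ** unit_sym c ** (L ** \<Sigma>)"
      by (simp add: matrix_mul_assoc)
    also have "\<dots> = unit_sym c" by (simp add: spd_inv_left[OF S] spd_inv_right[OF S])
    also have "\<Sigma> \<bullet> ?M = L \<bullet> unit_sym c"
    proof -
      have "?M \<bullet> \<Sigma> = (L ** unit_sym c) \<bullet> (\<Sigma> ** L)"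
        by (simp add: inner_matrix_mult_right spd_sym[OF L_spd])
      also have "\<dots> = unit_sym c \<bullet> L"
        by (subst inner_matrix_mult_left) (simp add: spd_sym[OF L_spd] spd_inv_right[OF S])
      finally show ?thesis by (simp add: inner_commute)
    qed
    finally show "\<beta>\<^sub>U (Inr d) (Inr c) = op_U \<kappa> (unit_sym c) $ fst d $ snd d"
      by (simp add: op_U_def algebra_simps)
  next
    fix c d :: "'p \<times> 'p" assume c: "c \<in> graph_positions E" and d: "d \<in> graph_positions E"
    let ?M = "unit_sym c"
    have M: "transpose ?M = ?M" by simp
    have "\<beta>\<^sub>G (Inr d) (Inr c)
        = (\<integral>x. - ((\<Sigma> ** unit_sym c ** \<Sigma>) $ fst d $ snd d)
          - W x * ((x - \<mu>) \<bullet> (?M *v (x - \<mu>)) * ((x - \<mu>) $ fst d * (x - \<mu>) $ snd d)) \<partial>F)"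
    proof (rule integral_cong_AE)
      show "(\<lambda>x. partial_psi \<psi>\<^sub>G x \<theta>\<^sub>G (Inr d) (Inr c)) \<in> borel_measurable F"
        using c d by (intro borel_measurable_integrable int_G) auto
      show "AE x in F. partial_psi \<psi>\<^sub>G x \<theta>\<^sub>G (Inr d) (Inr c)
          = - ((\<Sigma> ** unit_sym c ** \<Sigma>) $ fst d $ snd d)
          - W x * ((x - \<mu>) \<bullet> (?M *v (x - \<mu>)) * ((x - \<mu>) $ fst d * (x - \<mu>) $ snd d))"
        using D by eventually_elim (rule partial_G[OF c d])
    qed (use borel_measurable_integrable[OF form(1)[OF M]] in measurable)
    also have "\<dots> = - ((\<Sigma> ** unit_sym c ** \<Sigma>) $ fst d $ snd d)
        - \<kappa> * ((\<Sigma> \<bullet> ?M) * \<Sigma> $ fst d $ snd d + 2 * (\<Sigma> ** ?M ** \<Sigma>) $ fst d $ snd d)"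
      using form[OF M, of "fst d" "snd d"] by (simp add: prob_UNIV)
    finally show "\<beta>\<^sub>G (Inr d) (Inr c) = op_G \<kappa> (unit_sym c) $ fst d $ snd d"
      by (simp add: op_G_def algebra_simps)
  qed
qed

end


section \<open>Asymptotic expansions\<close>

definition trivial_kernel :: "'i set \<Rightarrow> ('i \<Rightarrow> 'i \<Rightarrow> real) \<Rightarrow> bool" where
  "trivial_kernel J b \<longleftrightarrow>
     (\<forall>D. (\<forall>j\<in>J. (\<Sum>k\<in>J. b j k * D k) = 0) \<longrightarrow> (\<forall>k\<in>J. D k = 0))"

text \<open>An injective linear map in finite dimension is bounded below. The index set
  \<open>J\<close> enters as the coordinate subspace \<open>s\<close>.\<close>

lemma trivial_kernel_lower_bound:
  fixes b :: "'i::finite \<Rightarrow> 'i \<Rightarrow> real"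
  assumes ker: "trivial_kernel J b"
  obtains C where "0 < C" "\<And>D. (\<Sum>k\<in>J. \<bar>D k\<bar>) \<le> C * (\<Sum>j\<in>J. \<bar>\<Sum>k\<in>J. b j k * D k\<bar>)"
proof -
  define s where "s = {v :: real ^ 'i. \<forall>k. k \<notin> J \<longrightarrow> v $ k = 0}"
  define f where "f v = (\<chi> j. if j \<in> J then \<Sum>k\<in>J. b j k * v $ k else 0)" for v :: "real ^ 'i"
  have s: "subspace s" by (auto simp: s_def subspace_def)
  have "linear f"
    by (rule linearI) (auto simp: f_def vec_eq_iff sum.distrib distrib_left sum_distrib_left mult_ac)
  then have f: "bounded_linear f" by (simp add: linear_conv_bounded_linear)
  have "v = 0" if "v \<in> s" "f v = 0" for v
  proof -
    have "(\<Sum>k\<in>J. b j k * v $ k) = 0" if "j \<in> J" for j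
      using arg_cong[OF \<open>f v = 0\<close>, of "\<lambda>w. w $ j"] that by (simp add: f_def)
    then have "v $ k = 0" if "k \<in> J" for k
      using ker[unfolded trivial_kernel_def, rule_format, of "\<lambda>k. v $ k"] that by blast
    with \<open>v \<in> s\<close> show ?thesis by (auto simp: s_def vec_eq_iff)
  qed
  then obtain e where e: "0 < e" "\<And>v. v \<in> s \<Longrightarrow> e * norm v \<le> norm (f v)"
    using injective_imp_isometric[OF closed_subspace[OF s] s f] by blast
  show thesis
  \<comment> \<open>The summand 1 keeps the constant positive when \<open>J\<close> is
    empty.\<close>
  proof (rule that[of "real (card J + 1) / e"])
    fix D :: "'i \<Rightarrow> real"
    define v where "v = (\<chi> k. if k \<in> J then D k else 0)"
    let ?r = "\<Sum>j\<in>J. \<bar>\<Sum>k\<in>J. b j k * D k\<bar>"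
    have fv: "f v $ j = (if j \<in> J then \<Sum>k\<in>J. b j k * D k else 0)" for j
      by (simp add: f_def v_def)
    have "norm (f v) \<le> (\<Sum>j\<in>UNIV. \<bar>f v $ j\<bar>)" by (rule norm_le_l1_cart)
    also have "\<dots> = ?r" by (simp add: fv if_distrib sum.If_cases cong: if_cong)
    finally have "e * norm v \<le> ?r" using e(2)[of v] by (simp add: s_def v_def)
    then have nv: "norm v \<le> ?r / e" using e(1) by (simp add: field_simps)
    have "\<bar>D k\<bar> \<le> norm v" if "k \<in> J" for k
      using component_le_norm_cart[of v k] that by (simp add: v_def)
    then have "(\<Sum>k\<in>J. \<bar>D k\<bar>) \<le> real (card J) * norm v" by (rule sum_bounded_above)
    also have "\<dots> \<le> real (card J + 1) * (?r / e)" using nv by (intro mult_mono) auto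
    finally show "(\<Sum>k\<in>J. \<bar>D k\<bar>) \<le> real (card J + 1) / e * ?r" by simp
  qed (use e(1) in simp)
qed

lemma tendsto_lower_bound:
  fixes b :: "'i::finite \<Rightarrow> 'i \<Rightarrow> real"
  assumes ker: "trivial_kernel J b"
    and lim: "\<And>j. j \<in> J \<Longrightarrow> ((\<lambda>z. \<Sum>k\<in>J. b j k * D z k) \<longlongrightarrow> 0) \<F>" and "k \<in> J"
  shows "((\<lambda>z. D z k) \<longlongrightarrow> 0) \<F>"
proof -
  obtain C where C: "0 < C" "\<And>D. (\<Sum>k\<in>J. \<bar>D k\<bar>) \<le> C * (\<Sum>j\<in>J. \<bar>\<Sum>k\<in>J. b j k * D k\<bar>)"
    using trivial_kernel_lower_bound[OF ker] by blast
  have lim': "((\<lambda>z. C * (\<Sum>j\<in>J. \<bar>\<Sum>k\<in>J. b j k * D z k\<bar>)) \<longlongrightarrow> 0) \<F>"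
    by (intro tendsto_mult_right_zero tendsto_null_sum tendsto_rabs_zero lim)
  show ?thesis
  proof (rule Lim_null_comparison[OF _ lim'], rule always_eventually, rule allI)
    fix z
    have "\<bar>D z k\<bar> \<le> (\<Sum>k\<in>J. \<bar>D z k\<bar>)" using \<open>k \<in> J\<close> by (intro member_le_sum) auto
    then show "norm (D z k) \<le> C * (\<Sum>j\<in>J. \<bar>\<Sum>k\<in>J. b j k * D z k\<bar>)"
      using C(2)[of "D z"] by simp
  qed
qed

context iid_sample
begin

text \<open>The lower bound for \<open>b\<close> gives
  \<open>N \<le> C * (|Z| + card J * e * N)\<close> with \<open>e\<close> tending to zero. Absorbing
  the last term bounds \<open>N\<close> by \<open>Z\<close>, which has bounded second moments; only
  then does the remainder \<open>e * N\<close> vanish.\<close>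

lemma regular_expansion:
  fixes \<psi> :: "'x \<Rightarrow> ('i::finite \<Rightarrow> real) \<Rightarrow> 'i \<Rightarrow> real"
  assumes reg: "M_estimation_regular M X F J \<Theta> \<psi>" and seq: "solution_sequence M X J \<Theta> \<psi> \<theta>\<^sub>n"
    and ker: "trivial_kernel J (b_matrix F J \<Theta> \<psi>)"
  defines "\<theta> \<equiv> theta_F F J \<Theta> \<psi>" and "b \<equiv> b_matrix F J \<Theta> \<psi>"
    and "D \<equiv> \<lambda>z k. sqrt (real (fst z)) * (\<theta>\<^sub>n (fst z) (snd z) k - theta_F F J \<Theta> \<psi> k)"
  shows "\<And>k. k \<in> J \<Longrightarrow> bounded_in_prob M (\<lambda>z. D z k)"
    and "\<And>j. j \<in> J \<Longrightarrow> ((\<lambda>z. sqrt (real (fst z)) * sample_mean (\<lambda>x. \<psi> x \<theta> j) z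
      + (\<Sum>k\<in>J. b j k * D z k)) \<longlongrightarrow> 0) (in_prob M)"
proof -
  note reg' = reg[unfolded M_estimation_regular_def Let_def, folded \<theta>_def]
  have "population_solution F J \<Theta> \<psi> \<theta>"
    unfolding \<theta>_def theta_F_def by (rule theI'[OF reg'[THEN conjunct1]])
  then have mean: "integrable F (\<lambda>x. \<psi> x \<theta> j)" "(\<integral>x. \<psi> x \<theta> j \<partial>F) = 0" if "j \<in> J" for j
    using that by (auto simp: population_solution_def)
  obtain r where r: "\<And>j k. j \<in> J \<Longrightarrow> k \<in> J \<Longrightarrow> tendsto_in_prob M (r j k) 0"
    and expand: "\<And>j. j \<in> J \<Longrightarrow> \<forall>\<^sub>F n in sequentially. AE \<omega> in M.
       0 = (1 / real n) * (\<Sum>i<n. \<psi> (X i \<omega>) \<theta> j) + (\<Sum>k\<in>J. (\<theta>\<^sub>n n \<omega> k - \<theta> k) *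
         ((1 / real n) * (\<Sum>i<n. partial_psi \<psi> (X i \<omega>) \<theta> j k) + r j k n \<omega>))"
    using reg'[THEN conjunct2, THEN conjunct2, THEN conjunct1, rule_format, OF seq] by blast
  note moments = reg'[THEN conjunct2, THEN conjunct2, THEN conjunct2, rule_format]
  define Z where "Z j z = sqrt (real (fst z)) * sample_mean (\<lambda>x. \<psi> x \<theta> j) z" for j z
  define \<epsilon> where "\<epsilon> j k z = sample_mean (\<lambda>x. partial_psi \<psi> x \<theta> j k) z + r j k (fst z) (snd z) - b j k" for j k z
  define e where "e z = (\<Sum>j\<in>J. \<Sum>k\<in>J. \<bar>\<epsilon> j k z\<bar>)" for z
  define N where "N z = (\<Sum>k\<in>J. \<bar>D z k\<bar>)" for z
  have Z_bounded: "bounded_in_prob M (Z j)" if j: "j \<in> J" for j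
    unfolding Z_def[abs_def]
  proof (rule centered_mean_bounded_in_prob)
    show "(\<lambda>x. \<psi> x \<theta> j) \<in> borel_measurable borel"
      using borel_measurable_integrable[OF mean(1)[OF j]] by simp
    show "integrable F (\<lambda>x. (\<psi> x \<theta> j)\<^sup>2)" using moments[OF j j] by (simp add: power2_eq_square)
  qed (rule mean(2)[OF j])
  have \<epsilon>_lim: "(\<epsilon> j k \<longlongrightarrow> 0) (in_prob M)" if j: "j \<in> J" and k: "k \<in> J" for j k
  proof -
    have "integrable F (\<lambda>x. partial_psi \<psi> x \<theta> j k)" using moments[OF j k] by blast
    then have "(sample_mean (\<lambda>x. partial_psi \<psi> x \<theta> j k) \<longlongrightarrow> b j k) (in_prob M)"
      unfolding b_def b_matrix_def \<theta>_def by (rule sample_mean_tendsto)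
    from tendsto_diff[OF tendsto_add[OF this tendsto_in_probD[OF r[OF j k]]] tendsto_const]
    have "((\<lambda>z. sample_mean (\<lambda>x. partial_psi \<psi> x \<theta> j k) z + r j k (fst z) (snd z) - b j k)
        \<longlongrightarrow> b j k + 0 - b j k) (in_prob M)" .
    then show ?thesis by (simp add: \<epsilon>_def[abs_def])
  qed
  have e_lim: "(e \<longlongrightarrow> 0) (in_prob M)"
    unfolding e_def[abs_def] by (intro tendsto_null_sum tendsto_rabs_zero \<epsilon>_lim)
  have eq: "\<forall>\<^sub>F z in in_prob M. Z j z + (\<Sum>k\<in>J. b j k * D z k) = - (\<Sum>k\<in>J. \<epsilon> j k z * D z k)"
    if j: "j \<in> J" for j
    using eventually_in_prob_AE[OF expand[OF j]]
  proof eventually_elim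
    case (elim z)
    let ?s = "sqrt (real (fst z))"
    have "0 = ?s * (sample_mean (\<lambda>x. \<psi> x \<theta> j) z + (\<Sum>k\<in>J. (\<theta>\<^sub>n (fst z) (snd z) k - \<theta> k) * (b j k + \<epsilon> j k z)))"
      using elim by (simp add: sample_mean_def \<epsilon>_def)
    also have "\<dots> = Z j z + (\<Sum>k\<in>J. D z k * (b j k + \<epsilon> j k z))"
      by (simp add: Z_def D_def \<theta>_def distrib_left sum_distrib_left mult_ac)
    finally show ?case by (simp add: distrib_left sum.distrib mult.commute)
  qed
  have remainder: "\<bar>\<Sum>k\<in>J. \<epsilon> j k z * D z k\<bar> \<le> e z * N z" if "j \<in> J" for j z
  proof -
    have "\<bar>\<Sum>k\<in>J. \<epsilon> j k z * D z k\<bar> \<le> (\<Sum>k\<in>J. \<bar>\<epsilon> j k z\<bar> * \<bar>D z k\<bar>)"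
      by (rule order_trans[OF sum_abs]) (simp add: abs_mult)
    also have "\<dots> \<le> (\<Sum>k\<in>J. \<bar>\<epsilon> j k z\<bar> * N z)"
      unfolding N_def by (intro sum_mono mult_left_mono member_le_sum) auto
    also have "\<dots> = (\<Sum>k\<in>J. \<bar>\<epsilon> j k z\<bar>) * N z" by (simp add: sum_distrib_right)
    also have "\<dots> \<le> e z * N z"
      unfolding e_def using that
      by (intro mult_right_mono member_le_sum[of j J "\<lambda>j. \<Sum>k\<in>J. \<bar>\<epsilon> j k z\<bar>"])
        (auto intro!: sum_nonneg simp: N_def)
    finally show ?thesis .
  qed
  obtain C where C: "0 < C" "\<And>D. (\<Sum>k\<in>J. \<bar>D k\<bar>) \<le> C * (\<Sum>j\<in>J. \<bar>\<Sum>k\<in>J. b j k * D k\<bar>)"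
    using trivial_kernel_lower_bound[OF ker] unfolding b_def by blast
  have "((\<lambda>z. C * (real (card J) * e z)) \<longlongrightarrow> 0) (in_prob M)"
    by (intro tendsto_mult_right_zero e_lim)
  \<comment> \<open>With the factor below one half, half of \<open>N z\<close> remains after
    absorption, whence the constant \<open>2 * C\<close> below.\<close>
  then have small: "\<forall>\<^sub>F z in in_prob M. C * (real (card J) * e z) < 1 / 2"
    by (rule order_tendstoD(2)) simp
  have "\<forall>\<^sub>F z in in_prob M. \<forall>j\<in>J. Z j z + (\<Sum>k\<in>J. b j k * D z k) = - (\<Sum>k\<in>J. \<epsilon> j k z * D z k)"
    using eq by (intro eventually_ball_finite) auto
  then have "\<forall>\<^sub>F z in in_prob M. norm (N z) \<le> (2 * C) * norm (\<Sum>j\<in>J. norm (Z j z))"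
    using small
  proof eventually_elim
    case (elim z)
    have "\<bar>\<Sum>k\<in>J. b j k * D z k\<bar> \<le> \<bar>Z j z\<bar> + e z * N z" if "j \<in> J" for j
      using elim(1) remainder[OF that, of z] that by fastforce
    then have "(\<Sum>j\<in>J. \<bar>\<Sum>k\<in>J. b j k * D z k\<bar>) \<le> (\<Sum>j\<in>J. \<bar>Z j z\<bar> + e z * N z)"
      by (rule sum_mono)
    also have "\<dots> = (\<Sum>j\<in>J. \<bar>Z j z\<bar>) + real (card J) * (e z * N z)"
      by (simp add: sum.distrib)
    finally have "C * (\<Sum>j\<in>J. \<bar>\<Sum>k\<in>J. b j k * D z k\<bar>)
        \<le> C * ((\<Sum>j\<in>J. \<bar>Z j z\<bar>) + real (card J) * (e z * N z))"
      using C(1) by (intro mult_left_mono) auto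
    then have "N z \<le> C * ((\<Sum>j\<in>J. \<bar>Z j z\<bar>) + real (card J) * (e z * N z))"
      using C(2)[of "D z"] unfolding N_def by linarith
    also have "\<dots> = C * (\<Sum>j\<in>J. \<bar>Z j z\<bar>) + C * (real (card J) * e z) * N z"
      by (simp add: algebra_simps)
    also have "\<dots> \<le> C * (\<Sum>j\<in>J. \<bar>Z j z\<bar>) + 1 / 2 * N z"
      using elim(2) by (intro add_left_mono mult_right_mono) (auto simp: N_def sum_nonneg)
    finally show ?case by (simp add: sum_nonneg N_def)
  qed
  then have N_bounded: "bounded_in_prob M N"
    by (rule bounded_in_prob_dominated[where Y = "\<lambda>z. \<Sum>j\<in>J. norm (Z j z)", rotated])
      (rule bounded_in_prob_sum[OF Z_bounded])
  show "bounded_in_prob M (\<lambda>z. D z k)" if "k \<in> J" for k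
  proof (rule bounded_in_prob_dominated[OF N_bounded, where C = 1], rule always_eventually, rule allI)
    fix z
    have "\<bar>D z k\<bar> \<le> N z" unfolding N_def using that by (intro member_le_sum) auto
    then show "norm (D z k) \<le> 1 * norm (N z)" by simp
  qed
  show "((\<lambda>z. sqrt (real (fst z)) * sample_mean (\<lambda>x. \<psi> x \<theta> j) z
      + (\<Sum>k\<in>J. b j k * D z k)) \<longlongrightarrow> 0) (in_prob M)" if "j \<in> J" for j
  proof (rule Lim_null_comparison[OF _ bounded_in_probD[OF N_bounded e_lim]])
    show "\<forall>\<^sub>F z in in_prob M. norm (sqrt (real (fst z)) * sample_mean (\<lambda>x. \<psi> x \<theta> j) z
      + (\<Sum>k\<in>J. b j k * D z k)) \<le> e z * norm (N z)"
      using eq[OF that]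
    proof eventually_elim
      case (elim z)
      have "norm (N z) = N z" by (simp add: N_def sum_nonneg)
      with remainder[OF that, of z] elim show ?case by (simp add: Z_def)
    qed
  qed
qed

end

section \<open>Linearization of the completion\<close>

lemma tendsto_matrixI:
  fixes A :: "'a \<Rightarrow> real ^ 'n ^ 'm"
  assumes "\<And>i j. ((\<lambda>z. A z $ i $ j) \<longlongrightarrow> B $ i $ j) \<F>"
  shows "(A \<longlongrightarrow> B) \<F>"
  by (intro vec_tendstoI assms)

lemma matrix_norm_le_sum: "norm A \<le> (\<Sum>i\<in>UNIV. \<Sum>j\<in>UNIV. \<bar>A $ i $ j\<bar>)"
  for A :: "real ^ 'n ^ 'm"
proof -
  have "norm A \<le> (\<Sum>i\<in>UNIV. norm (A $ i))" unfolding norm_vec_def by (rule L2_set_le_sum) simp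
  also have "\<dots> \<le> (\<Sum>i\<in>UNIV. \<Sum>j\<in>UNIV. \<bar>A $ i $ j\<bar>)" by (intro sum_mono norm_le_l1_cart)
  finally show ?thesis .
qed

text \<open>Pairing the image with \<open>\<Delta>\<close> and using
  \<open>inner_congruence_pos\<close> shows injectivity on the subspace \<open>sym_graph E\<close>;
  finite dimension makes it quantitative.\<close>

lemma congruence_graph_lower_bound:
  fixes \<Sigma> :: "real ^ 'n ^ 'n"
  assumes \<Sigma>: "\<Sigma> \<in> spd"
  obtains e where "0 < e" "\<And>\<Delta>. \<Delta> \<in> sym_graph E \<Longrightarrow> e * norm \<Delta> \<le> norm (graph_part E (\<Sigma> ** \<Delta> ** \<Sigma>))"
proof -
  let ?f = "\<lambda>\<Delta>. graph_part E (\<Sigma> ** \<Delta> ** \<Sigma>)"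
  have f: "bounded_linear ?f"
    by (intro bounded_linear_compose[OF bounded_linear_graph_part]
        bounded_linear_compose[OF bounded_bilinear.bounded_linear_left[OF bounded_bilinear_matrix_mult]]
        bounded_bilinear.bounded_linear_right[OF bounded_bilinear_matrix_mult])
  have "\<forall>\<Delta>\<in>sym_graph E. ?f \<Delta> = 0 \<longrightarrow> \<Delta> = 0"
  proof (intro ballI impI, rule ccontr)
    fix \<Delta> assume \<Delta>: "\<Delta> \<in> sym_graph E" "?f \<Delta> = 0" "\<Delta> \<noteq> 0"
    have "\<Delta> \<bullet> (\<Sigma> ** \<Delta> ** \<Sigma>) = \<Delta> \<bullet> ?f \<Delta>"
      using \<Delta>(1) by (simp add: inner_graph_part sym_graph_def)
    then show False using inner_congruence_pos[OF \<Sigma> \<Sigma> \<Delta>(3)] \<Delta>(2) by simp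
  qed
  then show thesis
    using injective_imp_isometric[OF closed_subspace[OF subspace_sym_graph] subspace_sym_graph f] that
    by blast
qed

text \<open>Delta method for \<open>h_graph\<close>: only its continuity is needed, since the difference of the inverses
  solves a linear equation whose coefficients converge.\<close>

lemma plug_in_expansion:
  fixes \<Sigma> :: "real ^ 'n ^ 'n" and S :: "nat \<times> 'a \<Rightarrow> real ^ 'n ^ 'n" and s :: "nat \<times> 'a \<Rightarrow> real"
  assumes \<Sigma>: "\<Sigma> \<in> spd" and L: "matrix_inv \<Sigma> \<in> spd_graph E"
    and S: "(S \<longlongrightarrow> \<Sigma>) (in_prob M)" "\<forall>\<^sub>F z in in_prob M. S z \<in> spd"
    and bounded: "bounded_in_prob M (\<lambda>z. s z *\<^sub>R (S z - \<Sigma>))"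
  defines "\<Delta> \<equiv> \<lambda>z. s z *\<^sub>R (matrix_inv (h_graph E (S z)) - matrix_inv \<Sigma>)"
  shows "((\<lambda>z. h_graph E (S z)) \<longlongrightarrow> \<Sigma>) (in_prob M)"
    and "((\<lambda>z. graph_part E (s z *\<^sub>R (S z - \<Sigma>) + \<Sigma> ** \<Delta> z ** \<Sigma>)) \<longlongrightarrow> 0) (in_prob M)"
proof -
  let ?B = "\<lambda>z. h_graph E (S z)" and ?V = "\<lambda>z. s z *\<^sub>R (S z - \<Sigma>)"
  have "h_graph E \<Sigma> = \<Sigma>" by (rule h_graph_eqI[OF \<Sigma> \<Sigma> L refl])
  then show B: "(?B \<longlongrightarrow> \<Sigma>) (in_prob M)"
    using continuous_on_tendsto_compose[OF continuous_on_h_graph[of E] S(1) \<Sigma> S(2)] by simp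
  obtain k1 where k1: "0 < k1" "\<And>A. norm (graph_part E A) \<le> norm A * k1"
    using bounded_linear.pos_bounded[OF bounded_linear_graph_part] by blast
  obtain k2 where k2: "0 < k2" "\<And>(A :: real ^ 'n ^ 'n) (C :: real ^ 'n ^ 'n). norm (A ** C) \<le> norm A * norm C * k2"
    using bounded_bilinear.pos_bounded[OF bounded_bilinear_matrix_mult] by blast
  define c where "c = k2 * norm \<Sigma> * k2 * k1"
  have bound: "norm (graph_part E (A ** C ** \<Sigma>)) \<le> c * norm A * norm C" for A C :: "real ^ 'n ^ 'n"
  proof -
    have "norm (A ** C ** \<Sigma>) \<le> norm (A ** C) * norm \<Sigma> * k2" by (rule k2(2))
    also have "\<dots> \<le> (norm A * norm C * k2) * norm \<Sigma> * k2"
      using k2 by (intro mult_right_mono) auto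
    finally have "norm (A ** C ** \<Sigma>) * k1 \<le> (norm A * norm C * k2) * norm \<Sigma> * k2 * k1"
      using k1(1) by (intro mult_right_mono) auto
    with k1(2)[of "A ** C ** \<Sigma>"] show ?thesis by (simp add: c_def mult_ac)
  qed
  let ?R = "\<lambda>z. graph_part E (?V z + \<Sigma> ** \<Delta> z ** \<Sigma>)"
  \<comment> \<open>The completion agrees with \<open>S z\<close> on the graph, so its own rescaled
    error may replace \<open>?V z\<close> there, and the inverse identity expresses that error by
    \<open>\<Delta> z\<close>. What is left carries the factor \<open>\<Sigma> - ?B z\<close>, which
    tends to zero.\<close>
  have R: "\<forall>\<^sub>F z in in_prob M. ?R z = graph_part E ((\<Sigma> - ?B z) ** \<Delta> z ** \<Sigma>) \<and> \<Delta> z \<in> sym_graph E"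
    using S(2)
  proof eventually_elim
    case (elim z)
    have Bs: "?B z \<in> spd" by (rule h_graph_spd[OF elim])
    have "?B z - \<Sigma> = - (?B z ** (matrix_inv (?B z) - matrix_inv \<Sigma>) ** \<Sigma>)"
      using matrix_inv_diff[of "matrix_inv (?B z)" "matrix_inv \<Sigma>"] Bs \<Sigma>
      by (simp add: spd_invertible spd_inv_spd matrix_inv_matrix_inv_spd)
    then have "s z *\<^sub>R (?B z - \<Sigma>) = - (?B z ** \<Delta> z ** \<Sigma>)"
      unfolding \<Delta>_def by (simp add: scalar_matrix_assoc matrix_scalar_ac)
    moreover have "graph_part E (?V z) = graph_part E (s z *\<^sub>R (?B z - \<Sigma>))"
      using graph_part_h_graph[OF elim, of E] linear_graph_part[of E]
      by (simp add: linear_scale linear_diff)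
    ultimately have "?R z = graph_part E (\<Sigma> ** \<Delta> z ** \<Sigma> - ?B z ** \<Delta> z ** \<Sigma>)"
      using linear_graph_part[of E] by (simp add: linear_add linear_diff linear_neg)
    moreover have "matrix_inv (?B z) - matrix_inv \<Sigma> \<in> sym_graph E"
      using h_graph_inv[OF elim] L by (intro subspace_diff[OF subspace_sym_graph]) (auto simp: spd_graph_eq)
    then have "\<Delta> z \<in> sym_graph E" unfolding \<Delta>_def by (intro subspace_scale[OF subspace_sym_graph])
    ultimately show ?case
      by (simp add: bounded_bilinear.diff_left[OF bounded_bilinear_matrix_mult])
  qed
  obtain e where e: "0 < e" "\<And>\<Delta>. \<Delta> \<in> sym_graph E \<Longrightarrow> e * norm \<Delta> \<le> norm (graph_part E (\<Sigma> ** \<Delta> ** \<Sigma>))"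
    using congruence_graph_lower_bound[OF \<Sigma>] by blast
  have "((\<lambda>z. c * norm (\<Sigma> - ?B z)) \<longlongrightarrow> c * norm (\<Sigma> - \<Sigma>)) (in_prob M)"
    by (intro tendsto_intros B)
  then have B0: "((\<lambda>z. c * norm (\<Sigma> - ?B z)) \<longlongrightarrow> 0) (in_prob M)" by simp
  then have "\<forall>\<^sub>F z in in_prob M. c * norm (\<Sigma> - ?B z) < e / 2"
    using e(1) by (intro order_tendstoD(2)) auto
  \<comment> \<open>Once the coefficient is below \<open>e / 2\<close>, half of the lower bound
    survives, so \<open>\<Delta>\<close> is dominated by \<open>?V\<close>.\<close>
  with R have "\<forall>\<^sub>F z in in_prob M. norm (\<Delta> z) \<le> (2 / e * k1) * norm (?V z)"
  proof eventually_elim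
    case (elim z)
    have "graph_part E (\<Sigma> ** \<Delta> z ** \<Sigma>) = ?R z - graph_part E (?V z)"
      by (simp add: graph_part_add)
    then have "e * norm (\<Delta> z) \<le> norm (?R z - graph_part E (?V z))"
      using e(2) elim(1) by metis
    also have "\<dots> \<le> norm (?R z) + norm (graph_part E (?V z))" by (rule norm_triangle_ineq4)
    also have "\<dots> \<le> c * norm (\<Sigma> - ?B z) * norm (\<Delta> z) + norm (?V z) * k1"
      by (intro add_mono k1(2)) (simp add: elim(1) bound)
    also have "\<dots> \<le> e / 2 * norm (\<Delta> z) + norm (?V z) * k1"
      using elim(2) by (intro add_right_mono mult_right_mono) auto
    finally show ?case using e(1) by (simp add: field_simps)
  qed
  then have \<Delta>_bounded: "bounded_in_prob M \<Delta>" by (rule bounded_in_prob_dominated[OF bounded])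
  show "(?R \<longlongrightarrow> 0) (in_prob M)"
  proof (rule Lim_null_comparison[OF _ bounded_in_probD[OF \<Delta>_bounded B0]])
    show "\<forall>\<^sub>F z in in_prob M. norm (?R z) \<le> c * norm (\<Sigma> - ?B z) * norm (\<Delta> z)"
      using R by eventually_elim (simp add: bound)
  qed
qed

section \<open>Action of the derivative matrices on symmetric matrices\<close>

context M_population
begin

lemma inner_inv_congruence: "L \<bullet> (\<Sigma> ** \<Delta> ** \<Sigma>) = \<Sigma> \<bullet> \<Delta>"
proof -
  have "(\<Sigma> ** \<Delta> ** \<Sigma>) \<bullet> L = (\<Sigma> ** \<Delta>) \<bullet> (L ** \<Sigma>)"
    by (simp add: inner_matrix_mult_right spd_sym[OF S])
  also have "\<dots> = \<Delta> \<bullet> \<Sigma>"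
    by (subst inner_matrix_mult_left) (simp add: spd_sym[OF S] spd_inv_left[OF S])
  finally show ?thesis by (simp add: inner_commute)
qed

lemma op_G_op_U: "op_G \<kappa> \<Delta> = op_U \<kappa> (\<Sigma> ** \<Delta> ** \<Sigma>)"
  by (simp add: op_G_def op_U_def inner_inv_congruence)

lemma linear_op_U: "linear (op_U \<kappa>)"
  by (rule linearI) (simp_all add: op_U_def inner_add_right algebra_simps)

lemma linear_op_G: "linear (op_G \<kappa>)"
proof -
  have "linear (\<lambda>\<Delta>. \<Sigma> ** \<Delta> ** \<Sigma>)"
    by (rule linearI) (simp_all add: matrix_add_ldistrib scalar_matrix_assoc matrix_scalar_ac
        bounded_bilinear.add_left[OF bounded_bilinear_matrix_mult])
  then show ?thesis
    unfolding op_G_op_U[abs_def] using linear_op_U linear_compose[of _ "op_U \<kappa>"] by (simp add: o_def)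
qed

lemma op_U_tendsto:
  assumes "((\<lambda>z. graph_part E (R z)) \<longlongrightarrow> 0) \<F>" and d: "d \<in> graph_positions E"
  shows "((\<lambda>z. op_U \<kappa> (R z) $ fst d $ snd d) \<longlongrightarrow> 0) \<F>"
proof -
  have "{fst d, snd d} \<in> E \<or> fst d = snd d"
    using d by (auto simp: graph_positions_def insert_commute)
  then have "op_U \<kappa> (R z) $ fst d $ snd d = op_U \<kappa> (graph_part E (R z)) $ fst d $ snd d" for z
    by (auto simp: op_U_def inner_graph_part[OF L_graph] graph_part_nth)
  moreover have "((\<lambda>z. op_U \<kappa> (graph_part E (R z)) $ fst d $ snd d) \<longlongrightarrow> op_U \<kappa> 0 $ fst d $ snd d) \<F>"
    using linear_op_U by (intro tendsto_intros bounded_linear.tendsto[OF _ assms(1)])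
      (simp add: linear_conv_bounded_linear)
  ultimately show ?thesis by (simp add: op_U_def)
qed

definition \<kappa> :: real where "\<kappa> = (SOME \<kappa>. scatter_form \<kappa>)"

lemma scatter_form_kappa: "scatter_form \<kappa>"
  unfolding \<kappa>_def by (rule someI_ex[OF scatter_form_exists])

abbreviation "apply_U j m V \<equiv>
  (\<Sum>k\<in>UNIV <+> lower_triangle. \<beta>\<^sub>U j k * coordinates lower_triangle m V k)"
abbreviation "apply_G j m \<Delta> \<equiv>
  (\<Sum>k\<in>UNIV <+> graph_positions E. \<beta>\<^sub>G j k * coordinates (graph_positions E) m \<Delta> k)"

text \<open>The scatter arguments \<open>\<Delta>\<close> and \<open>V\<close> may be unrelated,
  because the coupling blocks vanish.\<close>

lemma apply_location: "apply_G (Inl i) m \<Delta> = apply_U (Inl i) m V"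
  by (simp add: sum_sum_Plus beta_cross_U beta_cross_G beta_location)

lemma apply_U_scatter:
  assumes V: "transpose V = V" and d: "d \<in> lower_triangle"
  shows "apply_U (Inr d) m V = op_U \<kappa> V $ fst d $ snd d"
proof -
  have "(\<Sum>c\<in>lower_triangle. op_U \<kappa> (unit_sym c) $ fst d $ snd d * V $ fst c $ snd c) = op_U \<kappa> V $ fst d $ snd d"
    using V linear_op_U[of \<kappa>]
    by (intro sum_coordinates[of "\<lambda>V. op_U \<kappa> V $ fst d $ snd d"])
      (auto intro!: linearI simp: linear_add linear_scale)
  then show ?thesis
    using d scatter_form_kappa by (simp add: sum_sum_Plus beta_cross_U scatter_form_def)
qed

lemma apply_G_scatter:
  assumes \<Delta>: "\<Delta> \<in> sym_graph E" and d: "d \<in> graph_positions E"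
  shows "apply_G (Inr d) m \<Delta> = op_G \<kappa> \<Delta> $ fst d $ snd d"
proof -
  have "(\<Sum>c\<in>graph_positions E. op_G \<kappa> (unit_sym c) $ fst d $ snd d * \<Delta> $ fst c $ snd c) = op_G \<kappa> \<Delta> $ fst d $ snd d"
    using \<Delta> linear_op_G[of \<kappa>] graph_positions_lower
    by (intro sum_coordinates[of "\<lambda>V. op_G \<kappa> V $ fst d $ snd d"])
      (auto intro!: linearI simp: linear_add linear_scale sym_graph_def supported_on_graph_positions)
  then show ?thesis
    using d scatter_form_kappa by (simp add: sum_sum_Plus beta_cross_G scatter_form_def)
qed

lemma coordinates_symmetric_of:
  assumes "K \<subseteq> lower_triangle" "k \<in> UNIV <+> K"
  shows "coordinates K (location_of D) (symmetric_of K D) k = D k"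
  using assms(2) by (cases k) (auto simp: location_of_def symmetric_of_def)

lemma symmetric_of_sym_graph: "symmetric_of (graph_positions E) D \<in> sym_graph E"
proof -
  let ?A = "symmetric_of (graph_positions E) D"
  have "i = j" if "(i, j) \<in> graph_positions E" "(j, i) \<in> graph_positions E" for i j
    using subsetD[OF graph_positions_lower that(1)] subsetD[OF graph_positions_lower that(2)]
    by (simp add: lower_triangle_def)
  then have "transpose ?A = ?A"
    by (auto simp: symmetric_of_def transpose_def vec_eq_iff)
  moreover have "supported_on (graph_positions E) ?A"
    by (auto simp: supported_on_def symmetric_of_def)
  ultimately show ?thesis by (simp add: sym_graph_def supported_on_graph_positions)
qed

text \<open>The kernel condition kills \<open>op_G \<kappa> \<Delta>\<close> only at graph
  positions. Positivity of the congruence by \<open>\<Sigma>\<close> forces it to vanish everywhere,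
  so \<open>m\<close> together with \<open>\<Sigma> ** \<Delta> ** \<Sigma>\<close> lies in the
  kernel of the unconstrained matrix.\<close>

lemma graphical_kernel:
  assumes ker: "trivial_kernel (UNIV <+> lower_triangle) \<beta>\<^sub>U"
  shows "trivial_kernel (UNIV <+> graph_positions E) \<beta>\<^sub>G"
  unfolding trivial_kernel_def
proof (intro allI impI ballI)
  fix D :: "'p + 'p \<times> 'p \<Rightarrow> real" and k :: "'p + 'p \<times> 'p"
  assume D: "\<forall>j\<in>UNIV <+> graph_positions E. (\<Sum>k\<in>UNIV <+> graph_positions E. \<beta>\<^sub>G j k * D k) = 0"
    and k: "k \<in> UNIV <+> graph_positions E"
  define m where "m = location_of D"
  define \<Delta> where "\<Delta> = symmetric_of (graph_positions E) D"
  have \<Delta>: "\<Delta> \<in> sym_graph E" unfolding \<Delta>_def by (rule symmetric_of_sym_graph)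
  have coord: "coordinates (graph_positions E) m \<Delta> k = D k" if "k \<in> UNIV <+> graph_positions E" for k
    unfolding m_def \<Delta>_def using that by (rule coordinates_symmetric_of[OF graph_positions_lower])
  have D': "apply_G j m \<Delta> = 0"
    if "j \<in> UNIV <+> graph_positions E" for j
    using bspec[OF D that] by (simp add: coord cong: sum.cong)
  define V where "V = \<Sigma> ** \<Delta> ** \<Sigma>"
  have V: "transpose V = V"
    using \<Delta> by (simp add: V_def sym_graph_def matrix_transpose_mul spd_sym[OF S] matrix_mul_assoc)
  have V_eq: "op_U \<kappa> V = 0"
  proof -
    \<comment> \<open>\<open>T\<close> is \<open>- op_G \<kappa> \<Delta>\<close> with the
      congruence by \<open>\<Sigma>\<close> undone. It is supported on the graph because
      \<open>\<Delta>\<close> and \<open>L\<close> are, and hence orthogonal to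
      \<open>op_G \<kappa> \<Delta>\<close>, whose graph part vanishes.\<close>
    define T where "T = (1 + 2 * \<kappa>) *\<^sub>R \<Delta> + (\<kappa> * (\<Sigma> \<bullet> \<Delta>)) *\<^sub>R L"
    have T: "T \<in> sym_graph E"
      unfolding T_def using \<Delta> K
      by (intro subspace_add[OF subspace_sym_graph] subspace_scale[OF subspace_sym_graph]) (auto simp: spd_graph_eq)
    have \<Sigma>T: "\<Sigma> ** T ** \<Sigma> = - op_G \<kappa> \<Delta>"
      unfolding T_def op_G_def
      by (simp add: matrix_add_ldistrib spd_inv_right[OF S]
          bounded_bilinear.add_left[OF bounded_bilinear_matrix_mult]
          bounded_bilinear.scaleR_left[OF bounded_bilinear_matrix_mult]
          bounded_bilinear.scaleR_right[OF bounded_bilinear_matrix_mult])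
    have "op_G \<kappa> \<Delta> $ i $ j = 0" if "(i, j) \<in> graph_positions E" for i j
      using apply_G_scatter[OF \<Delta> that, of m] D'[of "Inr (i, j)"] that by simp
    moreover have "transpose (op_G \<kappa> \<Delta>) = op_G \<kappa> \<Delta>"
      unfolding op_G_op_U V_def[symmetric] using V spd_sym[OF S]
      by (simp add: op_U_def transpose_def vec_eq_iff)
    ultimately have "op_G \<kappa> \<Delta> $ i $ j = 0" if "{i, j} \<in> E \<or> i = j" for i j
      using that sym_nth[of "op_G \<kappa> \<Delta>" j i]
      by (cases i j rule: linorder_cases) (auto simp: graph_positions_def insert_commute)
    then have "graph_part E (op_G \<kappa> \<Delta>) = 0" by (simp add: vec_eq_iff graph_part_nth)
    then have "T \<bullet> (\<Sigma> ** T ** \<Sigma>) = 0"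
      using inner_graph_part[of E T "op_G \<kappa> \<Delta>"] T unfolding \<Sigma>T by (simp add: sym_graph_def)
    then have "T = 0" using inner_congruence_pos[OF S S, of T] by force
    then show ?thesis using \<Sigma>T by (simp add: op_G_op_U V_def)
  qed
  have ker': "coordinates lower_triangle m V j = 0" if "j \<in> UNIV <+> lower_triangle" for j
  proof (rule ker[unfolded trivial_kernel_def, rule_format, OF _ that])
    fix j :: "'p + 'p \<times> 'p" assume j: "j \<in> UNIV <+> lower_triangle"
    show "apply_U j m V = 0"
    proof (cases j)
      case (Inl i)
      then show ?thesis using apply_location[of i m \<Delta> V] D'[of "Inl i"] by simp
    next
      case (Inr d)
      then show ?thesis using apply_U_scatter[OF V, of d m] j V_eq by simp
    qed
  qed
  have "m $ i = 0" for i using ker'[of "Inl i"] by simp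
  then have "m = 0" by (simp add: vec_eq_iff)
  have "V $ i $ j = 0" for i j
    using ker'[of "Inr (i, j)"] ker'[of "Inr (j, i)"] sym_nth[OF V, of i j]
    by (cases "j \<le> i") (auto simp: lower_triangle_def)
  then have "V = 0" by (simp add: vec_eq_iff)
  then have "\<Delta> = 0" using inner_congruence_pos[OF S S, of \<Delta>] unfolding V_def by force
  with \<open>m = 0\<close> coord[OF k] k show "D k = 0" by (cases k) auto
qed

end


section \<open>The plug-in and the graphical estimators\<close>

lemma sum_outer_nth:
  "((1 / real n) *\<^sub>R (\<Sum>i<n. w i *\<^sub>R outer (y i))) $ j $ k = (1 / real n) * (\<Sum>i<n. w i * (y i $ j * y i $ k))"
  by (simp add: outer_def)

lemma mean_minus_const:
  "0 < n \<Longrightarrow> (1 / real n) * (\<Sum>i<n. f i - a) = (1 / real n) * (\<Sum>i<n. f i) - a"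
  "0 < n \<Longrightarrow> (1 / real n) * (\<Sum>i<n. a - f i) = a - (1 / real n) * (\<Sum>i<n. f i)"
  by (simp_all add: sum_subtractf field_simps)

lemma borel_measurable_coordinates:
  assumes m: "m \<in> borel_measurable M" and A: "A \<in> borel_measurable M" and j: "j \<in> UNIV <+> K"
  shows "(\<lambda>\<omega>. coordinates K (m \<omega>) (A \<omega>) j) \<in> borel_measurable M"
proof (cases j)
  case (Inr c)
  then have "c \<in> K" using j by simp
  have "(\<lambda>\<omega>. A \<omega> $ fst c $ snd c) \<in> borel_measurable M"
    by (rule borel_measurable_continuous_on[OF _ A]) (intro continuous_intros)
  then show ?thesis using \<open>c \<in> K\<close> by (simp add: Inr)
qed (use m in \<open>simp add: borel_measurable_vec_nth\<close>)

lemma borel_measurable_continuous_on_spd: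
  fixes f :: "real ^ 'n ^ 'n \<Rightarrow> 'b::topological_space"
  assumes f: "continuous_on spd f" and A: "A \<in> borel_measurable M" "\<And>\<omega>. \<omega> \<in> space M \<Longrightarrow> A \<omega> \<in> spd"
  shows "(\<lambda>\<omega>. f (A \<omega>)) \<in> borel_measurable M"
proof -
  have "A \<in> measurable M (restrict_space borel spd)"
    using A by (intro measurable_restrict_space2) auto
  then show ?thesis
    by (rule measurable_compose[OF _ borel_measurable_continuous_on_restrict[OF f]])
qed

lemma unconstrained_solution_sequence:
  fixes \<mu>\<^sub>n :: "nat \<Rightarrow> 'a \<Rightarrow> real ^ 'p::{finite,linorder}"
  assumes est: "estimator_sequence M X (M_equations u\<^sub>1 u\<^sub>2) \<mu>\<^sub>n S\<^sub>n"
  shows "solution_sequence M X (UNIV <+> lower_triangle) unconstrained_params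
    (unconstrained_psi u\<^sub>1 u\<^sub>2) (\<lambda>n \<omega>. coordinates lower_triangle (\<mu>\<^sub>n n \<omega>) (S\<^sub>n n \<omega>))"
  unfolding solution_sequence_def
proof (intro conjI allI ballI)
  note est' = est[unfolded estimator_sequence_def]
  show "(\<lambda>\<omega>. coordinates lower_triangle (\<mu>\<^sub>n n \<omega>) (S\<^sub>n n \<omega>) j) \<in> borel_measurable M"
    if "j \<in> UNIV <+> lower_triangle" for n j
    using est' that by (intro borel_measurable_coordinates) auto
  show "coordinates lower_triangle (\<mu>\<^sub>n n \<omega>) (S\<^sub>n n \<omega>) \<in> unconstrained_params" if "\<omega> \<in> space M" for n \<omega>
    unfolding unconstrained_params_def using est' that by blast
  have "\<forall>\<^sub>F n in sequentially. AE \<omega> in M. M_equations u\<^sub>1 u\<^sub>2 n (\<lambda>i. X i \<omega>) (\<mu>\<^sub>n n \<omega>) (S\<^sub>n n \<omega>)"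
    using est' by blast
  then show "\<forall>\<^sub>F n in sequentially. AE \<omega> in M. \<forall>j\<in>UNIV <+> lower_triangle.
      1 / real n * (\<Sum>i<n. unconstrained_psi u\<^sub>1 u\<^sub>2 (X i \<omega>) (coordinates lower_triangle (\<mu>\<^sub>n n \<omega>) (S\<^sub>n n \<omega>)) j) = 0"
    using eventually_gt_at_top[of 0]
  proof eventually_elim
    case (elim n)
    show ?case
      using elim(1) AE_space
    proof eventually_elim
      case (elim \<omega>)
      let ?m = "\<mu>\<^sub>n n \<omega>" and ?S = "S\<^sub>n n \<omega>"
      have S: "?S \<in> spd" using est' elim(2) by blast
      have sym: "symmetric_of lower_triangle (coordinates lower_triangle ?m ?S) = ?S"
        by (simp add: symmetric_of_coordinates spd_sym[OF S])
      have eq1: "0 = (\<Sum>i<n. u\<^sub>1 (mahalanobis ?m ?S (X i \<omega>)) *\<^sub>R (X i \<omega> - ?m))"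
        and eq2: "?S = (1 / real n) *\<^sub>R (\<Sum>i<n. u\<^sub>2 (mahalanobis ?m ?S (X i \<omega>)) *\<^sub>R outer (X i \<omega> - ?m))"
        using elim(1) unfolding M_equations_def by blast+
      have "(\<Sum>i<n. u\<^sub>1 (mahalanobis ?m ?S (X i \<omega>)) * (X i \<omega> - ?m) $ k) = 0" for k
        using arg_cong[OF eq1, of "\<lambda>v. v $ k"] by simp
      moreover have "1 / real n * (\<Sum>i<n. u\<^sub>2 (mahalanobis ?m ?S (X i \<omega>)) * ((X i \<omega> - ?m) $ fst c * (X i \<omega> - ?m) $ snd c) - ?S $ fst c $ snd c) = 0" for c
        using arg_cong[OF eq2, of "\<lambda>A. A $ fst c $ snd c"]
        unfolding sum_outer_nth mean_minus_const[OF \<open>0 < n\<close>] by simp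
      ultimately show ?case
        unfolding ball_Plus
        by (auto simp only: unconstrained_psi_Inl unconstrained_psi_Inr sym location_of_coordinates mult_zero_right)
    qed
  qed
qed

text \<open>Solution sequences must lie in the parameter set at every outcome and sample size, but
  the inverse of the estimator has the right zeros only where the equations hold. The default
  \<open>L\<close> fills the remaining cases and is eventually almost surely absent.\<close>

lemma graphical_solution_sequence:
  fixes \<mu>\<^sub>M :: "nat \<Rightarrow> 'a \<Rightarrow> real ^ 'p::{finite,linorder}"
  assumes est: "estimator_sequence M X (graphical_M_equations E u\<^sub>1 u\<^sub>2) \<mu>\<^sub>M S\<^sub>M"
    and L: "L \<in> spd_graph E"
  defines "K \<equiv> \<lambda>n \<omega>. if matrix_inv (S\<^sub>M n \<omega>) \<in> spd_graph E then matrix_inv (S\<^sub>M n \<omega>) else L"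
  shows "solution_sequence M X (UNIV <+> graph_positions E) (graphical_params E)
      (graphical_psi E u\<^sub>1 u\<^sub>2) (\<lambda>n \<omega>. coordinates (graph_positions E) (\<mu>\<^sub>M n \<omega>) (K n \<omega>))"
    and "\<forall>\<^sub>F n in sequentially. AE \<omega> in M. K n \<omega> = matrix_inv (S\<^sub>M n \<omega>)"
proof -
  note est' = est[unfolded estimator_sequence_def]
  have Kg: "K n \<omega> \<in> spd_graph E" for n \<omega> using L by (simp add: K_def)
  have eqs: "\<forall>\<^sub>F n in sequentially. AE \<omega> in M. graphical_M_equations E u\<^sub>1 u\<^sub>2 n (\<lambda>i. X i \<omega>) (\<mu>\<^sub>M n \<omega>) (S\<^sub>M n \<omega>)"
    using est' by blast
  have K_eq: "K n \<omega> = matrix_inv (S\<^sub>M n \<omega>)"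
    if "\<omega> \<in> space M" "graphical_M_equations E u\<^sub>1 u\<^sub>2 n (\<lambda>i. X i \<omega>) (\<mu>\<^sub>M n \<omega>) (S\<^sub>M n \<omega>)" for n \<omega>
  proof -
    have "matrix_inv (S\<^sub>M n \<omega>) \<in> spd" using est' that(1) by (intro spd_inv_spd) blast
    then have "matrix_inv (S\<^sub>M n \<omega>) \<in> spd_graph E"
      using that(2) by (simp add: spd_graph_def graphical_M_equations_def)
    then show ?thesis by (simp add: K_def)
  qed
  show "\<forall>\<^sub>F n in sequentially. AE \<omega> in M. K n \<omega> = matrix_inv (S\<^sub>M n \<omega>)"
    using eqs
  proof eventually_elim
    case (elim n)
    then show ?case using AE_space by eventually_elim (rule K_eq)
  qed
  have inv_meas: "(\<lambda>\<omega>. matrix_inv (S\<^sub>M n \<omega>)) \<in> borel_measurable M" for n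
    using est' by (intro borel_measurable_continuous_on_spd[OF continuous_on_matrix_inv_spd]) auto
  have "spd_graph E \<in> sets borel"
    unfolding spd_graph_eq
    by (intro sets.Int spd_borel borel_closed closed_subspace[OF subspace_sym_graph])
  then have K_meas: "K n \<in> borel_measurable M" for n
    unfolding K_def
    by (intro measurable_If inv_meas measurable_const)
      (auto intro!: measurable_sets_Collect[OF inv_meas] simp: pred_def)
  show "solution_sequence M X (UNIV <+> graph_positions E) (graphical_params E)
      (graphical_psi E u\<^sub>1 u\<^sub>2) (\<lambda>n \<omega>. coordinates (graph_positions E) (\<mu>\<^sub>M n \<omega>) (K n \<omega>))"
    unfolding solution_sequence_def
  proof (intro conjI allI ballI)
    show "(\<lambda>\<omega>. coordinates (graph_positions E) (\<mu>\<^sub>M n \<omega>) (K n \<omega>) j) \<in> borel_measurable M"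
      if "j \<in> UNIV <+> graph_positions E" for n j
      using est' that K_meas by (intro borel_measurable_coordinates) auto
    show "coordinates (graph_positions E) (\<mu>\<^sub>M n \<omega>) (K n \<omega>) \<in> graphical_params E" for n \<omega>
      using Kg by (auto simp: graphical_params_def)
    show "\<forall>\<^sub>F n in sequentially. AE \<omega> in M. \<forall>j\<in>UNIV <+> graph_positions E.
        1 / real n * (\<Sum>i<n. graphical_psi E u\<^sub>1 u\<^sub>2 (X i \<omega>) (coordinates (graph_positions E) (\<mu>\<^sub>M n \<omega>) (K n \<omega>)) j) = 0"
      using eqs eventually_gt_at_top[of 0]
    proof eventually_elim
      case (elim n)
      show ?case
        using elim(1) AE_space
      proof eventually_elim
        case (elim \<omega>)
        let ?m = "\<mu>\<^sub>M n \<omega>" and ?S = "S\<^sub>M n \<omega>" and ?\<theta> = "coordinates (graph_positions E) (\<mu>\<^sub>M n \<omega>) (K n \<omega>)"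
        have S: "?S \<in> spd" using est' elim(2) by blast
        have "symmetric_of (graph_positions E) ?\<theta> = K n \<omega>"
          using Kg[of n \<omega>] by (simp add: symmetric_of_coordinates supported_on_graph_positions spd_graph_eq sym_graph_def)
        then have sym: "symmetric_of (graph_positions E) ?\<theta> = matrix_inv ?S"
          using K_eq elim by simp
        have eq1: "0 = (\<Sum>i<n. u\<^sub>1 (mahalanobis ?m ?S (X i \<omega>)) *\<^sub>R (X i \<omega> - ?m))"
          and eq2: "\<And>j k. {j, k} \<in> E \<or> j = k \<Longrightarrow> ?S $ j $ k =
            ((1 / real n) *\<^sub>R (\<Sum>i<n. u\<^sub>2 (mahalanobis ?m ?S (X i \<omega>)) *\<^sub>R outer (X i \<omega> - ?m))) $ j $ k"
          using elim(1) unfolding graphical_M_equations_def by blast+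
        have "(\<Sum>i<n. u\<^sub>1 (mahalanobis ?m ?S (X i \<omega>)) * (X i \<omega> - ?m) $ k) = 0" for k
          using arg_cong[OF eq1, of "\<lambda>v. v $ k"] by simp
        moreover have "1 / real n * (\<Sum>i<n. ?S $ fst c $ snd c
            - u\<^sub>2 (mahalanobis ?m ?S (X i \<omega>)) * ((X i \<omega> - ?m) $ fst c * (X i \<omega> - ?m) $ snd c)) = 0"
          if "c \<in> graph_positions E" for c
        proof -
          have "{fst c, snd c} \<in> E \<or> fst c = snd c"
            using that by (auto simp: graph_positions_def insert_commute)
          from eq2[OF this] show ?thesis
            unfolding sum_outer_nth mean_minus_const[OF \<open>0 < n\<close>] by simp
        qed
        ultimately show ?case
          unfolding ball_Plus
          by (auto simp only: graphical_psi_Inl graphical_psi_Inr sym location_of_coordinates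
              matrix_inv_matrix_inv_spd[OF S] mahalanobis_def[symmetric] mult_zero_right)
      qed
    qed
  qed
qed

lemma invertible_on_trivial_kernel:
  fixes b :: "'i::finite \<Rightarrow> 'i \<Rightarrow> real"
  assumes "invertible_on J b"
  shows "trivial_kernel J b"
  unfolding trivial_kernel_def
proof (intro allI impI ballI)
  fix D k assume D: "\<forall>j\<in>J. (\<Sum>k\<in>J. b j k * D k) = 0" and k: "k \<in> J"
  obtain c where c: "\<And>i j. i \<in> J \<Longrightarrow> j \<in> J \<Longrightarrow> (\<Sum>k\<in>J. c i k * b k j) = (if i = j then 1 else 0)"
    using assms unfolding invertible_on_def by blast
  have "D k = (\<Sum>j\<in>J. (if k = j then 1 else 0) * D j)"
    using k by (simp add: if_distrib[of "\<lambda>x. x * _"] cong: if_cong)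
  also have "\<dots> = (\<Sum>j\<in>J. (\<Sum>l\<in>J. c k l * b l j) * D j)"
    using c[OF k] by (intro sum.cong refl) simp
  also have "\<dots> = (\<Sum>l\<in>J. c k l * (\<Sum>j\<in>J. b l j * D j))"
    by (simp add: sum_distrib_left sum_distrib_right mult.assoc) (rule sum.swap)
  also have "\<dots> = 0" using D by simp
  finally show "D k = 0" .
qed

lemma tendsto_symmetric_matrix:
  fixes A :: "'z \<Rightarrow> real ^ 'p::{finite,linorder} ^ 'p::{finite,linorder}"
  assumes ev: "\<forall>\<^sub>F z in \<F>. transpose (A z) = A z \<and> supported_on K (A z)"
    and B: "transpose B = B" "supported_on K B"
    and lim: "\<And>c. c \<in> K \<Longrightarrow> ((\<lambda>z. A z $ fst c $ snd c) \<longlongrightarrow> B $ fst c $ snd c) \<F>"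
  shows "(A \<longlongrightarrow> B) \<F>"
proof (rule tendsto_matrixI)
  fix i j
  consider "(i, j) \<in> K" | "(j, i) \<in> K" | "(i, j) \<notin> K" "(j, i) \<notin> K" by blast
  then show "((\<lambda>z. A z $ i $ j) \<longlongrightarrow> B $ i $ j) \<F>"
  proof cases
    case 1
    then show ?thesis using lim[of "(i, j)"] by simp
  next
    case 2
    have "\<forall>\<^sub>F z in \<F>. A z $ j $ i = A z $ i $ j"
      using ev by (rule eventually_mono) (blast intro: sym_nth)
    with lim[OF 2] sym_nth[OF B(1), of i j] show ?thesis
      by (auto intro: Lim_transform_eventually)
  next
    case 3
    have "\<forall>\<^sub>F z in \<F>. 0 = A z $ i $ j"
      using ev by (rule eventually_mono) (use 3 in \<open>auto simp: supported_on_def\<close>)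
    moreover have "B $ i $ j = 0" using B(2) 3 by (auto simp: supported_on_def)
    ultimately show ?thesis by (auto intro: Lim_transform_eventually)
  qed
qed

lemma linear_vec_mat: "linear vec_mat"
  by (rule linearI) (simp_all add: vec_mat_def vec_eq_iff)

theorem theorem11:
  fixes M :: "'a measure"
    and X :: "nat \<Rightarrow> 'a \<Rightarrow> real ^ 'p::{finite,linorder}"
    and E :: "'p::{finite,linorder} set set"
    and \<mu> :: "real ^ 'p::{finite,linorder}" and S :: "real ^ 'p::{finite,linorder} ^ 'p::{finite,linorder}" and g :: "real \<Rightarrow> real"
    and u\<^sub>1 u\<^sub>2 :: "real \<Rightarrow> real"
    and \<mu>\<^sub>n \<mu>\<^sub>M :: "nat \<Rightarrow> 'a \<Rightarrow> real ^ 'p::{finite,linorder}"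
    and S\<^sub>n S\<^sub>M :: "nat \<Rightarrow> 'a \<Rightarrow> real ^ 'p::{finite,linorder} ^ 'p::{finite,linorder}"
  assumes "prob_space M"
    and "simple_graph E"
    and "S \<in> spd" and "matrix_inv S \<in> spd_graph E"
    and "\<And>s. 0 \<le> s \<Longrightarrow> 0 \<le> g s"
    and "prob_space.indep_vars M (\<lambda>_. borel) X UNIV"
    and "\<And>i. distributed M lborel (X i) (\<lambda>x. ennreal (elliptical_density \<mu> S g x))"
    and "monotonicity_conditions u\<^sub>1 u\<^sub>2"
    and "M_estimation_regular M X (elliptical \<mu> S g)
           (UNIV <+> lower_triangle) unconstrained_params (unconstrained_psi u\<^sub>1 u\<^sub>2)"
    and "M_estimation_regular M X (elliptical \<mu> S g)
           (UNIV <+> graph_positions E) (graphical_params E) (graphical_psi E u\<^sub>1 u\<^sub>2)"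
    and nondegenerate: "invertible_on (UNIV <+> lower_triangle)
           (b_matrix (elliptical \<mu> S g) (UNIV <+> lower_triangle)
              unconstrained_params (unconstrained_psi u\<^sub>1 u\<^sub>2))"
    and "estimator_sequence M X (M_equations u\<^sub>1 u\<^sub>2) \<mu>\<^sub>n S\<^sub>n"
    and "estimator_sequence M X (graphical_M_equations E u\<^sub>1 u\<^sub>2) \<mu>\<^sub>M S\<^sub>M"
  shows "tendsto_in_prob M
           (\<lambda>n \<omega>. sqrt (real n) *\<^sub>R
              ((\<mu>\<^sub>n n \<omega>, vec_mat (h_graph E (S\<^sub>n n \<omega>))) - (\<mu>\<^sub>M n \<omega>, vec_mat (S\<^sub>M n \<omega>))))
           0"
proof -
  interpret prob_space M by (rule assms(1))
  let ?F = "elliptical \<mu> S g"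
  let ?JU = "UNIV <+> lower_triangle :: ('p + 'p \<times> 'p) set"
  let ?JG = "UNIV <+> graph_positions E :: ('p + 'p \<times> 'p) set"
  let ?\<F> = "in_prob M"
  define s :: "nat \<times> 'a \<Rightarrow> real" where "s z = sqrt (real (fst z))" for z
  have distr: "distr M borel (X i) = ?F" for i
    using distributed_distr_eq_density[OF assms(7), of i]
    by (simp add: elliptical_def cong: distr_cong)
  interpret I: iid_sample M X ?F
    by unfold_locales (rule assms(6), rule distr)
  have "elliptical_law ?F \<mu> S"
    using distributed_borel_measurable[OF assms(7)]
    by (intro elliptical_law_elliptical assms(3) I.prob_space_F) simp
  note regU = assms(9)[unfolded M_estimation_regular_def Let_def]
  note regG = assms(10)[unfolded M_estimation_regular_def Let_def]
  obtain \<eta> where \<eta>: "0 < \<eta>" and \<theta>U: "theta_F ?F ?JU unconstrained_params (unconstrained_psi u\<^sub>1 u\<^sub>2)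
      = coordinates lower_triangle \<mu> (\<eta> *\<^sub>R S)"
    using unconstrained_theta_F[OF \<open>elliptical_law ?F \<mu> S\<close> regU[THEN conjunct1]] by blast
  define \<Sigma> where "\<Sigma> = \<eta> *\<^sub>R S"
  note \<theta>U = \<theta>U[folded \<Sigma>_def]
  have \<Sigma>: "\<Sigma> \<in> spd" unfolding \<Sigma>_def by (rule scaleR_spd[OF assms(3) \<eta>])
  \<comment> \<open>From here on \<open>\<Sigma>\<close> takes the place of \<open>S\<close>; a
    positive factor does not change the reflections.\<close>
  have law: "elliptical_law ?F \<mu> \<Sigma>"
    unfolding \<Sigma>_def by (rule elliptical_law.elliptical_law_scaleR) fact+
  have K: "matrix_inv \<Sigma> \<in> spd_graph E"
    using assms(4) \<eta> spd_inv_spd[OF \<Sigma>] subspace_scale[OF subspace_sym_graph]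
    unfolding \<Sigma>_def matrix_inv_scaleR[OF assms(3) less_imp_neq[OF \<eta>, symmetric]] spd_graph_eq by blast
  have "population_solution ?F ?JU unconstrained_params (unconstrained_psi u\<^sub>1 u\<^sub>2) (coordinates lower_triangle \<mu> \<Sigma>)"
    unfolding \<theta>U[symmetric] theta_F_def by (rule theI'[OF regU[THEN conjunct1]])
  note \<theta>G = graphical_theta_F[OF \<Sigma> K this regG[THEN conjunct1]]
  note momentsU = regU[THEN conjunct2, THEN conjunct2, THEN conjunct2, rule_format, unfolded \<theta>U]
  note momentsG = regG[THEN conjunct2, THEN conjunct2, THEN conjunct2, rule_format, unfolded \<theta>G]
  interpret P: M_population ?F \<mu> \<Sigma> E u\<^sub>1 u\<^sub>2 "coordinates lower_triangle \<mu> \<Sigma>"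
      "coordinates (graph_positions E) \<mu> (matrix_inv \<Sigma>)"
    by (rule M_population.intro[OF law], rule M_population_axioms.intro[OF K])
      (rule momentsU[THEN conjunct1] momentsU[THEN conjunct2, THEN conjunct1]
        momentsG[THEN conjunct1] momentsG[THEN conjunct2, THEN conjunct1]; assumption)+
  have bU: "b_matrix ?F ?JU unconstrained_params (unconstrained_psi u\<^sub>1 u\<^sub>2) = P.\<beta>\<^sub>U"
    unfolding b_matrix_def \<theta>U by simp
  have bG: "b_matrix ?F ?JG (graphical_params E) (graphical_psi E u\<^sub>1 u\<^sub>2) = P.\<beta>\<^sub>G"
    unfolding b_matrix_def \<theta>G by simp
  have kerU: "trivial_kernel ?JU P.\<beta>\<^sub>U"
    using invertible_on_trivial_kernel[OF nondegenerate] unfolding bU .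
  have kerG: "trivial_kernel ?JG P.\<beta>\<^sub>G" by (rule P.graphical_kernel[OF kerU])

  define K\<^sub>M where "K\<^sub>M n \<omega> = (if matrix_inv (S\<^sub>M n \<omega>) \<in> spd_graph E then matrix_inv (S\<^sub>M n \<omega>) else matrix_inv \<Sigma>)" for n \<omega>
  note seqU = unconstrained_solution_sequence[OF assms(12)]
  note seqG = graphical_solution_sequence(1)[OF assms(13) K, folded K\<^sub>M_def]
  note K\<^sub>M_eq = graphical_solution_sequence(2)[OF assms(13) K, folded K\<^sub>M_def]
  note expandU = I.regular_expansion[OF assms(9) seqU kerU[folded bU], unfolded bU \<theta>U]
  note expandG = I.regular_expansion[OF assms(10) seqG kerG[folded bG], unfolded bG \<theta>G]
  have limU: "((\<lambda>z. coordinates lower_triangle (\<mu>\<^sub>n (fst z) (snd z)) (S\<^sub>n (fst z) (snd z)) j)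
      \<longlongrightarrow> coordinates lower_triangle \<mu> \<Sigma> j) ?\<F>" if "j \<in> ?JU" for j
    using regU[THEN conjunct2, THEN conjunct1, rule_format, OF seqU that] unfolding \<theta>U by (rule tendsto_in_probD)
  have limG: "((\<lambda>z. coordinates (graph_positions E) (\<mu>\<^sub>M (fst z) (snd z)) (K\<^sub>M (fst z) (snd z)) j)
      \<longlongrightarrow> coordinates (graph_positions E) \<mu> (matrix_inv \<Sigma>) j) ?\<F>" if "j \<in> ?JG" for j
    using regG[THEN conjunct2, THEN conjunct1, rule_format, OF seqG that] unfolding \<theta>G by (rule tendsto_in_probD)

  define SU where "SU z = S\<^sub>n (fst z) (snd z)" for z
  define KG where "KG z = K\<^sub>M (fst z) (snd z)" for z
  define mU where "mU z = s z *\<^sub>R (\<mu>\<^sub>n (fst z) (snd z) - \<mu>)" for z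
  define mG where "mG z = s z *\<^sub>R (\<mu>\<^sub>M (fst z) (snd z) - \<mu>)" for z
  define V where "V z = s z *\<^sub>R (SU z - \<Sigma>)" for z
  define \<Delta>P where "\<Delta>P z = s z *\<^sub>R (matrix_inv (h_graph E (SU z)) - matrix_inv \<Sigma>)" for z
  define \<Delta>G where "\<Delta>G z = s z *\<^sub>R (KG z - matrix_inv \<Sigma>)" for z
  have SU_spd: "\<forall>\<^sub>F z in ?\<F>. SU z \<in> spd"
    unfolding SU_def using assms(12) by (intro eventually_in_prob_space) (simp add: estimator_sequence_def)
  have KG_graph: "KG z \<in> spd_graph E" for z using K by (simp add: KG_def K\<^sub>M_def)
  have KG_eq: "\<forall>\<^sub>F z in ?\<F>. S\<^sub>M (fst z) (snd z) \<in> spd \<and> KG z = matrix_inv (S\<^sub>M (fst z) (snd z))"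
  proof -
    have "\<forall>\<^sub>F z in ?\<F>. S\<^sub>M (fst z) (snd z) \<in> spd"
      using assms(13) by (intro eventually_in_prob_space) (simp add: estimator_sequence_def)
    then show ?thesis
      using eventually_in_prob_AE[OF K\<^sub>M_eq] by eventually_elim (simp add: KG_def)
  qed
  have coordU: "s z * (coordinates lower_triangle (\<mu>\<^sub>n (fst z) (snd z)) (S\<^sub>n (fst z) (snd z)) k
      - coordinates lower_triangle \<mu> \<Sigma> k) = coordinates lower_triangle (mU z) (V z) k" if "k \<in> ?JU" for z k
    using that by (cases k) (auto simp: mU_def V_def SU_def)
  have coordG: "s z * (coordinates (graph_positions E) (\<mu>\<^sub>M (fst z) (snd z)) (K\<^sub>M (fst z) (snd z)) k
      - coordinates (graph_positions E) \<mu> (matrix_inv \<Sigma>) k) = coordinates (graph_positions E) (mG z) (\<Delta>G z) k"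
    if "k \<in> ?JG" for z k
    using that by (cases k) (auto simp: mG_def \<Delta>G_def KG_def)
  let ?Z = "\<lambda>j z. s z * I.sample_mean (\<lambda>x. unconstrained_psi u\<^sub>1 u\<^sub>2 x (coordinates lower_triangle \<mu> \<Sigma>) j) z"
  let ?ZG = "\<lambda>j z. s z * I.sample_mean (\<lambda>x. graphical_psi E u\<^sub>1 u\<^sub>2 x (coordinates (graph_positions E) \<mu> (matrix_inv \<Sigma>)) j) z"
  have U: "((\<lambda>z. ?Z j z + P.apply_U j (mU z) (V z)) \<longlongrightarrow> 0) ?\<F>"
    if "j \<in> ?JU" for j
    using expandU(2)[OF that] by (simp add: s_def[symmetric] coordU cong: sum.cong)
  have G: "((\<lambda>z. ?ZG j z + P.apply_G j (mG z) (\<Delta>G z)) \<longlongrightarrow> 0) ?\<F>"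
    if "j \<in> ?JG" for j
    using expandG(2)[OF that] by (simp add: s_def[symmetric] coordG cong: sum.cong)

  have SU_lim: "(SU \<longlongrightarrow> \<Sigma>) ?\<F>"
  proof (rule tendsto_symmetric_matrix[where K = lower_triangle])
    show "\<forall>\<^sub>F z in ?\<F>. transpose (SU z) = SU z \<and> supported_on lower_triangle (SU z)"
      using SU_spd by eventually_elim (simp add: spd_sym)
    show "((\<lambda>z. SU z $ fst c $ snd c) \<longlongrightarrow> \<Sigma> $ fst c $ snd c) ?\<F>" if "c \<in> lower_triangle" for c
      using limU[of "Inr c"] that by (simp add: SU_def)
  qed (simp_all add: spd_sym[OF \<Sigma>])
  have sym_graph_iff: "A \<in> sym_graph E \<longleftrightarrow> transpose A = A \<and> supported_on (graph_positions E) A" for A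
    by (simp add: sym_graph_def supported_on_graph_positions)
  have KG_lim: "(KG \<longlongrightarrow> matrix_inv \<Sigma>) ?\<F>"
  proof (rule tendsto_symmetric_matrix[where K = "graph_positions E"])
    show "\<forall>\<^sub>F z in ?\<F>. transpose (KG z) = KG z \<and> supported_on (graph_positions E) (KG z)"
      using KG_graph by (simp add: spd_graph_eq sym_graph_iff)
    show "((\<lambda>z. KG z $ fst c $ snd c) \<longlongrightarrow> matrix_inv \<Sigma> $ fst c $ snd c) ?\<F>" if "c \<in> graph_positions E" for c
      using limG[of "Inr c"] that by (simp add: KG_def)
  qed (use K in \<open>simp_all add: spd_graph_eq sym_graph_iff\<close>)
  have V_sym: "\<forall>\<^sub>F z in ?\<F>. transpose (V z) = V z"
    using SU_spd
  proof eventually_elim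
    case (elim z)
    from spd_sym[OF this] spd_sym[OF \<Sigma>] show ?case
      by (simp add: V_def transpose_def vec_eq_iff)
  qed
  have V_bounded: "bounded_in_prob M V"
  proof -
    have "bounded_in_prob M (\<lambda>z. coordinates lower_triangle (mU z) (V z) j)" if "j \<in> ?JU" for j
      using expandU(1)[OF that] by (simp add: s_def[symmetric] coordU[OF that])
    from this[of "Inr _"] have entry: "bounded_in_prob M (\<lambda>z. V z $ fst c $ snd c)" if "c \<in> lower_triangle" for c
      using that by simp
    let ?N = "\<lambda>z. \<Sum>c\<in>lower_triangle. norm (V z $ fst c $ snd c)"
    have "bounded_in_prob M ?N" by (rule bounded_in_prob_sum[OF entry])
    moreover have "\<forall>\<^sub>F z in ?\<F>. norm (V z) \<le> real (CARD('p) * CARD('p)) * norm (?N z)"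
      using V_sym
    proof eventually_elim
      case (elim z)
      have "\<bar>V z $ i $ j\<bar> \<le> ?N z" for i j
      proof -
        define c where "c = (if j \<le> i then (i, j) else (j, i))"
        have "V z $ i $ j = V z $ fst c $ snd c" using sym_nth[OF elim, of i j] by (simp add: c_def)
        moreover have "norm (V z $ fst c $ snd c) \<le> ?N z"
          by (rule member_le_sum) (auto simp: c_def lower_triangle_def)
        ultimately show ?thesis by simp
      qed
      then have "(\<Sum>i\<in>UNIV. \<Sum>j\<in>UNIV. \<bar>V z $ i $ j\<bar>) \<le> (\<Sum>i\<in>(UNIV::'p set). \<Sum>j\<in>(UNIV::'p set). ?N z)"
        by (intro sum_mono)
      then show ?case
        using matrix_norm_le_sum[of "V z"] by (simp add: sum_nonneg mult.assoc)
    qed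
    ultimately show ?thesis by (rule bounded_in_prob_dominated)
  qed
  note plug_in = plug_in_expansion[OF \<Sigma> K SU_lim SU_spd V_bounded[unfolded V_def], folded V_def \<Delta>P_def]

  have \<Delta>P_graph: "\<forall>\<^sub>F z in ?\<F>. \<Delta>P z \<in> sym_graph E"
    using SU_spd
  proof eventually_elim
    case (elim z)
    have "matrix_inv (h_graph E (SU z)) - matrix_inv \<Sigma> \<in> sym_graph E"
      using h_graph_inv[OF elim] K by (intro subspace_diff[OF subspace_sym_graph]) (auto simp: spd_graph_eq)
    then show ?case unfolding \<Delta>P_def by (rule subspace_scale[OF subspace_sym_graph])
  qed
  have \<Delta>G_graph: "\<Delta>G z \<in> sym_graph E" for z
    unfolding \<Delta>G_def using KG_graph[of z] K
    by (intro subspace_scale[OF subspace_sym_graph] subspace_diff[OF subspace_sym_graph]) (auto simp: spd_graph_eq)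
  note psi = psi_inverse_parameter[OF \<Sigma> K]
  \<comment> \<open>The same expansion as in \<open>G\<close>, now for the plug-in estimator
    measured through the inverse of its completion.\<close>
  have plug_in_G: "((\<lambda>z. ?ZG j z + P.apply_G j (mU z) (\<Delta>P z)) \<longlongrightarrow> 0) ?\<F>"
    if j: "j \<in> ?JG" for j
  proof (cases j)
    case (Inl i)
    show ?thesis
    proof -
      have "P.apply_U (Inl i) (mU z) (V z) = P.apply_G (Inl i) (mU z) (\<Delta>P z)" for z
        by (rule P.apply_location[symmetric])
      then show ?thesis using U[of "Inl i"] by (simp only: Inl psi Inl_mem_Plus)
    qed
  next
    case (Inr d)
    then have d: "d \<in> graph_positions E" and d': "d \<in> lower_triangle"
      using j graph_positions_lower by auto
    \<comment> \<open>Linearity splits the first term into \<open>op_U\<close> of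
      \<open>V z\<close>, which cancels against \<open>apply_U\<close>, and \<open>op_G\<close> of
      \<open>\<Delta>P z\<close>. The opposite signs of the two estimating functions turn the rest
      into the graphical expansion.\<close>
    have "((\<lambda>z. P.op_U P.\<kappa> (V z + \<Sigma> ** \<Delta>P z ** \<Sigma>) $ fst d $ snd d
        - (?Z (Inr d) z + P.apply_U (Inr d) (mU z) (V z))) \<longlongrightarrow> 0 - 0) ?\<F>"
      using d' by (intro tendsto_diff P.op_U_tendsto[OF plug_in(2) d] U) simp
    then have "((\<lambda>z. P.op_U P.\<kappa> (V z + \<Sigma> ** \<Delta>P z ** \<Sigma>) $ fst d $ snd d
        - (?Z (Inr d) z + P.apply_U (Inr d) (mU z) (V z))) \<longlongrightarrow> 0) ?\<F>"
      by simp
    moreover have "\<forall>\<^sub>F z in ?\<F>. P.op_U P.\<kappa> (V z + \<Sigma> ** \<Delta>P z ** \<Sigma>) $ fst d $ snd d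
        - (?Z (Inr d) z + P.apply_U (Inr d) (mU z) (V z))
        = ?ZG j z + P.apply_G j (mU z) (\<Delta>P z)"
      using V_sym \<Delta>P_graph
    proof eventually_elim
      case (elim z)
      have "?ZG (Inr d) z = - ?Z (Inr d) z"
        unfolding psi(2)[OF d] by (simp add: I.sample_mean_def sum_negf)
      then show ?case
        unfolding Inr P.apply_U_scatter[OF elim(1) d'] P.apply_G_scatter[OF elim(2) d] P.op_G_op_U linear_add[OF P.linear_op_U] by simp
    qed
    ultimately show ?thesis by (rule Lim_transform_eventually)
  qed

  \<comment> \<open>Subtracting the two expansions removes the common random term
    \<open>?ZG\<close>, leaving the graphical derivative matrix applied to the difference; its
    trivial kernel finishes.\<close>
  have diff: "((\<lambda>z. coordinates (graph_positions E) (mU z) (\<Delta>P z) k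
      - coordinates (graph_positions E) (mG z) (\<Delta>G z) k) \<longlongrightarrow> 0) ?\<F>" if "k \<in> ?JG" for k
  proof (rule tendsto_lower_bound[OF kerG _ that])
    fix j assume "j \<in> ?JG"
    from tendsto_diff[OF plug_in_G[OF this] G[OF this]]
    show "((\<lambda>z. \<Sum>k\<in>?JG. P.\<beta>\<^sub>G j k * (coordinates (graph_positions E) (mU z) (\<Delta>P z) k
        - coordinates (graph_positions E) (mG z) (\<Delta>G z) k)) \<longlongrightarrow> 0) ?\<F>"
      by (simp add: right_diff_distrib sum_subtractf)
  qed
  have location: "((\<lambda>z. mU z - mG z) \<longlongrightarrow> 0) ?\<F>"
    by (rule vec_tendstoI) (use diff[of "Inl _"] in simp)
  have scatter: "((\<lambda>z. \<Delta>P z - \<Delta>G z) \<longlongrightarrow> 0) ?\<F>"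
  proof (rule tendsto_symmetric_matrix[where K = "graph_positions E"])
    show "\<forall>\<^sub>F z in ?\<F>. transpose (\<Delta>P z - \<Delta>G z) = \<Delta>P z - \<Delta>G z \<and> supported_on (graph_positions E) (\<Delta>P z - \<Delta>G z)"
      using \<Delta>P_graph
    proof eventually_elim
      case (elim z)
      from subspace_diff[OF subspace_sym_graph this \<Delta>G_graph[of z]] show ?case
        by (simp only: sym_graph_iff)
    qed
    show "((\<lambda>z. (\<Delta>P z - \<Delta>G z) $ fst c $ snd c) \<longlongrightarrow> 0 $ fst c $ snd c) ?\<F>" if "c \<in> graph_positions E" for c
      using diff[of "Inr c"] that by simp
  qed (simp_all add: transpose_def vec_eq_iff supported_on_def)

  have SM_lim: "((\<lambda>z. matrix_inv (KG z)) \<longlongrightarrow> \<Sigma>) ?\<F>"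
    using tendsto_matrix_inv[OF KG_lim spd_invertible[OF spd_inv_spd[OF \<Sigma>]]]
    by (simp add: matrix_inv_matrix_inv_spd[OF \<Sigma>])
  \<comment> \<open>Return from inverses to scatter matrices. The two outer factors converge to
    \<open>\<Sigma>\<close>, so the rescaled difference of the scatter matrices vanishes with that
    of the inverses.\<close>
  have "((\<lambda>z. - (h_graph E (SU z) ** (\<Delta>P z - \<Delta>G z) ** matrix_inv (KG z))) \<longlongrightarrow> - (\<Sigma> ** 0 ** \<Sigma>)) ?\<F>"
    by (intro tendsto_intros plug_in(1) scatter SM_lim)
  then have "((\<lambda>z. - (h_graph E (SU z) ** (\<Delta>P z - \<Delta>G z) ** matrix_inv (KG z))) \<longlongrightarrow> 0) ?\<F>"
    by simp
  moreover have "\<forall>\<^sub>F z in ?\<F>. - (h_graph E (SU z) ** (\<Delta>P z - \<Delta>G z) ** matrix_inv (KG z))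
      = s z *\<^sub>R (h_graph E (SU z) - S\<^sub>M (fst z) (snd z))"
    using SU_spd KG_eq
  proof eventually_elim
    case (elim z)
    let ?B = "h_graph E (SU z)" and ?SM = "S\<^sub>M (fst z) (snd z)"
    have B: "?B \<in> spd" by (rule h_graph_spd[OF elim(1)])
    have SM: "?SM \<in> spd" and KG: "KG z = matrix_inv ?SM" using elim(2) by auto
    have "?B - ?SM = - (?B ** (matrix_inv ?B - matrix_inv ?SM) ** ?SM)"
      using matrix_inv_diff[of "matrix_inv ?B" "matrix_inv ?SM"] B SM
      by (simp add: spd_invertible spd_inv_spd matrix_inv_matrix_inv_spd)
    moreover have "\<Delta>P z - \<Delta>G z = s z *\<^sub>R (matrix_inv ?B - matrix_inv ?SM)"
      by (simp add: \<Delta>P_def \<Delta>G_def KG scaleR_diff_right)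
    ultimately show ?case
      using SM by (simp add: KG matrix_inv_matrix_inv_spd
          bounded_bilinear.scaleR_left[OF bounded_bilinear_matrix_mult]
          bounded_bilinear.scaleR_right[OF bounded_bilinear_matrix_mult])
  qed
  ultimately have scatter': "((\<lambda>z. s z *\<^sub>R (h_graph E (SU z) - S\<^sub>M (fst z) (snd z))) \<longlongrightarrow> 0) ?\<F>"
    by (rule Lim_transform_eventually)
  have vec_mat: "bounded_linear (vec_mat :: real ^ 'p::{finite,linorder} ^ 'p::{finite,linorder} \<Rightarrow> _)"
    using linear_vec_mat by (simp add: linear_conv_bounded_linear)

  show ?thesis
  proof (rule tendsto_in_probI)
    fix n
    have meas: "\<mu>\<^sub>n n \<in> borel_measurable M" "S\<^sub>n n \<in> borel_measurable M" "\<mu>\<^sub>M n \<in> borel_measurable M"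
        "S\<^sub>M n \<in> borel_measurable M" "\<And>\<omega>. \<omega> \<in> space M \<Longrightarrow> S\<^sub>n n \<omega> \<in> spd"
      using assms(12,13) by (auto simp: estimator_sequence_def)
    have [measurable]: "(\<lambda>\<omega>. vec_mat (h_graph E (S\<^sub>n n \<omega>))) \<in> borel_measurable M"
      by (rule borel_measurable_continuous_on_spd[OF _ meas(2,5)])
        (intro bounded_linear.continuous_on[OF vec_mat] continuous_on_h_graph)
    have [measurable]: "(\<lambda>\<omega>. vec_mat (S\<^sub>M n \<omega>)) \<in> borel_measurable M"
      by (rule borel_measurable_continuous_on[OF _ meas(4)]) (intro linear_continuous_on vec_mat)
    note [measurable] = meas(1,3)
    show "(\<lambda>\<omega>. sqrt (real n) *\<^sub>R ((\<mu>\<^sub>n n \<omega>, vec_mat (h_graph E (S\<^sub>n n \<omega>))) - (\<mu>\<^sub>M n \<omega>, vec_mat (S\<^sub>M n \<omega>))))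
        \<in> borel_measurable M"
      by measurable
  next
    have "((\<lambda>z. (mU z - mG z, vec_mat (s z *\<^sub>R (h_graph E (SU z) - S\<^sub>M (fst z) (snd z))))) \<longlongrightarrow> (0, vec_mat 0)) ?\<F>"
      by (intro tendsto_Pair location bounded_linear.tendsto[OF vec_mat] scatter')
    then show "((\<lambda>z. sqrt (real (fst z)) *\<^sub>R
        ((\<mu>\<^sub>n (fst z) (snd z), vec_mat (h_graph E (S\<^sub>n (fst z) (snd z)))) - (\<mu>\<^sub>M (fst z) (snd z), vec_mat (S\<^sub>M (fst z) (snd z))))) \<longlongrightarrow> 0) ?\<F>"
      by (simp add: mU_def mG_def SU_def s_def linear_0[OF linear_vec_mat] linear_diff[OF linear_vec_mat]
          linear_scale[OF linear_vec_mat] scaleR_diff_right zero_prod_def)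
  qed
qed


end
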